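(* Let $\mathcal{A}\in\mathbb{R}^{n\times n\times p}$ be T-SPD with T-eigenvalues $\lambda_1\ge\lambda_2\ge\cdots\ge\lambda_d>0$, where $d=np$. Fix integers $k\ge 1$ (target rank), $\ell\ge 2$ (oversampling) and $q\ge 0$ (power-iteration count), with $k+\ell\le d$. Let $M:=\operatorname{bcirc}(\mathcal{A})$ and let $Q\in\mathbb{R}^{d\times(k+\ell)}$ be the matrix with orthonormal columns produced by the T-product randomized subspace iteration with parameters $(k,\ell,q)$. Then $$\mathbb{E}\,\|M-QQ^{\mathsf T}M\|_2\;\le\;\Biggl[\Bigl(1+4\sqrt{\tfrac{k+\ell}{\ell-1}}\Bigr)\lambda_{k+1}^{\,q+1}+\frac{e\sqrt{k+\ell}}{\ell}\Bigl(\sum_{j>k}\lambda_j^{\,2(q+1)}\Bigr)^{1/2}\Biggr]^{1/(q+1)},$$ where the expectation is over the Gaussian sketch $\Omega$ and $\|\cdot\|_2$ is the spectral norm. In particular, as $q\to\infty$ (with $\mathcal{A},k,\ell$ fixed) the right-hand side converges to $\lambda_{k+1}$.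
   Context: For $\mathcal{A}\in\mathbb{R}^{n\times n\times p}$ with frontal slices $\mathcal{A}^{(1)},\dots,\mathcal{A}^{(p)}\in\mathbb{R}^{n\times n}$, $\operatorname{bcirc}(\mathcal{A})\in\mathbb{R}^{np\times np}$ is the block circulant matrix whose $(i,j)$ block ($1\le i,j\le p$) is $\mathcal{A}^{(((i-j)\bmod p)+1)}$. The tensor $\mathcal{A}$ is T-SPD if $\operatorname{bcirc}(\mathcal{A})$ is symmetric positive definite. The T-eigenvalues of $\mathcal{A}$ are the eigenvalues of $\operatorname{bcirc}(\mathcal{A})$, counted with multiplicity. T-product randomized subspace iteration with parameters $(k,\ell,q)$ (exact arithmetic): draw $\Omega\in\mathbb{R}^{d\times(k+\ell)}$ with i.i.d. $\mathcal{N}(0,1)$ entries; set $Y=M\Omega$; for $i=1,\dots,q$ let $Q_i$ be the orthonormal factor of a thin QR factorization of $Y$ and replace $Y$ by $MQ_i$; finally let $Q$ be the orthonormal factor of a thin QR factorization of $Y$. (So $Q$ has $k+\ell$ orthonormal columns, almost surely spanning the column space of the final $Y$.) *)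

theory Defs
  imports
    "HOL-Probability.Probability"
    "Jordan_Normal_Form.Char_Poly"
begin

text \<open>A third-order tensor is the list of its frontal slices. The list is indexed from 0, so the
  slice usually written with superscript \<open>s + 1\<close> is \<open>A ! s\<close>; rows and columns of matrices are also
  indexed from 0.\<close>

type_synonym tensor = "real mat list"

definition carrier_tensor :: "nat \<Rightarrow> nat \<Rightarrow> nat \<Rightarrow> tensor set" where
  "carrier_tensor n m p = {A. length A = p \<and> set A \<subseteq> carrier_mat n m}"

text \<open>The entry \<open>(r, c)\<close> lies in block \<open>(r div n, c div n)\<close>. The block difference is taken in
  \<^typ>\<open>int\<close>, since subtraction on \<^typ>\<open>nat\<close> truncates.\<close>

definition bcirc :: "nat \<Rightarrow> tensor \<Rightarrow> real mat" where
  "bcirc n A = (let p = length A in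
     Matrix.mat (n * p) (n * p) (\<lambda>(r, c).
       A ! nat ((int (r div n) - int (c div n)) mod int p) $$ (r mod n, c mod n)))"

definition symmetric_positive_definite :: "real mat \<Rightarrow> bool" where
  "symmetric_positive_definite M \<longleftrightarrow>
     M \<in> carrier_mat (dim_row M) (dim_row M) \<and> transpose_mat M = M \<and>
     (\<forall>v \<in> carrier_vec (dim_row M). v \<noteq> 0\<^sub>v (dim_row M) \<longrightarrow> 0 < scalar_prod v (M *\<^sub>v v))"

definition T_SPD :: "nat \<Rightarrow> tensor \<Rightarrow> bool" where
  "T_SPD n A \<longleftrightarrow> symmetric_positive_definite (bcirc n A)"

text \<open>The roots are taken over the complex numbers because the block circulant matrix of an
  arbitrary real tensor need not have real eigenvalues.\<close>

definition T_eigenvalues :: "nat \<Rightarrow> tensor \<Rightarrow> complex multiset" where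
  "T_eigenvalues n A = proots (char_poly (map_mat complex_of_real (bcirc n A)))"

definition euclidean_norm :: "real vec \<Rightarrow> real" where
  "euclidean_norm v = sqrt (scalar_prod v v)"

definition spectral_norm :: "real mat \<Rightarrow> real" where
  "spectral_norm B = (SUP v \<in> {v \<in> carrier_vec (dim_col B). euclidean_norm v \<le> 1}.
     euclidean_norm (B *\<^sub>v v))"

definition standard_gaussian_matrix ::
    "'w measure \<Rightarrow> nat \<Rightarrow> nat \<Rightarrow> ('w \<Rightarrow> real mat) \<Rightarrow> bool" where
  "standard_gaussian_matrix P d m Omega \<longleftrightarrow>
     (\<forall>\<omega> \<in> space P. Omega \<omega> \<in> carrier_mat d m) \<and>
     prob_space.indep_vars P (\<lambda>_. borel) (\<lambda>ij \<omega>. Omega \<omega> $$ ij) ({..<d} \<times> {..<m}) \<and>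
     (\<forall>ij \<in> {..<d} \<times> {..<m}.
        distributed P lborel (\<lambda>\<omega>. Omega \<omega> $$ ij) (\<lambda>x. ennreal (std_normal_density x)))"

definition thin_QR :: "real mat \<Rightarrow> real mat \<Rightarrow> real mat \<Rightarrow> bool" where
  "thin_QR Y Q R \<longleftrightarrow>
     Q \<in> carrier_mat (dim_row Y) (dim_col Y) \<and> R \<in> carrier_mat (dim_col Y) (dim_col Y) \<and>
     transpose_mat Q * Q = 1\<^sub>m (dim_col Y) \<and> upper_triangular R \<and> Y = Q * R"

text \<open>A thin QR factorization is not unique (signs; more freedom if \<open>Y\<close> is rank deficient), so
  the iteration is a relation between the sketch and all its possible outcomes.
  \<open>subspace_iterate M Om i Y\<close>: the working matrix may be \<open>Y\<close> after \<open>i\<close> power steps.\<close>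

inductive subspace_iterate :: "real mat \<Rightarrow> real mat \<Rightarrow> nat \<Rightarrow> real mat \<Rightarrow> bool"
  for M Om where
  init: "subspace_iterate M Om 0 (M * Om)"
| step: "subspace_iterate M Om i Y \<Longrightarrow> thin_QR Y Q R \<Longrightarrow> subspace_iterate M Om (Suc i) (M * Q)"

definition subspace_iteration_output ::
    "real mat \<Rightarrow> real mat \<Rightarrow> nat \<Rightarrow> real mat \<Rightarrow> bool" where
  "subspace_iteration_output M Om q Q \<longleftrightarrow> (\<exists>Y R. subspace_iterate M Om q Y \<and> thin_QR Y Q R)"

definition approximation_error :: "real mat \<Rightarrow> real mat \<Rightarrow> real" where
  "approximation_error M Q = spectral_norm (M - Q * transpose_mat Q * M)"

text \<open>The choice of QR factors may depend on the sample point in a non-measurable way. The error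
  is nevertheless almost surely determined by the sketch, hence measurable for the completion of
  the probability space. For a \<open>P\<close>-measurable error this is the ordinary expectation by
  \<open>integral_completion\<close>.\<close>

definition expected_error ::
    "'w measure \<Rightarrow> real mat \<Rightarrow> ('w \<Rightarrow> real mat) \<Rightarrow> real" where
  "expected_error P M Q = integral\<^sup>L (completion P) (\<lambda>\<omega>. approximation_error M (Q \<omega>))"

definition error_bound :: "nat \<Rightarrow> nat \<Rightarrow> nat \<Rightarrow> (nat \<Rightarrow> real) \<Rightarrow> nat \<Rightarrow> real" where
  "error_bound d k l lam q =
     ((1 + 4 * sqrt (real (k + l) / (real l - 1))) * lam (k + 1) ^ (q + 1)
      + exp 1 * sqrt (real (k + l)) / real l
        * sqrt (\<Sum>j = k + 1..d. lam j ^ (2 * (q + 1)))) powr (1 / real (q + 1))"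

end

theory Submission
  imports Defs
begin

text \<open>Write \<open>B = M ^ (q + 1) = U \<Sigma> U\<^sup>T\<close>, \<open>m = k + l\<close>, and let \<open>G\<^sub>1\<close>, \<open>G\<^sub>2\<close> be the first \<open>k\<close> and the remaining rows of
  the Gaussian matrix \<open>U\<^sup>T \<Omega>\<close>. The range of \<open>Q\<close> contains that of \<open>B \<Omega>\<close>, which gives
  \<open>\<parallel>M - Q Q\<^sup>T M\<parallel> ^ (q + 1) \<le> \<parallel>B - Q Q\<^sup>T B\<parallel> \<le> \<lambda>\<^sub>k\<^sub>+\<^sub>1 ^ (q + 1) + \<parallel>N\<parallel>\<close> with \<open>N = \<Sigma>\<^sub>2 G\<^sub>2 G\<^sub>1\<^sup>\<dagger>\<close>.

  The usual treatment bounds the expectation of \<open>\<parallel>N\<parallel>\<close> by Chevet's inequality and a tail bound for the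
  smallest singular value of \<open>G\<^sub>1\<close>. Both are avoided here. For an independent Gaussian test vector \<open>z\<close>
  and a standard normal variable \<open>g\<close> one has \<open>\<parallel>N\<parallel> ^ r * E \<bar>g\<bar> ^ r \<le> E\<^sub>z \<bar>N z\<bar> ^ r\<close>, and \<open>\<bar>N z\<bar>\<close> has the law of
  \<open>\<bar>\<Sigma>\<^sub>2 h\<bar> * \<bar>z\<bar> / \<chi>\<close> with independent Gaussian vectors \<open>h\<close>, \<open>z\<close> and \<open>\<chi>\<close> the norm of a Gaussian vector in dimension
  \<open>l + 1\<close>. For \<open>r = l - 1\<close> the moments combine to \<open>E \<chi> ^ (- r) = E \<bar>g\<bar> ^ r / r!\<close>. Together with
  \<open>(E \<bar>\<Sigma>\<^sub>2 h\<bar> ^ r) ^ (1 / r) \<le> \<parallel>\<Sigma>\<^sub>2\<parallel>\<^sub>F + sqrt r * \<parallel>\<Sigma>\<^sub>2\<parallel>\<close> and \<open>r! \<ge> (l / e) ^ r\<close> this gives the stated constants.\<close>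

section \<open>Gaussian measures on finite products\<close>

text \<open>The exponent r = l - 1 is singled out by two facts. After a rotation, and conditionally
  on the other rows, the distance of one row of \<open>G\<^sub>1\<close> from their span is the norm
  \<chi> of a Gaussian vector in dimension r + 2, and in this dimension the integral for E
  \<chi>^(-r) has an elementary antiderivative. Legendre's duplication formula turns the value into
  E |g|^r / r!, so the price E |g|^r of replacing the operator norm by a random test vector cancels
  and only 1 / r! survives. Gaussian moments are kept as nonnegative integrals, where infinite
  values cause no harm; only the bounded error and quantities derived from it are integrated as real
  functions. Jensen's inequality with exponents r and q + 1 then leads back to first moments. The
  outcome \<open>Q\<close> is an arbitrary selection among QR factorizations, so the error may fail
  to be measurable. Almost surely it equals an expression in adjugates and determinants of the
  sketch, which makes it measurable for the completion.\<close>

lemma product_sigma_finite_lborel: "product_sigma_finite (\<lambda>_. lborel :: real measure)"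
  by (simp add: product_sigma_finite_def lborel.sigma_finite_measure_axioms)

lemma distr_lborel_reflect_translate:
  fixes s t :: real
  assumes "\<bar>s\<bar> = 1"
  shows "distr lborel borel (\<lambda>x. t + s * x) = lborel"
proof -
  have "s \<noteq> 0" using assms by auto
  from lborel_real_affine[OF this, of t] assms show ?thesis
    by (simp add: density_1)
qed

text \<open>The sign \<open>s\<close> covers translations and point reflections at once; these are
  the only changes of variables that the uniqueness argument below applies directly to Lebesgue
  measure.\<close>

lemma nn_integral_PiM_lborel_reflect_translate:
  fixes f :: "('i \<Rightarrow> real) \<Rightarrow> ennreal"
  assumes I: "finite I" and s: "\<bar>s\<bar> = 1"
    and f[measurable]: "f \<in> borel_measurable (Pi\<^sub>M I (\<lambda>_. lborel))"
  shows "(\<integral>\<^sup>+x. f (\<lambda>i\<in>I. y i + s * x i) \<partial>Pi\<^sub>M I (\<lambda>_. lborel)) = integral\<^sup>N (Pi\<^sub>M I (\<lambda>_. lborel)) f"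
proof -
  let ?L = "Pi\<^sub>M I (\<lambda>_. lborel :: real measure)"
  let ?g = "\<lambda>x. \<lambda>i\<in>I. y i + s * x i"
  interpret product_sigma_finite "\<lambda>_. lborel :: real measure" by (rule product_sigma_finite_lborel)
  have g[measurable]: "?g \<in> measurable ?L ?L" by measurable
  have "distr ?L ?L ?g = ?L"
  proof (rule PiM_eqI[OF I])
    fix A :: "'i \<Rightarrow> real set" assume A: "\<And>i. i \<in> I \<Longrightarrow> A i \<in> sets lborel"
    have *: "?g -` Pi\<^sub>E I A \<inter> space ?L = Pi\<^sub>E I (\<lambda>i. (\<lambda>x. y i + s * x) -` A i)"
      by (auto simp: space_PiM PiE_iff)
    have "emeasure (distr ?L ?L ?g) (Pi\<^sub>E I A) = emeasure ?L (Pi\<^sub>E I (\<lambda>i. (\<lambda>x. y i + s * x) -` A i))"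
      using A I by (subst emeasure_distr) (auto simp: * intro!: sets_PiM_I_finite)
    also have "\<dots> = (\<Prod>i\<in>I. emeasure lborel ((\<lambda>x. y i + s * x) -` A i))"
      using A I by (subst emeasure_PiM) (auto intro!: measurable_sets_borel[of _ borel])
    also have "\<dots> = (\<Prod>i\<in>I. emeasure lborel (A i))"
    proof (rule prod.cong[OF refl])
      fix i assume "i \<in> I"
      have "emeasure lborel (A i) = emeasure (distr lborel borel (\<lambda>x. y i + s * x)) (A i)"
        by (simp add: distr_lborel_reflect_translate[OF s])
      also have "\<dots> = emeasure lborel ((\<lambda>x. y i + s * x) -` A i)"
        using A[OF \<open>i \<in> I\<close>] by (subst emeasure_distr) auto
      finally show "emeasure lborel ((\<lambda>x. y i + s * x) -` A i) = emeasure lborel (A i)" by simp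
    qed
    finally show "emeasure (distr ?L ?L ?g) (Pi\<^sub>E I A) = (\<Prod>i\<in>I. emeasure lborel (A i))" .
  qed simp
  then have "integral\<^sup>N ?L f = integral\<^sup>N (distr ?L ?L ?g) f" by simp
  also have "\<dots> = (\<integral>\<^sup>+x. f (?g x) \<partial>?L)" by (rule nn_integral_distr) auto
  finally show ?thesis by simp
qed

text \<open>Weil's uniqueness argument for translation invariant measures: pair \<open>f \<circ> T\<close> with a \<open>T\<close>-invariant
  weight \<open>g\<close> of integral 1.\<close>

lemma nn_integral_PiM_lborel_isometry:
  fixes f g :: "('i \<Rightarrow> real) \<Rightarrow> ennreal"
  assumes I: "finite I"
    and f[measurable]: "f \<in> borel_measurable (Pi\<^sub>M I (\<lambda>_. lborel))"
    and g[measurable]: "g \<in> borel_measurable (Pi\<^sub>M I (\<lambda>_. lborel))"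
    and T[measurable]: "T \<in> measurable (Pi\<^sub>M I (\<lambda>_. lborel)) (Pi\<^sub>M I (\<lambda>_. lborel))"
    and g1: "integral\<^sup>N (Pi\<^sub>M I (\<lambda>_. lborel)) g = 1"
    and gT: "\<And>x. x \<in> extensional I \<Longrightarrow> g (T x) = g x"
    and TT': "\<And>x y. x \<in> extensional I \<Longrightarrow> y \<in> extensional I \<Longrightarrow>
      T (\<lambda>i\<in>I. - T' y i + x i) = (\<lambda>i\<in>I. - y i + T x i)"
  shows "(\<integral>\<^sup>+x. f (T x) \<partial>Pi\<^sub>M I (\<lambda>_. lborel)) = integral\<^sup>N (Pi\<^sub>M I (\<lambda>_. lborel)) f"
proof -
  let ?L = "Pi\<^sub>M I (\<lambda>_. lborel :: real measure)"
  interpret product_sigma_finite "\<lambda>_. lborel :: real measure" by (rule product_sigma_finite_lborel)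
  interpret L: sigma_finite_measure ?L by (rule sigma_finite[OF I])
  interpret LL: pair_sigma_finite ?L ?L by standard
  have sp: "space ?L = extensional I" by (auto simp: space_PiM PiE_def)
  have Tx: "T x \<in> extensional I" if "x \<in> extensional I" for x
    using measurable_space[OF T, of x] that by (simp add: sp)
  have add[measurable]: "(\<lambda>(x, y). \<lambda>i\<in>I. y i + x i) \<in> measurable (?L \<Otimes>\<^sub>M ?L) ?L"
    by measurable
  have sub[measurable]: "(\<lambda>(x, y). \<lambda>i\<in>I. - y i + x i) \<in> measurable (?L \<Otimes>\<^sub>M ?L) ?L"
    by measurable
  have tr: "(\<integral>\<^sup>+x. h (\<lambda>i\<in>I. y i + x i) \<partial>?L) = integral\<^sup>N ?L h" if "h \<in> borel_measurable ?L" for h y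
    using nn_integral_PiM_lborel_reflect_translate[OF I _ that, of 1] by simp
  have rf: "(\<integral>\<^sup>+x. h (\<lambda>i\<in>I. - x i + y i) \<partial>?L) = integral\<^sup>N ?L h" if "h \<in> borel_measurable ?L" for h y
    using nn_integral_PiM_lborel_reflect_translate[OF I _ that, of "-1" y] by (simp add: add.commute)
  have eq: "(\<lambda>i\<in>I. y i + T (\<lambda>i\<in>I. - T' y i + x i) i) = T x"
    if "x \<in> extensional I" "y \<in> extensional I" for x y
    using Tx[OF that(1)] by (subst TT'[OF that]) (auto simp: fun_eq_iff extensional_def)
  have "(\<integral>\<^sup>+x. f (T x) \<partial>?L) = (\<integral>\<^sup>+x. f (T x) * (\<integral>\<^sup>+y. g (\<lambda>i\<in>I. y i + T x i) \<partial>?L) \<partial>?L)"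
    by (simp add: tr[OF g, of "T x" for x, unfolded add.commute[of "T _ _"]] g1)
  also have "\<dots> = (\<integral>\<^sup>+x. (\<integral>\<^sup>+y. f (T x) * g (\<lambda>i\<in>I. y i + T x i) \<partial>?L) \<partial>?L)"
    by (intro nn_integral_cong nn_integral_cmult[symmetric]) measurable
  also have "\<dots> = (\<integral>\<^sup>+y. (\<integral>\<^sup>+x. f (T x) * g (\<lambda>i\<in>I. y i + T x i) \<partial>?L) \<partial>?L)"
    by (rule LL.Fubini'[symmetric]) measurable
  \<comment> \<open>For fixed \<open>y\<close> the variable \<open>x\<close> is translated by
    \<open>- T' y\<close>. By \<open>TT'\<close> this changes \<open>T x\<close> into
    \<open>T x - y\<close>, so the argument of \<open>g\<close> becomes \<open>T x\<close>.\<close>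
  also have "\<dots> = (\<integral>\<^sup>+y. (\<integral>\<^sup>+x. f (T (\<lambda>i\<in>I. - T' y i + x i)) * g (\<lambda>i\<in>I. y i + T (\<lambda>i\<in>I. - T' y i + x i) i) \<partial>?L) \<partial>?L)"
    by (intro nn_integral_cong tr[symmetric]) measurable
  also have "\<dots> = (\<integral>\<^sup>+y. (\<integral>\<^sup>+x. f (\<lambda>i\<in>I. - y i + T x i) * g (T x) \<partial>?L) \<partial>?L)"
    by (intro nn_integral_cong, subst eq) (simp_all add: TT'[simplified] sp)
  also have "\<dots> = (\<integral>\<^sup>+x. (\<integral>\<^sup>+y. f (\<lambda>i\<in>I. - y i + T x i) * g (T x) \<partial>?L) \<partial>?L)"
    by (rule LL.Fubini') measurable
  \<comment> \<open>As a function of \<open>y\<close>, the point \<open>T x - y\<close> is a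
    reflection followed by a translation, so the inner integral of \<open>f\<close> does not depend
    on \<open>x\<close>.\<close>
  also have "\<dots> = (\<integral>\<^sup>+x. integral\<^sup>N ?L f * g (T x) \<partial>?L)"
    by (intro nn_integral_cong) (simp add: nn_integral_multc rf[simplified])
  also have "\<dots> = (\<integral>\<^sup>+x. integral\<^sup>N ?L f * g x \<partial>?L)"
    by (intro nn_integral_cong) (simp add: gT sp)
  also have "\<dots> = integral\<^sup>N ?L f" by (simp add: nn_integral_cmult g1)
  finally show ?thesis .
qed

definition std_normal :: "real measure" where
  "std_normal = density lborel (\<lambda>x. ennreal (std_normal_density x))"

definition gaussian :: "'i set \<Rightarrow> ('i \<Rightarrow> real) measure" where
  "gaussian I = Pi\<^sub>M I (\<lambda>_. std_normal)"

lemma prob_space_std_normal: "prob_space std_normal"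
  unfolding std_normal_def by (rule prob_space_normal_density) simp

lemma sets_std_normal[measurable_cong, simp]: "sets std_normal = sets borel"
  by (simp add: std_normal_def)

lemma space_std_normal[simp]: "space std_normal = UNIV"
  by (simp add: std_normal_def)

lemma sets_gaussian[measurable_cong]: "sets (gaussian I) = sets (Pi\<^sub>M I (\<lambda>_. borel))"
  unfolding gaussian_def by (intro sets_PiM_cong) simp_all

lemma space_gaussian: "space (gaussian I) = extensional I"
  by (auto simp: gaussian_def space_PiM PiE_def)

lemma borel_measurable_gaussian_component:
  "p \<in> D \<Longrightarrow> (\<lambda>x. x p) \<in> borel_measurable (gaussian D)"
  by measurable

lemma product_prob_space_std_normal: "product_prob_space (\<lambda>_. std_normal)"
  by (intro product_prob_spaceI prob_space_std_normal)

lemma prob_space_gaussian: "prob_space (gaussian I)"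
  unfolding gaussian_def by (intro prob_space_PiM prob_space_std_normal)

lemma nn_integral_std_normal:
  "f \<in> borel_measurable borel \<Longrightarrow>
    integral\<^sup>N std_normal f = (\<integral>\<^sup>+x. ennreal (std_normal_density x) * f x \<partial>lborel)"
  unfolding std_normal_def by (subst nn_integral_density) auto

lemma nn_integral_gaussian_prod:
  assumes "finite I" "\<And>i. i \<in> I \<Longrightarrow> f i \<in> borel_measurable borel"
  shows "(\<integral>\<^sup>+x. (\<Prod>i\<in>I. f i (x i)) \<partial>gaussian I) = (\<Prod>i\<in>I. integral\<^sup>N std_normal (f i))"
proof -
  interpret product_prob_space "\<lambda>_. std_normal" by (rule product_prob_space_std_normal)
  show ?thesis unfolding gaussian_def
    using assms by (intro product_nn_integral_prod) (auto simp: measurable_def)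
qed

lemma nn_integral_gaussian_component:
  assumes I: "finite I" "i \<in> I" and f: "f \<in> borel_measurable borel"
  shows "(\<integral>\<^sup>+x. f (x i) \<partial>gaussian I) = integral\<^sup>N std_normal f"
proof -
  interpret prob_space std_normal by (rule prob_space_std_normal)
  have "(\<integral>\<^sup>+x. f (x i) \<partial>gaussian I) = (\<integral>\<^sup>+x. (\<Prod>j\<in>I. (if j = i then f else (\<lambda>_. 1)) (x j)) \<partial>gaussian I)"
    by (simp add: if_distrib[of "\<lambda>f. f _"] I cong: if_cong)
  also have "\<dots> = (\<Prod>j\<in>I. integral\<^sup>N std_normal (if j = i then f else (\<lambda>_. 1)))"
    using I f by (subst nn_integral_gaussian_prod) auto
  also have "\<dots> = (\<Prod>j\<in>I. if j = i then integral\<^sup>N std_normal f else 1)"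
    by (intro prod.cong refl) (auto simp: emeasure_space_1[simplified])
  finally show ?thesis using I by simp
qed

lemma gaussian_density:
  assumes I: "finite I"
  shows "gaussian I = density (Pi\<^sub>M I (\<lambda>_. lborel)) (\<lambda>x. \<Prod>i\<in>I. ennreal (std_normal_density (x i)))"
proof -
  interpret G: product_prob_space "\<lambda>_. std_normal" by (rule product_prob_space_std_normal)
  interpret L: product_sigma_finite "\<lambda>_. lborel :: real measure" by (rule product_sigma_finite_lborel)
  have "density (Pi\<^sub>M I (\<lambda>_. lborel)) (\<lambda>x. \<Prod>i\<in>I. ennreal (std_normal_density (x i))) = Pi\<^sub>M I (\<lambda>_. std_normal)"
    (is "?D = _")
  proof (rule G.PiM_eqI[OF I])
    show "sets ?D = sets (Pi\<^sub>M I (\<lambda>_. std_normal))"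
      by (simp, intro sets_PiM_cong) simp_all
    fix A :: "'a \<Rightarrow> real set" assume "\<And>i. i \<in> I \<Longrightarrow> A i \<in> sets std_normal"
    then have A: "\<And>i. i \<in> I \<Longrightarrow> A i \<in> sets borel" by simp
    have "emeasure ?D (Pi\<^sub>E I A) = (\<integral>\<^sup>+x. (\<Prod>i\<in>I. ennreal (std_normal_density (x i))) * indicator (Pi\<^sub>E I A) x \<partial>Pi\<^sub>M I (\<lambda>_. lborel))"
      using A I by (intro emeasure_density) (auto intro!: sets_PiM_I_finite)
    also have "\<dots> = (\<integral>\<^sup>+x. (\<Prod>i\<in>I. ennreal (std_normal_density (x i)) * indicator (A i) (x i)) \<partial>Pi\<^sub>M I (\<lambda>_. lborel))"
    proof (rule nn_integral_cong)
      fix x assume "x \<in> space (Pi\<^sub>M I (\<lambda>_. lborel :: real measure))"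
      then have "indicator (Pi\<^sub>E I A) x = (\<Prod>i\<in>I. indicator (A i) (x i) :: ennreal)"
        using I by (auto simp: indicator_def space_PiM PiE_iff prod_eq_1_iff  split: if_splits)
      then show "(\<Prod>i\<in>I. ennreal (std_normal_density (x i))) * indicator (Pi\<^sub>E I A) x
        = (\<Prod>i\<in>I. ennreal (std_normal_density (x i)) * indicator (A i) (x i))"
        by (simp add: prod.distrib)
    qed
    also have "\<dots> = (\<Prod>i\<in>I. \<integral>\<^sup>+x. ennreal (std_normal_density x) * indicator (A i) x \<partial>lborel)"
      using A I by (intro L.product_nn_integral_prod[OF I]) auto
    also have "\<dots> = (\<Prod>i\<in>I. emeasure std_normal (A i))"
      using A by (intro prod.cong refl) (simp add: std_normal_def emeasure_density)
    finally show "emeasure ?D (Pi\<^sub>E I A) = (\<Prod>i\<in>I. emeasure std_normal (A i))" .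
  qed
  then show ?thesis by (simp add: gaussian_def)
qed

lemma prod_std_normal_density:
  "finite I \<Longrightarrow> (\<Prod>i\<in>I. std_normal_density (x i)) = (1 / sqrt (2 * pi)) ^ card I * exp (- (\<Sum>i\<in>I. (x i)\<^sup>2) / 2)"
  by (simp add: std_normal_density_def prod_dividef prod.distrib exp_sum[symmetric] sum_negf sum_divide_distrib power_divide)

text \<open>The Gaussian density itself serves as the invariant weight: it depends on
  \<open>x\<close> only through the sum of squares and has integral 1. The Lebesgue statement is
  then applied to the density times \<open>f\<close>.\<close>

lemma nn_integral_gaussian_isometry:
  fixes f :: "('i \<Rightarrow> real) \<Rightarrow> ennreal"
  assumes I: "finite I"
    and f: "f \<in> borel_measurable (gaussian I)"
    and T: "T \<in> measurable (gaussian I) (gaussian I)"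
    and norm: "\<And>x. x \<in> extensional I \<Longrightarrow> (\<Sum>i\<in>I. (T x i)\<^sup>2) = (\<Sum>i\<in>I. (x i)\<^sup>2)"
    and TT': "\<And>x y. x \<in> extensional I \<Longrightarrow> y \<in> extensional I \<Longrightarrow>
      T (\<lambda>i\<in>I. - T' y i + x i) = (\<lambda>i\<in>I. - y i + T x i)"
  shows "(\<integral>\<^sup>+x. f (T x) \<partial>gaussian I) = integral\<^sup>N (gaussian I) f"
proof -
  let ?L = "Pi\<^sub>M I (\<lambda>_. lborel :: real measure)"
  define g :: "('i \<Rightarrow> real) \<Rightarrow> ennreal" where "g x = (\<Prod>i\<in>I. ennreal (std_normal_density (x i)))" for x
  have sL: "sets (gaussian I) = sets ?L" unfolding sets_gaussian by (intro sets_PiM_cong) simp_all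
  have f'[measurable]: "f \<in> borel_measurable ?L" using f by (simp cong: measurable_cong_sets add: sL)
  have T'[measurable]: "T \<in> measurable ?L ?L" using T by (simp cong: measurable_cong_sets add: sL)
  have g[measurable]: "g \<in> borel_measurable ?L" unfolding g_def by measurable
  have gT: "g (T x) = g x" if "x \<in> extensional I" for x
    unfolding g_def by (simp add: prod_ennreal prod_std_normal_density[OF I] norm[OF that])
  have dens: "gaussian I = density ?L g" unfolding g_def by (rule gaussian_density[OF I])
  interpret prob_space "gaussian I" by (rule prob_space_gaussian)
  have "integral\<^sup>N ?L g = (\<integral>\<^sup>+x. 1 \<partial>gaussian I)" unfolding dens by (subst nn_integral_density) auto
  also have "\<dots> = 1" by (simp add: emeasure_space_1)
  finally have g1: "integral\<^sup>N ?L g = 1" .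
  have Tx: "T x \<in> extensional I" if "x \<in> extensional I" for x
    using measurable_space[OF T, of x] that by (simp add: space_gaussian)
  have "(\<integral>\<^sup>+x. f (T x) \<partial>gaussian I) = (\<integral>\<^sup>+x. g x * f (T x) \<partial>?L)"
    unfolding dens by (rule nn_integral_density) measurable
  also have "\<dots> = (\<integral>\<^sup>+x. g (T x) * f (T x) \<partial>?L)"
    by (intro nn_integral_cong) (simp add: gT space_PiM PiE_def)
  also have "\<dots> = (\<integral>\<^sup>+x. g x * f x \<partial>?L)"
    by (rule nn_integral_PiM_lborel_isometry[OF I _ g T' g1 gT TT', of "\<lambda>x. g x * f x"]) measurable
  also have "\<dots> = integral\<^sup>N (gaussian I) f"
    unfolding dens by (rule nn_integral_density[symmetric]) measurable
  finally show ?thesis .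
qed

text \<open>Here \<open>T'\<close> is the transpose. Orthonormal columns give preservation of the
  norm, orthonormal rows give that \<open>T'\<close> is a right inverse.\<close>

lemma nn_integral_gaussian_orthogonal:
  fixes f :: "('i \<Rightarrow> real) \<Rightarrow> ennreal" and v :: "'i \<Rightarrow> 'i \<Rightarrow> real"
  assumes I: "finite I" and f: "f \<in> borel_measurable (gaussian I)"
    and rows: "\<And>i i'. i \<in> I \<Longrightarrow> i' \<in> I \<Longrightarrow> (\<Sum>j\<in>I. v i j * v i' j) = (if i = i' then 1 else 0)"
    and cols: "\<And>j j'. j \<in> I \<Longrightarrow> j' \<in> I \<Longrightarrow> (\<Sum>i\<in>I. v i j * v i j') = (if j = j' then 1 else 0)"
  shows "(\<integral>\<^sup>+x. f (\<lambda>i\<in>I. \<Sum>j\<in>I. v i j * x j) \<partial>gaussian I) = integral\<^sup>N (gaussian I) f"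
proof (rule nn_integral_gaussian_isometry[where T' = "\<lambda>y j. \<Sum>i\<in>I. v i j * y i", OF I f])
  show "(\<lambda>x. \<lambda>i\<in>I. \<Sum>j\<in>I. v i j * x j) \<in> gaussian I \<rightarrow>\<^sub>M gaussian I"
    by measurable
next
  fix x :: "'i \<Rightarrow> real"
  have "(\<Sum>i\<in>I. (\<Sum>j\<in>I. v i j * x j)\<^sup>2) = (\<Sum>i\<in>I. \<Sum>j\<in>I. \<Sum>j'\<in>I. (v i j * v i j') * (x j * x j'))"
    by (simp add: power2_eq_square sum_product mult_ac)
  also have "\<dots> = (\<Sum>j\<in>I. \<Sum>j'\<in>I. \<Sum>i\<in>I. (v i j * v i j') * (x j * x j'))"
    by (subst sum.swap, rule sum.cong[OF refl], rule sum.swap)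
  also have "\<dots> = (\<Sum>j\<in>I. \<Sum>j'\<in>I. (if j = j' then 1 else 0) * (x j * x j'))"
    by (intro sum.cong refl) (simp add: sum_distrib_right[symmetric] cols)
  also have "\<dots> = (\<Sum>j\<in>I. (x j)\<^sup>2)"
    using I by (intro sum.cong refl) (simp add: if_distrib[of "\<lambda>a. a * _"] power2_eq_square cong: if_cong)
  finally show "(\<Sum>i\<in>I. ((\<lambda>i\<in>I. \<Sum>j\<in>I. v i j * x j) i)\<^sup>2) = (\<Sum>i\<in>I. (x i)\<^sup>2)" by simp
next
  fix x y :: "'i \<Rightarrow> real"
  have *: "(\<Sum>j\<in>I. v i j * (\<Sum>i'\<in>I. v i' j * y i')) = y i" if "i \<in> I" for i
  proof -
    have "(\<Sum>j\<in>I. v i j * (\<Sum>i'\<in>I. v i' j * y i')) = (\<Sum>i'\<in>I. (\<Sum>j\<in>I. v i j * v i' j) * y i')"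
      by (simp add: sum_distrib_left sum_distrib_right mult_ac, rule sum.swap)
    also have "\<dots> = (\<Sum>i'\<in>I. (if i = i' then 1 else 0) * y i')"
      using that by (intro sum.cong refl) (simp add: rows)
    also have "\<dots> = y i" using I that by (simp add: if_distrib[of "\<lambda>a. a * _"] cong: if_cong)
    finally show ?thesis .
  qed
  show "(\<lambda>i\<in>I. \<Sum>j\<in>I. v i j * (\<lambda>i\<in>I. - (\<Sum>i'\<in>I. v i' i * y i') + x i) j) =
    (\<lambda>i\<in>I. - y i + (\<lambda>i\<in>I. \<Sum>j\<in>I. v i j * x j) i)"
    by (rule ext) (simp add: right_diff_distrib sum_subtractf *)
qed

section \<open>Moments of Gaussian vectors\<close>

lemma nn_integral_std_normal_exp_square:
  fixes a :: real
  assumes a: "a < 1 / 2"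
  shows "(\<integral>\<^sup>+x. ennreal (exp (a * x\<^sup>2)) \<partial>std_normal) = ennreal (1 / sqrt (1 - 2 * a))"
proof -
  define b where "b = 1 - 2 * a"
  have b: "b > 0" using a by (simp add: b_def)
  have eq: "std_normal_density x * exp (a * x\<^sup>2) = 1 / sqrt b * normal_density 0 (1 / sqrt b) x" for x
  proof -
    have "- (b * x\<^sup>2 / 2) = - x\<^sup>2 / 2 + a * x\<^sup>2" by (simp add: b_def field_simps)
    moreover have "sqrt (2 * pi * (1 / b)) = sqrt (2 * pi) / sqrt b" by (simp add: real_sqrt_mult real_sqrt_divide)
    ultimately show ?thesis using b
      by (simp add: normal_density_def exp_add[symmetric] power_divide field_simps)
  qed
  have "(\<integral>\<^sup>+x. ennreal (exp (a * x\<^sup>2)) \<partial>std_normal) =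
      (\<integral>\<^sup>+x. ennreal (1 / sqrt b) * ennreal (normal_density 0 (1 / sqrt b) x) \<partial>lborel)"
    using b by (subst nn_integral_std_normal) (auto simp: ennreal_mult[symmetric] eq simp del: real_sqrt_gt_0_iff)
  also have "\<dots> = ennreal (1 / sqrt b) * (\<integral>\<^sup>+x. ennreal (normal_density 0 (1 / sqrt b) x) \<partial>lborel)"
    by (rule nn_integral_cmult) measurable
  also have "(\<integral>\<^sup>+x. ennreal (normal_density 0 (1 / sqrt b) x) \<partial>lborel) = 1"
    using b by (subst nn_integral_eq_integral) auto
  finally show ?thesis by (simp add: b_def)
qed

lemma nn_integral_gaussian_exp_quadratic:
  assumes I: "finite I" and a: "\<And>i. i \<in> I \<Longrightarrow> a i < 1 / 2"
  shows "(\<integral>\<^sup>+x. ennreal (exp (\<Sum>i\<in>I. a i * (x i)\<^sup>2)) \<partial>gaussian I) = ennreal (\<Prod>i\<in>I. 1 / sqrt (1 - 2 * a i))"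
proof -
  have "(\<integral>\<^sup>+x. ennreal (exp (\<Sum>i\<in>I. a i * (x i)\<^sup>2)) \<partial>gaussian I) =
      (\<integral>\<^sup>+x. (\<Prod>i\<in>I. ennreal (exp (a i * (x i)\<^sup>2))) \<partial>gaussian I)"
    by (simp add: prod_ennreal exp_sum I)
  also have "\<dots> = (\<Prod>i\<in>I. ennreal (1 / sqrt (1 - 2 * a i)))"
    using a by (subst nn_integral_gaussian_prod[OF I]) (auto simp: nn_integral_std_normal_exp_square)
  also have "\<dots> = ennreal (\<Prod>i\<in>I. 1 / sqrt (1 - 2 * a i))"
    using a by (intro prod_ennreal) (force simp: field_simps)
  finally show ?thesis .
qed

text \<open>Chernoff's method with parameter \<open>r / (2 Y)\<close>; this value makes the two exponential factors cancel exactly.\<close>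

lemma nn_integral_gaussian_weighted_norm_power_le:
  fixes s :: "'i \<Rightarrow> real" and S :: real
  assumes I: "finite I" and r: "r \<ge> 1" and S: "\<And>i. i \<in> I \<Longrightarrow> (s i)\<^sup>2 \<le> S" "0 \<le> S"
  shows "(\<integral>\<^sup>+x. ennreal (sqrt (\<Sum>i\<in>I. (s i)\<^sup>2 * (x i)\<^sup>2) ^ r) \<partial>gaussian I)
    \<le> ennreal (sqrt ((\<Sum>i\<in>I. (s i)\<^sup>2) + r * S) ^ r)"
proof (cases "(\<Sum>i\<in>I. (s i)\<^sup>2) = 0")
  case True
  then have "\<forall>i\<in>I. s i = 0" using I by (simp add: sum_nonneg_eq_0_iff)
  then show ?thesis using r by (simp add: power_0_left)
next
  case False
  define F where "F = (\<Sum>i\<in>I. (s i)\<^sup>2)"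
  define Y where "Y = F + r * S"
  define \<theta> where "\<theta> = r / (2 * Y)"
  have F: "F > 0" using False by (simp add: F_def sum_nonneg less_le)
  have Y: "Y > 0" "Y \<ge> F" using F S r by (auto simp: Y_def add_pos_nonneg)
  \<comment> \<open>This is where \<open>Y = F + r * S\<close> comes from: every factor
    \<open>1 - 2 * \<theta> * (s i)^2\<close> is at least \<open>F / Y\<close>, so the product of
    the inverse square roots is at most exp (\<theta> * F / (F / Y)) = exp (\<theta> * Y) = exp (r /
    2).\<close>
  have U: "1 - 2 * \<theta> * S = F / Y" using Y by (simp add: \<theta>_def field_simps Y_def)
  have th: "\<theta> > 0" using Y r by (simp add: \<theta>_def)
  have u: "2 * \<theta> * (s i)\<^sup>2 \<le> 2 * \<theta> * S" if "i \<in> I" for i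
    using S(1)[OF that] th by simp
  have FY: "F / Y > 0" using F Y by simp
  have small: "\<theta> * (s i)\<^sup>2 < 1 / 2" if "i \<in> I" for i
    using u[OF that] U FY by linarith
  \<comment> \<open>The inequality u \<le> exp (u - 1) at u = X / Y, raised to the power r /
    2.\<close>
  have pt: "sqrt X ^ r \<le> sqrt (Y / exp 1) ^ r * exp (\<theta> * X)" if "X \<ge> 0" for X
  proof -
    have "X / Y \<le> exp (X / Y - 1)" using exp_ge_add_one_self[of "X / Y - 1"] by simp
    then have "Y * (X / Y) \<le> Y * exp (X / Y - 1)" using Y by (intro mult_left_mono) auto
    then have "X \<le> Y / exp 1 * exp (X / Y)" using Y by (simp add: exp_diff)
    then have "sqrt X \<le> sqrt (Y / exp 1 * exp (X / Y))" by simp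
    also have "\<dots> = sqrt (Y / exp 1) * exp (X / Y / 2)"
      by (simp only: real_sqrt_mult) (simp add: real_sqrt_unique[of "exp (X / Y / 2)"] power2_eq_square exp_add[symmetric])
    finally have "sqrt X ^ r \<le> (sqrt (Y / exp 1) * exp (X / Y / 2)) ^ r"
      using that by (intro power_mono) auto
    then show ?thesis by (simp add: power_mult_distrib exp_of_nat_mult[symmetric] \<theta>_def field_simps)
  qed
  have one: "1 / sqrt (1 - u) \<le> exp (u / (2 * (F / Y)))" if "0 \<le> u" "u \<le> 2 * \<theta> * S" for u
  proof -
    have "1 - u \<ge> F / Y" using that U by linarith
    then have u1: "1 - u > 0" using FY by linarith
    have "1 / (1 - u) = 1 + u / (1 - u)" using u1 by (simp add: field_simps)
    also have "\<dots> \<le> 1 + u / (F / Y)"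
      using divide_left_mono[OF \<open>1 - u \<ge> F / Y\<close> that(1) mult_pos_pos[OF u1 FY]] by simp
    also have "\<dots> \<le> exp (u / (F / Y))" by (rule exp_ge_add_one_self)
    finally have "sqrt (1 / (1 - u)) \<le> sqrt (exp (u / (F / Y)))" by simp
    also have "\<dots> = exp (u / (F / Y) / 2)"
      by (rule real_sqrt_unique) (auto simp: power2_eq_square exp_add[symmetric])
    finally show ?thesis by (simp add: real_sqrt_divide mult.commute)
  qed
  have "(\<integral>\<^sup>+x. ennreal (sqrt (\<Sum>i\<in>I. (s i)\<^sup>2 * (x i)\<^sup>2) ^ r) \<partial>gaussian I)
    \<le> (\<integral>\<^sup>+x. ennreal (sqrt (Y / exp 1) ^ r) * ennreal (exp (\<Sum>i\<in>I. (\<theta> * (s i)\<^sup>2) * (x i)\<^sup>2)) \<partial>gaussian I)"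
    using Y by (intro nn_integral_mono)
      (auto simp: ennreal_mult[symmetric] sum_distrib_left mult.assoc intro!: ennreal_leI order_trans[OF pt] sum_nonneg)
  also have "\<dots> = ennreal (sqrt (Y / exp 1) ^ r) * (\<integral>\<^sup>+x. ennreal (exp (\<Sum>i\<in>I. (\<theta> * (s i)\<^sup>2) * (x i)\<^sup>2)) \<partial>gaussian I)"
    by (rule nn_integral_cmult) measurable
  also have "(\<integral>\<^sup>+x. ennreal (exp (\<Sum>i\<in>I. (\<theta> * (s i)\<^sup>2) * (x i)\<^sup>2)) \<partial>gaussian I)
     = ennreal (\<Prod>i\<in>I. 1 / sqrt (1 - 2 * (\<theta> * (s i)\<^sup>2)))"
    by (rule nn_integral_gaussian_exp_quadratic[OF I]) (rule small)
  also have "ennreal (sqrt (Y / exp 1) ^ r) * \<dots> \<le> ennreal (sqrt (Y / exp 1) ^ r) * ennreal (\<Prod>i\<in>I. exp (2 * \<theta> * (s i)\<^sup>2 / (2 * (F / Y))))"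
  proof (intro mult_left_mono ennreal_leI prod_mono conjI)
    fix i assume i: "i \<in> I"
    show "0 \<le> 1 / sqrt (1 - 2 * (\<theta> * (s i)\<^sup>2))" using small[OF i] by simp
    show "1 / sqrt (1 - 2 * (\<theta> * (s i)\<^sup>2)) \<le> exp (2 * \<theta> * (s i)\<^sup>2 / (2 * (F / Y)))"
      using one[of "2 * \<theta> * (s i)\<^sup>2"] u[OF i] th by (simp add: mult.assoc)
  qed simp
  also have "(\<Prod>i\<in>I. exp (2 * \<theta> * (s i)\<^sup>2 / (2 * (F / Y)))) = exp (1 / 2) ^ r"
  proof -
    have "(\<Prod>i\<in>I. exp (2 * \<theta> * (s i)\<^sup>2 / (2 * (F / Y)))) = exp (2 * \<theta> * F / (2 * (F / Y)))"
      by (simp add: exp_sum[symmetric] I F_def sum_divide_distrib sum_distrib_left)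
    also have "2 * \<theta> * F / (2 * (F / Y)) = of_nat r * (1 / 2)" using F Y by (simp add: \<theta>_def field_simps)
    finally show ?thesis by (simp only: exp_of_nat_mult)
  qed
  also have "ennreal (sqrt (Y / exp 1) ^ r) * ennreal (exp (1 / 2) ^ r) = ennreal (sqrt Y ^ r)"
  proof -
    have "exp (1 / 2) = sqrt (exp 1 :: real)"
      by (rule real_sqrt_unique[symmetric]) (auto simp: power2_eq_square exp_add[symmetric])
    then have "sqrt (Y / exp 1) * exp (1 / 2) = sqrt Y" by (simp add: real_sqrt_divide)
    then show ?thesis using Y by (simp add: ennreal_mult[symmetric] power_mult_distrib[symmetric])
  qed
  finally show ?thesis by (simp add: Y_def F_def)
qed

text \<open>E |g|^r for a standard normal g: the double factorial (r - 1)!! for even r, and sqrt (2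
  / pi) times (r - 1)!! for odd r.\<close>

definition abs_moment :: "nat \<Rightarrow> real" where
  "abs_moment r = (if even r then fact r / (2 ^ (r div 2) * fact (r div 2))
     else sqrt (2 / pi) * 2 ^ (r div 2) * fact (r div 2))"

lemma abs_moment_pos: "abs_moment r > 0"
  by (simp add: abs_moment_def)

lemma nn_integral_abs_moment: "(\<integral>\<^sup>+x. ennreal (\<bar>x\<bar> ^ r) \<partial>std_normal) = ennreal (abs_moment r)"
proof -
  have "has_bochner_integral lborel (\<lambda>x. std_normal_density x * \<bar>x\<bar> ^ r) (abs_moment r)"
  proof (cases "even r")
    case True
    then show ?thesis using std_normal_moment_even[of "r div 2"]
      by (simp add: abs_moment_def power_even_abs)
  next
    case False
    then show ?thesis using std_normal_moment_abs_odd[of "r div 2"]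
      by (simp add: abs_moment_def)
  qed
  then have "(\<integral>\<^sup>+x. ennreal (std_normal_density x * \<bar>x\<bar> ^ r) \<partial>lborel) = ennreal (abs_moment r)"
    by (simp add: has_bochner_integral_iff nn_integral_eq_integral)
  then show ?thesis by (subst nn_integral_std_normal) (auto simp: ennreal_mult)
qed

text \<open>Up to a constant this is \<open>y powr (- r / 2)\<close>, written as a mixture of exponentials so that its
  Gaussian expectation factorizes. At \<open>y = 0\<close> the value is infinite.\<close>

definition exp_mixture :: "nat \<Rightarrow> real \<Rightarrow> ennreal" where
  "exp_mixture r y = (\<integral>\<^sup>+t. ennreal (t ^ (r - 1) * exp (- (t\<^sup>2 * y))) * indicator {0..} t \<partial>lborel)"

lemma exp_mixture_antimono: "x \<le> y \<Longrightarrow> exp_mixture r y \<le> exp_mixture r x"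
  unfolding exp_mixture_def
  by (intro nn_integral_mono) (auto simp: indicator_def intro!: ennreal_leI mult_left_mono)

lemma exp_mixture_measurable[measurable]: "exp_mixture r \<in> borel_measurable borel"
  unfolding exp_mixture_def by measurable

text \<open>The substitution t -> sqrt y * t shows that \<open>exp_mixture r\<close> is homogeneous
  of degree - r / 2. Stated as a product, it avoids negative powers and division in
  \<open>ennreal\<close>.\<close>

lemma exp_mixture_scale:
  assumes r: "r \<ge> 1" and y: "y > 0"
  shows "exp_mixture r 1 = ennreal (sqrt y ^ r) * exp_mixture r y"
proof -
  have eq: "ennreal ((sqrt y * t) ^ (r - 1) * exp (- ((sqrt y * t)\<^sup>2 * 1)))
    = ennreal (sqrt y ^ (r - 1)) * ennreal (t ^ (r - 1) * exp (- (t\<^sup>2 * y)))" if "t \<ge> 0" for t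
    using that y by (subst ennreal_mult[symmetric]) (auto simp: power_mult_distrib mult_ac)
  have "exp_mixture r 1 = \<bar>sqrt y\<bar> * (\<integral>\<^sup>+t. ennreal ((0 + sqrt y * t) ^ (r - 1) * exp (- ((0 + sqrt y * t)\<^sup>2 * 1))) * indicator {0..} (0 + sqrt y * t) \<partial>lborel)"
    unfolding exp_mixture_def using y by (intro nn_integral_real_affine) auto
  also have "\<dots> = ennreal (sqrt y) * (\<integral>\<^sup>+t. ennreal (sqrt y ^ (r - 1)) * (ennreal (t ^ (r - 1) * exp (- (t\<^sup>2 * y))) * indicator {0..} t) \<partial>lborel)"
  proof (rule arg_cong2[where f = "(*)"], goal_cases)
    case 2
    show ?case
    proof (rule nn_integral_cong)
    fix t
    have "indicator {0..} (0 + sqrt y * t) = (indicator {0..} t :: ennreal)"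
      using y by (auto simp: indicator_def zero_le_mult_iff)
    then show "ennreal ((0 + sqrt y * t) ^ (r - 1) * exp (- ((0 + sqrt y * t)\<^sup>2 * 1))) * indicator {0..} (0 + sqrt y * t)
      = ennreal (sqrt y ^ (r - 1)) * (ennreal (t ^ (r - 1) * exp (- (t\<^sup>2 * y))) * indicator {0..} t)"
      by (cases "t \<ge> 0") (simp only: add_0_left eq mult.assoc, simp)
    qed
  qed (use y in simp)
  also have "\<dots> = ennreal (sqrt y) * (ennreal (sqrt y ^ (r - 1)) * exp_mixture r y)"
    unfolding exp_mixture_def by (subst nn_integral_cmult) auto
  also have "\<dots> = ennreal (sqrt y ^ r) * exp_mixture r y"
    using y r by (cases r) (auto simp: mult.assoc[symmetric] ennreal_mult[symmetric])
  finally show ?thesis .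
qed

text \<open>The integral is Gamma (r / 2) / 2. Expressing it through \<open>fact r\<close> and
  \<open>abs_moment r\<close> amounts to the duplication formula, which is verified separately for
  even and odd \<open>r\<close>.\<close>

lemma exp_mixture_one:
  assumes r: "r \<ge> 1"
  shows "exp_mixture r 1 = ennreal (fact r / (r * sqrt 2 ^ r * abs_moment r))"
proof (cases "even r")
  case True
  then have "r = 2 * ((r - 2) div 2) + 2" using r by presburger
  then obtain j where j: "r = 2 * j + 2" by blast
  have "has_bochner_integral lborel (\<lambda>x. indicator {0..} x *\<^sub>R (exp (- x\<^sup>2) * x ^ (2 * j + 1))) (fact j / 2 :: real)"
    by (rule gaussian_moment_odd_pos)
  then have "(\<integral>\<^sup>+x. ennreal (indicator {0..} x *\<^sub>R (exp (- x\<^sup>2) * x ^ (2 * j + 1))) \<partial>lborel) = ennreal (fact j / 2)"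
    by (subst nn_integral_eq_integral) (auto simp: has_bochner_integral_iff indicator_def)
  also have "(\<integral>\<^sup>+x. ennreal (indicator {0..} x *\<^sub>R (exp (- x\<^sup>2) * x ^ (2 * j + 1))) \<partial>lborel) = exp_mixture r 1"
    unfolding exp_mixture_def by (intro nn_integral_cong) (auto simp: indicator_def j mult.commute)
  finally have em: "exp_mixture r 1 = ennreal (fact j / 2)" .
  have s: "sqrt 2 ^ r = (2::real) ^ (j + 1)" unfolding j by (simp add: power_add power_mult)
  have "r div 2 = j + 1" by (simp add: j)
  then have am: "abs_moment r = fact r / (2 ^ (j + 1) * fact (j + 1))"
    unfolding abs_moment_def using True by simp
  have cancel: "N / (R * P * (N / (P * M))) = M / R" if "N \<noteq> 0" "P \<noteq> 0" for N R P M :: real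
    using that by simp
  have cancel2: "a * f / (2 * a) = f / 2" if "a \<noteq> 0" for a f :: real using that by simp
  have "fact r / (r * sqrt 2 ^ r * abs_moment r) = fact (j + 1) / r"
    unfolding s am by (rule cancel) auto
  also have "\<dots> = (real j + 1) * fact j / (2 * (real j + 1))"
    by (rule arg_cong2[where f = "(/)"]) (simp_all add: j algebra_simps)
  also have "\<dots> = fact j / 2" using cancel2[of "real j + 1"] by simp
  finally have "fact r / (r * sqrt 2 ^ r * abs_moment r) = fact j / 2" .
  then show ?thesis unfolding em by (intro arg_cong[of _ _ ennreal]) (rule sym)
next
  case False
  then obtain j where j: "r = 2 * j + 1" by (elim oddE)
  have "has_bochner_integral lborel (\<lambda>x. indicator {0..} x *\<^sub>R (exp (- x\<^sup>2) * x ^ (2 * j))) (sqrt pi / 2 * (fact (2 * j) / (2 ^ (2 * j) * fact j)))"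
    by (rule gaussian_moment_even_pos)
  then have "(\<integral>\<^sup>+x. ennreal (indicator {0..} x *\<^sub>R (exp (- x\<^sup>2) * x ^ (2 * j))) \<partial>lborel) = ennreal (sqrt pi / 2 * (fact (2 * j) / (2 ^ (2 * j) * fact j)))"
    by (subst nn_integral_eq_integral) (auto simp: has_bochner_integral_iff indicator_def)
  also have "(\<integral>\<^sup>+x. ennreal (indicator {0..} x *\<^sub>R (exp (- x\<^sup>2) * x ^ (2 * j))) \<partial>lborel) = exp_mixture r 1"
    unfolding exp_mixture_def by (intro nn_integral_cong) (auto simp: indicator_def j mult.commute)
  finally have *: "exp_mixture r 1 = ennreal (sqrt pi / 2 * (fact (2 * j) / (2 ^ (2 * j) * fact j)))" .
  have s: "sqrt 2 ^ r = (2::real) ^ j * sqrt 2" unfolding j by (simp add: power_add power_mult)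
  have fr: "fact r = real r * fact (2 * j)" by (simp add: j)
  have am: "abs_moment r = sqrt (2 / pi) * 2 ^ j * fact j" by (simp add: j abs_moment_def)
  have "fact r / (r * sqrt 2 ^ r * abs_moment r) = fact (2 * j) / (2 ^ j * (sqrt 2 * sqrt (2 / pi)) * 2 ^ j * fact j)"
    unfolding s using r fr am by (simp add: mult_ac del: fact_Suc)
  also have "sqrt 2 * sqrt (2 / pi) = 2 / sqrt pi" by (simp add: real_sqrt_divide)
  also have "fact (2 * j) / (2 ^ j * (2 / sqrt pi) * 2 ^ j * fact j) = sqrt pi / 2 * (fact (2 * j) / (2 ^ (2 * j) * fact j))"
  proof -
    have *: "N / (P * (2 / w) * P * f) = w / 2 * (N / (P * P * f))" for N P w f :: real by (simp add: mult_ac)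
    have "(2::real) ^ (2 * j) = 2 ^ j * 2 ^ j" unfolding mult_2 by (rule power_add)
    then show ?thesis unfolding * by simp
  qed
  finally show ?thesis using * by simp
qed

text \<open>After Fubini the integrand is t^(r - 1) * (1 + 2 t^2)^(- (r + 2) / 2). Since t / sqrt (1
  + 2 t^2) has derivative (1 + 2 t^2)^(- 3 / 2), an antiderivative is \<open>F\<close>; this is
  special to r + 2 coordinates and dictates the choice of \<open>r\<close>.\<close>

lemma nn_integral_gaussian_exp_mixture:
  assumes I: "finite I" and JI: "J \<subseteq> I" and J: "card J = r + 2" and r: "r \<ge> 1"
  shows "(\<integral>\<^sup>+x. exp_mixture r (\<Sum>i\<in>J. (x i)\<^sup>2) \<partial>gaussian I) = ennreal (1 / (r * sqrt 2 ^ r))"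
proof -
  interpret prob_space "gaussian I" by (rule prob_space_gaussian)
  interpret pair_sigma_finite "gaussian I" "lborel :: real measure"
    by (intro pair_sigma_finite.intro sigma_finite_measure_axioms lborel.sigma_finite_measure_axioms)
  have neg: "-1 < t\<^sup>2 * 2" for t :: real by (rule order.strict_trans2[of _ 0]) auto
  have JI': "i \<in> I" if "i \<in> J" for i using that JI by auto
  have [measurable]: "(\<lambda>x. x i) \<in> borel_measurable (gaussian I)" if "i \<in> J" for i
    using JI'[OF that] by measurable
  have fJ: "finite J" using I JI finite_subset by blast
  define F where "F t = (t / sqrt (1 + 2 * t\<^sup>2)) ^ r / r" for t :: real
  have pos: "1 + 2 * t\<^sup>2 > 0" for t :: real by (simp add: add_pos_nonneg)
  have inner: "(\<integral>\<^sup>+x. ennreal (exp (- (t\<^sup>2 * (\<Sum>i\<in>J. (x i)\<^sup>2)))) \<partial>gaussian I) = ennreal (1 / sqrt (1 + 2 * t\<^sup>2) ^ (r + 2))" for t :: real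
  proof -
    let ?a = "\<lambda>i. if i \<in> J then - t\<^sup>2 else 0"
    have "(\<integral>\<^sup>+x. ennreal (exp (- (t\<^sup>2 * (\<Sum>i\<in>J. (x i)\<^sup>2)))) \<partial>gaussian I) = (\<integral>\<^sup>+x. ennreal (exp (\<Sum>i\<in>I. ?a i * (x i)\<^sup>2)) \<partial>gaussian I)"
      using I JI by (simp add: sum_distrib_left sum_negf[symmetric] if_distrib[of "\<lambda>a. a * _"] sum.If_cases Int_absorb1 Int_commute cong: if_cong)
    also have "\<dots> = ennreal (\<Prod>i\<in>I. 1 / sqrt (1 - 2 * ?a i))"
      by (intro nn_integral_gaussian_exp_quadratic[OF I]) (simp add: neg)
    also have "(\<Prod>i\<in>I. 1 / sqrt (1 - 2 * ?a i)) = (\<Prod>i\<in>I. if i \<in> J then 1 / sqrt (1 + 2 * t\<^sup>2) else 1)"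
      by (intro prod.cong) auto
    also have "\<dots> = 1 / sqrt (1 + 2 * t\<^sup>2) ^ (r + 2)"
      using I JI J by (simp add: prod.If_cases Int_absorb1 power_divide)
    finally show ?thesis .
  qed
  have "(\<integral>\<^sup>+x. exp_mixture r (\<Sum>i\<in>J. (x i)\<^sup>2) \<partial>gaussian I)
    = (\<integral>\<^sup>+t. \<integral>\<^sup>+x. ennreal (t ^ (r - 1) * exp (- (t\<^sup>2 * (\<Sum>i\<in>J. (x i)\<^sup>2)))) * indicator {0..} t \<partial>gaussian I \<partial>lborel)"
    unfolding exp_mixture_def
    by (rule Fubini'[symmetric]) measurable
  also have "\<dots> = (\<integral>\<^sup>+t. ennreal (t ^ (r - 1) / sqrt (1 + 2 * t\<^sup>2) ^ (r + 2)) * indicator {0..} t \<partial>lborel)"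
  proof (rule nn_integral_cong)
    fix t :: real
    show "(\<integral>\<^sup>+x. ennreal (t ^ (r - 1) * exp (- (t\<^sup>2 * (\<Sum>i\<in>J. (x i)\<^sup>2)))) * indicator {0..} t \<partial>gaussian I)
      = ennreal (t ^ (r - 1) / sqrt (1 + 2 * t\<^sup>2) ^ (r + 2)) * indicator {0..} t"
    proof (cases "t \<ge> 0")
      case True
      have "(\<integral>\<^sup>+x. ennreal (t ^ (r - 1) * exp (- (t\<^sup>2 * (\<Sum>i\<in>J. (x i)\<^sup>2)))) * indicator {0..} t \<partial>gaussian I)
        = (\<integral>\<^sup>+x. ennreal (t ^ (r - 1)) * ennreal (exp (- (t\<^sup>2 * (\<Sum>i\<in>J. (x i)\<^sup>2)))) \<partial>gaussian I)"
        using True by (intro nn_integral_cong) (auto simp: ennreal_mult)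
      also have "\<dots> = ennreal (t ^ (r - 1)) * ennreal (1 / sqrt (1 + 2 * t\<^sup>2) ^ (r + 2))"
        by (subst nn_integral_cmult) (simp_all add: inner)
      finally show ?thesis using True pos[of t] by (simp add: ennreal_mult[symmetric] less_imp_le)
    qed simp
  qed
  also have "\<dots> = ennreal (1 / (r * sqrt 2 ^ r) - F 0)"
  proof (rule nn_integral_FTC_atLeast)
    fix t :: real assume t: "0 \<le> t"
    define q where "q = sqrt (1 + 2 * t\<^sup>2)"
    have q: "q > 0" "q\<^sup>2 = 1 + 2 * t\<^sup>2" using pos[of t] by (auto simp: q_def less_imp_le)
    have "DERIV (\<lambda>t. t / sqrt (1 + 2 * t\<^sup>2)) t :> (q - t * (4 * t * inverse q / 2)) / (q * q)"
      unfolding q_def using pos[of t] by (auto intro!: derivative_eq_intros)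
    also have "(q - t * (4 * t * inverse q / 2)) / (q * q) = (q\<^sup>2 - 2 * t\<^sup>2) / q ^ 3"
      using q(1) by (simp add: field_simps power2_eq_square power3_eq_cube)
    also have "\<dots> = 1 / q ^ 3" by (simp add: q(2))
    finally have d: "DERIV (\<lambda>t. t / sqrt (1 + 2 * t\<^sup>2)) t :> 1 / q ^ 3" .
    have "DERIV F t :> of_nat r * (1 / q ^ 3 * (t / q) ^ (r - Suc 0)) / r"
      unfolding F_def[abs_def] using DERIV_cdivide[OF DERIV_power[OF d, of r], of r] by (simp add: q_def)
    also have "of_nat r * (1 / q ^ 3 * (t / q) ^ (r - Suc 0)) / r = t ^ (r - 1) / (q ^ 3 * q ^ (r - 1))"
      using r by (simp add: power_divide)
    also have "q ^ 3 * q ^ (r - 1) = q ^ (r + 2)"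
      using r by (simp add: power_add[symmetric])
    finally show "DERIV F t :> t ^ (r - 1) / sqrt (1 + 2 * t\<^sup>2) ^ (r + 2)" by (simp add: q_def)
    show "0 \<le> t ^ (r - 1) / sqrt (1 + 2 * t\<^sup>2) ^ (r + 2)" using t pos[of t] by simp
  next
    have "((\<lambda>t::real. t / sqrt (1 + 2 * t\<^sup>2)) \<longlongrightarrow> 1 / sqrt 2) at_top"
      by (real_asymp simp: powr_half_sqrt field_simps)
    from tendsto_divide[OF tendsto_power[OF this, of r] tendsto_const[of "real r"]]
    have "(F \<longlongrightarrow> (1 / sqrt 2) ^ r / r) at_top"
      unfolding F_def[abs_def] using r by simp
    then show "(F \<longlongrightarrow> 1 / (r * sqrt 2 ^ r)) at_top"
      by (simp add: power_divide mult.commute)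
  qed measurable
  also have "F 0 = 0" using r by (simp add: F_def)
  finally show ?thesis by simp
qed

text \<open>The base is n + 1 instead of the customary n: at n = l - 1 it becomes l / e, the origin
  of the factor e / l in the error bound. The induction step is (1 + 1 / (n + 1))^(n + 1) \<le>
  e.\<close>

lemma fact_ge_power_div_exp: "fact n \<ge> ((real n + 1) / exp 1) ^ n"
proof (induction n)
  case (Suc n)
  have "((real n + 2) / (real n + 1)) ^ (n + 1) = (1 + 1 / (real n + 1)) ^ (n + 1)"
    by (simp add: field_simps)
  also have "\<dots> \<le> exp (1 / (real n + 1)) ^ (n + 1)"
    by (intro power_mono exp_ge_add_one_self) (auto intro: add_nonneg_nonneg)
  also have "\<dots> = exp (real (n + 1) * (1 / (real n + 1)))" by (rule exp_of_nat_mult[symmetric])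
  also have "\<dots> = exp 1" by simp
  finally have le: "((real n + 2) / (real n + 1)) ^ (n + 1) \<le> exp 1" .
  have "((real (Suc n) + 1) / exp 1) ^ Suc n = (((real n + 2) / (real n + 1)) * ((real n + 1) / exp 1)) ^ (n + 1)"
  proof -
    have "(real (Suc n) + 1) / exp 1 = ((real n + 2) / (real n + 1)) * ((real n + 1) / exp 1)" by simp
    then show ?thesis by (simp only: Suc_eq_plus1)
  qed
  also have "\<dots> = ((real n + 2) / (real n + 1)) ^ (n + 1) * ((real n + 1) / exp 1) ^ (n + 1)"
    by (rule power_mult_distrib)
  also have "\<dots> \<le> exp 1 * ((real n + 1) / exp 1) ^ (n + 1)"
    using le by (intro mult_right_mono) auto
  also have "\<dots> = (real n + 1) * ((real n + 1) / exp 1) ^ n" by simp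
  also have "\<dots> \<le> (real n + 1) * fact n" using Suc by (intro mult_left_mono) auto
  also have "\<dots> = fact (Suc n)" by (simp add: algebra_simps)
  finally show ?case .
qed simp

section \<open>Reflections and orthonormal bases\<close>

definition householder :: "'i set \<Rightarrow> ('i \<Rightarrow> real) \<Rightarrow> 'i \<Rightarrow> 'i \<Rightarrow> real" where
  "householder I w i j = (if i = j then 1 else 0) - 2 * w i * w j / (\<Sum>l\<in>I. (w l)\<^sup>2)"

text \<open>For \<open>w = 0\<close> the definition gives the identity matrix, since \<open>x / 0 = 0\<close>.\<close>

lemma householder_sym: "householder I w i j = householder I w j i"
  by (simp add: householder_def mult_ac)

lemma householder_apply:
  assumes "finite I" "i \<in> I"
  shows "(\<Sum>j\<in>I. householder I w i j * x j) = x i - 2 * w i * (\<Sum>j\<in>I. w j * x j) / (\<Sum>l\<in>I. (w l)\<^sup>2)"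
proof -
  have "(\<Sum>j\<in>I. householder I w i j * x j) = (\<Sum>j\<in>I. (if i = j then x j else 0) - 2 * w i / (\<Sum>l\<in>I. (w l)\<^sup>2) * (w j * x j))"
    by (intro sum.cong) (auto simp: householder_def algebra_simps)
  also have "\<dots> = (\<Sum>j\<in>I. if i = j then x j else 0) - 2 * w i / (\<Sum>l\<in>I. (w l)\<^sup>2) * (\<Sum>j\<in>I. w j * x j)"
    by (simp only: sum_subtractf sum_distrib_left)
  finally show ?thesis using assms by simp
qed

lemma householder_orthogonal:
  assumes I: "finite I" "i \<in> I" "i' \<in> I"
  shows "(\<Sum>j\<in>I. householder I w i j * householder I w i' j) = (if i = i' then 1 else 0)"
proof -
  define n where "n = (\<Sum>l\<in>I. (w l)\<^sup>2)"
  have s: "(\<Sum>j\<in>I. w j * householder I w i' j) = w i' - 2 * w i' * n / n"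
    using householder_apply[OF I(1,3), of w w] by (simp add: mult.commute n_def power2_eq_square)
  have "(\<Sum>j\<in>I. householder I w i j * householder I w i' j) = householder I w i' i - 2 * w i * (w i' - 2 * w i' * n / n) / n"
    unfolding householder_apply[OF I(1,2)] s n_def by (rule refl)
  also have "\<dots> = (if i = i' then 1 else 0)"
    by (cases "n = 0") (auto simp: householder_def n_def[symmetric] field_simps)
  finally show ?thesis .
qed

text \<open>For vectors of equal norm 2 <x - y, x> = |x - y|^2, so the reflection subtracts exactly
  x - y from x. If x = y the matrix is the identity.\<close>

lemma householder_exchange:
  assumes I: "finite I" and eq: "(\<Sum>i\<in>I. (x i)\<^sup>2) = (\<Sum>i\<in>I. (y i)\<^sup>2)" and i: "i \<in> I"
  shows "(\<Sum>j\<in>I. householder I (\<lambda>i. x i - y i) i j * x j) = y i"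
proof -
  define n where "n = (\<Sum>l\<in>I. (x l - y l)\<^sup>2)"
  have n0: "n = (\<Sum>l\<in>I. (x l)\<^sup>2) + (\<Sum>l\<in>I. (y l)\<^sup>2) - 2 * (\<Sum>l\<in>I. x l * y l)"
    unfolding n_def by (simp add: power2_eq_square algebra_simps sum.distrib sum_subtractf sum_distrib_left)
  have "2 * (\<Sum>l\<in>I. (x l - y l) * x l) = n"
    using eq n0 by (simp add: power2_eq_square algebra_simps sum.distrib sum_subtractf)
  then have w: "2 * ((x i - y i) * (\<Sum>l\<in>I. (x l - y l) * x l)) / n = (x i - y i) * (n / n)"
    by (metis mult.left_commute times_divide_eq_right)
  show ?thesis
  proof (cases "n = 0")
    case True
    then have "x i - y i = 0" using I i unfolding n_def by (subst (asm) sum_nonneg_eq_0_iff) auto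
    then show ?thesis using householder_apply[OF I i] by simp
  next
    case False
    then have "2 * (x i - y i) * (\<Sum>l\<in>I. (x l - y l) * x l) / n = x i - y i"
      using w by (simp only: mult.assoc divide_self_if if_False mult_1_right)
    then show ?thesis unfolding householder_apply[OF I i] n_def[symmetric] by simp
  qed
qed

lemma householder_to_axis:
  fixes x :: "'i \<Rightarrow> real"
  assumes I: "finite I" "i0 \<in> I"
  defines "h \<equiv> householder I (\<lambda>i. x i - (if i = i0 then sqrt (\<Sum>l\<in>I. (x l)\<^sup>2) else 0))"
  shows "i \<in> I \<Longrightarrow> (\<Sum>j\<in>I. h i j * x j) = (if i = i0 then sqrt (\<Sum>l\<in>I. (x l)\<^sup>2) else 0)"
  unfolding h_def using I
  by (intro householder_exchange)
    (auto simp: if_distrib[of "\<lambda>a. a\<^sup>2"] sum_nonneg cong: if_cong)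

text \<open>The \<open>j\<close> vectors are padded by zero rows to a square matrix. Its row
  \<open>j\<close> is zero, so it is singular, and a kernel vector is normalized.\<close>

lemma exists_unit_orthogonal:
  fixes f :: "nat \<Rightarrow> nat \<Rightarrow> real"
  assumes "j < m"
  shows "\<exists>u. (\<Sum>c<m. (u c)\<^sup>2) = 1 \<and> (\<forall>i<j. (\<Sum>c<m. f i c * u c) = 0)"
proof -
  define A where "A = Matrix.mat m m (\<lambda>(i, c). if i < j then f i c else 0)"
  have A: "A \<in> carrier_mat m m" by (simp add: A_def)
  have "A\<^sup>T *\<^sub>v unit_vec m j = 0\<^sub>v m"
    using assms by (intro eq_vecI) (auto simp: A_def)
  then have "det (A\<^sup>T) = 0"
    using A assms by (subst det_0_iff_vec_prod_zero[of _ m]) (auto intro!: exI[of _ "unit_vec m j"])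
  then have "det A = 0" using det_transpose[OF A] by simp
  then obtain v where v: "v \<in> carrier_vec m" "v \<noteq> 0\<^sub>v m" "A *\<^sub>v v = 0\<^sub>v m"
    using det_0_iff_vec_prod_zero[OF A] by blast
  define n where "n = (\<Sum>c<m. (v $ c)\<^sup>2)"
  have "n \<noteq> 0"
  proof
    assume "n = 0"
    then have "\<forall>c<m. v $ c = 0" unfolding n_def by (subst (asm) sum_nonneg_eq_0_iff) auto
    then have "v = 0\<^sub>v m" using v(1) by (intro eq_vecI) auto
    then show False using v by simp
  qed
  moreover have "n \<ge> 0" unfolding n_def by (simp add: sum_nonneg)
  ultimately have n: "n > 0" by simp
  have z: "(\<Sum>c<m. f i c * v $ c) = 0" if "i < j" for i
  proof -
    have "(A *\<^sub>v v) $ i = (\<Sum>c<m. f i c * v $ c)"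
      using that assms v(1) by (simp add: A_def scalar_prod_def atLeast0LessThan)
    then show ?thesis using v(3) that assms by simp
  qed
  show ?thesis
    using n z by (intro exI[of _ "\<lambda>c. v $ c / sqrt n"])
      (auto simp: power_divide sum_divide_distrib[symmetric] n_def[symmetric])
qed

text \<open>The basis grows by one vector at a time. Up to step \<open>b\<close> there are n + a < a
  + b = m linear conditions, afterwards n < m, so a further unit vector always exists, also when the
  \<open>f j\<close> are dependent.\<close>

lemma exists_orthonormal_basis_orthogonal_to:
  fixes f :: "nat \<Rightarrow> nat \<Rightarrow> real"
  assumes "a + b = m"
  shows "\<exists>v. (\<forall>i<m. \<forall>i'<m. (\<Sum>c<m. v i c * v i' c) = (if i = i' then 1 else 0)) \<and>
    (\<forall>i<b. \<forall>j<a. (\<Sum>c<m. f j c * v i c) = 0)"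
proof -
  have "\<exists>v. (\<forall>i<n. \<forall>i'<n. (\<Sum>c<m. v i c * v i' c) = (if i = i' then 1 else 0)) \<and>
    (\<forall>i<min b n. \<forall>j<a. (\<Sum>c<m. f j c * v i c) = 0)" if "n \<le> m" for n
    using that
  proof (induction n)
    case (Suc n)
    obtain v where v1: "\<forall>i<n. \<forall>i'<n. (\<Sum>c<m. v i c * v i' c) = (if i = i' then 1 else 0)"
      and v2: "\<forall>i<min b n. \<forall>j<a. (\<Sum>c<m. f j c * v i c) = 0"
      using Suc.IH[OF Suc_leD[OF Suc.prems]] by (elim exE conjE)
    \<comment> \<open>The conditions on the new vector: the \<open>n\<close> vectors already found,
      followed by the vectors \<open>f\<close>; the latter count only while \<open>n < b\<close>,
      which \<open>N\<close> encodes.\<close>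
    define g where "g i = (if i < n then v i else f (i - n))" for i
    define N where "N = (if n < b then n + a else n)"
    have "N < m" using assms Suc.prems by (auto simp: N_def)
    from exists_unit_orthogonal[OF this, of g] obtain u where
      u: "(\<Sum>c<m. (u c)\<^sup>2) = 1" "\<And>i. i < N \<Longrightarrow> (\<Sum>c<m. g i c * u c) = 0" by auto
    have vu: "(\<Sum>c<m. v i c * u c) = 0" if "i < n" for i
      using u(2)[of i] that by (auto simp: N_def g_def)
    have fu: "(\<Sum>c<m. f j c * u c) = 0" if "j < a" "n < b" for j
      using u(2)[of "n + j"] that by (auto simp: N_def g_def)
    have uv: "(\<Sum>c<m. u c * v i c) = 0" if "i < n" for i
      using vu[OF that] by (simp add: mult.commute)
    have "(\<Sum>c<m. (v(n := u)) i c * (v(n := u)) i' c) = (if i = i' then 1 else 0)"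
      if "i < Suc n" "i' < Suc n" for i i'
      using that v1 vu uv u(1) by (cases "i = n"; cases "i' = n") (simp_all add: power2_eq_square)
    moreover have "(\<Sum>c<m. f j c * (v(n := u)) i c) = 0" if "i < min b (Suc n)" "j < a" for i j
      using that v2 fu by (cases "i = n") simp_all
    ultimately show ?case by (intro exI[of _ "v(n := u)"]) simp
  qed simp
  from this[of m] assms show ?thesis by (simp add: min_absorb1)
qed

lemma orthonormal_rows_imp_columns:
  fixes v :: "nat \<Rightarrow> nat \<Rightarrow> real"
  assumes rows: "\<And>i i'. i < m \<Longrightarrow> i' < m \<Longrightarrow> (\<Sum>c<m. v i c * v i' c) = (if i = i' then 1 else 0)"
    and c: "c < m" "c' < m"
  shows "(\<Sum>i<m. v i c * v i c') = (if c = c' then 1 else 0)"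
proof -
  define A where "A = Matrix.mat m m (\<lambda>(i, j). v i j)"
  have A: "A \<in> carrier_mat m m" by (simp add: A_def)
  have "A * A\<^sup>T = 1\<^sub>m m"
    using rows by (intro eq_matI) (auto simp: A_def scalar_prod_def atLeast0LessThan)
  from mat_mult_left_right_inverse[OF A _ this] have "A\<^sup>T * A = 1\<^sub>m m" using A by auto
  then have "(A\<^sup>T * A) $$ (c, c') = 1\<^sub>m m $$ (c, c')" by simp
  then show ?thesis using c by (simp add: A_def scalar_prod_def atLeast0LessThan)
qed

section \<open>Rotations of Gaussian matrices\<close>

lemma nn_integral_gaussian_fold:
  assumes "I \<inter> J = {}" "finite I" "finite J" "f \<in> borel_measurable (gaussian (I \<union> J))"
  shows "integral\<^sup>N (gaussian (I \<union> J)) f =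
    (\<integral>\<^sup>+x. \<integral>\<^sup>+y. f (merge I J (x, y)) \<partial>gaussian J \<partial>gaussian I)"
proof -
  interpret product_prob_space "\<lambda>_. std_normal" by (rule product_prob_space_std_normal)
  show ?thesis using assms unfolding gaussian_def by (rule product_nn_integral_fold)
qed

lemma nn_integral_gaussian_rotate_rows:
  fixes f :: "('i \<times> 'j \<Rightarrow> real) \<Rightarrow> ennreal"
  assumes I: "finite I" and J: "finite J" and f: "f \<in> borel_measurable (gaussian (I \<times> J))"
    and rows: "\<And>i i'. i \<in> I \<Longrightarrow> i' \<in> I \<Longrightarrow> (\<Sum>j\<in>I. v i j * v i' j) = (if i = i' then 1 else 0)"
    and cols: "\<And>j j'. j \<in> I \<Longrightarrow> j' \<in> I \<Longrightarrow> (\<Sum>i\<in>I. v i j * v i j') = (if j = j' then 1 else 0)"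
  shows "(\<integral>\<^sup>+x. f (\<lambda>(i, c)\<in>I \<times> J. \<Sum>i'\<in>I. v i i' * x (i', c)) \<partial>gaussian (I \<times> J)) = integral\<^sup>N (gaussian (I \<times> J)) f"
proof -
  \<comment> \<open>The Kronecker product of \<open>v\<close> with the identity on \<open>J\<close>,
    which makes the simultaneous rotation of all columns one orthogonal map on
    \<open>I \<times> J\<close>.\<close>
  define K :: "'i \<times> 'j \<Rightarrow> 'i \<times> 'j \<Rightarrow> real" where "K = (\<lambda>(i, c) (i', c'). if c = c' then v i i' else 0)"
  have K: "(\<Sum>p'\<in>I \<times> J. K p p' * x p') = (\<Sum>i'\<in>I. v (fst p) i' * x (i', snd p))" if "p \<in> I \<times> J" for p x
    using that J by (auto simp: K_def sum.cartesian_product' if_distrib[of "\<lambda>a. a * _"] cong: if_cong)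
  have K': "(\<Sum>p\<in>I \<times> J. K p p' * x p) = (\<Sum>i\<in>I. v i (fst p') * x (i, snd p'))" if "p' \<in> I \<times> J" for p' x
    using that J by (auto simp: K_def sum.cartesian_product' if_distrib[of "\<lambda>a. a * _"] cong: if_cong)
  have "(\<integral>\<^sup>+x. f (\<lambda>p\<in>I \<times> J. \<Sum>p'\<in>I \<times> J. K p p' * x p') \<partial>gaussian (I \<times> J)) = integral\<^sup>N (gaussian (I \<times> J)) f"
  proof (rule nn_integral_gaussian_orthogonal)
    fix p p' assume p: "p \<in> I \<times> J" "p' \<in> I \<times> J"
    show "(\<Sum>q\<in>I \<times> J. K p q * K p' q) = (if p = p' then 1 else 0)"
      unfolding K[OF p(1)] using p rows by (cases p; cases p'; cases "snd p = snd p'") (auto simp: K_def)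
    show "(\<Sum>q\<in>I \<times> J. K q p * K q p') = (if p = p' then 1 else 0)"
      unfolding K'[OF p(1)] using p cols by (cases p; cases p'; cases "snd p = snd p'") (auto simp: K_def)
  qed (use I J f in auto)
  moreover have "(\<lambda>p\<in>I \<times> J. \<Sum>p'\<in>I \<times> J. K p p' * x p') = (\<lambda>(i, c)\<in>I \<times> J. \<Sum>i'\<in>I. v i i' * x (i', c))" for x
    by (rule restrict_ext) (auto simp: K)
  ultimately show ?thesis by simp
qed

lemma nn_integral_gaussian_rotate_columns:
  fixes f :: "('i \<times> 'j \<Rightarrow> real) \<Rightarrow> ennreal"
  assumes I: "finite I" and J: "finite J" and f: "f \<in> borel_measurable (gaussian (I \<times> J))"
    and rows: "\<And>c c'. c \<in> J \<Longrightarrow> c' \<in> J \<Longrightarrow> (\<Sum>j\<in>J. v c j * v c' j) = (if c = c' then 1 else 0)"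
    and cols: "\<And>j j'. j \<in> J \<Longrightarrow> j' \<in> J \<Longrightarrow> (\<Sum>c\<in>J. v c j * v c j') = (if j = j' then 1 else 0)"
  shows "(\<integral>\<^sup>+x. f (\<lambda>(i, c)\<in>I \<times> J. \<Sum>c'\<in>J. v c c' * x (i, c')) \<partial>gaussian (I \<times> J)) = integral\<^sup>N (gaussian (I \<times> J)) f"
proof -
  define K :: "'i \<times> 'j \<Rightarrow> 'i \<times> 'j \<Rightarrow> real" where "K = (\<lambda>(i, c) (i', c'). if i = i' then v c c' else 0)"
  have K: "(\<Sum>p'\<in>I \<times> J. K p p' * x p') = (\<Sum>c'\<in>J. v (snd p) c' * x (fst p, c'))" if "p \<in> I \<times> J" for p x
    using that I by (auto simp: K_def sum.cartesian_product' if_distrib[of "\<lambda>a. a * _"] sum.swap[of _ _ I] cong: if_cong)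
  have K': "(\<Sum>p\<in>I \<times> J. K p p' * x p) = (\<Sum>c\<in>J. v c (snd p') * x (fst p', c))" if "p' \<in> I \<times> J" for p' x
    using that I by (auto simp: K_def sum.cartesian_product' if_distrib[of "\<lambda>a. a * _"] sum.swap[of _ _ I] cong: if_cong)
  have "(\<integral>\<^sup>+x. f (\<lambda>p\<in>I \<times> J. \<Sum>p'\<in>I \<times> J. K p p' * x p') \<partial>gaussian (I \<times> J)) = integral\<^sup>N (gaussian (I \<times> J)) f"
  proof (rule nn_integral_gaussian_orthogonal)
    fix p p' assume p: "p \<in> I \<times> J" "p' \<in> I \<times> J"
    show "(\<Sum>q\<in>I \<times> J. K p q * K p' q) = (if p = p' then 1 else 0)"
      unfolding K[OF p(1)] using p rows by (cases p; cases p'; cases "fst p = fst p'") (auto simp: K_def)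
    show "(\<Sum>q\<in>I \<times> J. K q p * K q p') = (if p = p' then 1 else 0)"
      unfolding K'[OF p(1)] using p cols by (cases p; cases p'; cases "fst p = fst p'") (auto simp: K_def)
  qed (use I J f in auto)
  moreover have "(\<lambda>p\<in>I \<times> J. \<Sum>p'\<in>I \<times> J. K p p' * x p') = (\<lambda>(i, c)\<in>I \<times> J. \<Sum>c'\<in>J. v c c' * x (i, c'))" for x
    by (rule restrict_ext) (auto simp: K)
  ultimately show ?thesis by simp
qed

lemma householder_orthogonal':
  "finite I \<Longrightarrow> j \<in> I \<Longrightarrow> j' \<in> I \<Longrightarrow>
    (\<Sum>i\<in>I. householder I w i j * householder I w i j') = (if j = j' then 1 else 0)"
  using householder_orthogonal[of I j j' w] by (simp add: householder_sym[of I w _ j] householder_sym[of I w _ j'])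

text \<open>A reflection carrying \<open>c\<close> to the axis \<open>i0\<close> shows that the
  linear form has the law of |c| times one standard normal coordinate.\<close>

lemma nn_integral_gaussian_linear_form_power:
  fixes c :: "'i \<Rightarrow> real"
  assumes I: "finite I" and r: "r \<ge> 1"
  shows "(\<integral>\<^sup>+x. ennreal (\<bar>\<Sum>i\<in>I. c i * x i\<bar> ^ r) \<partial>gaussian I) = ennreal (sqrt (\<Sum>i\<in>I. (c i)\<^sup>2) ^ r * abs_moment r)"
proof (cases "I = {}")
  case True
  then show ?thesis using r by (simp add: power_0_left)
next
  case False
  then obtain i0 where i0: "i0 \<in> I" by auto
  define n where "n = sqrt (\<Sum>i\<in>I. (c i)\<^sup>2)"
  have n: "n \<ge> 0" by (simp add: n_def sum_nonneg)
  define h where "h = householder I (\<lambda>i. c i - (if i = i0 then n else 0))"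
  have h: "(\<Sum>j\<in>I. h i j * c j) = (if i = i0 then n else 0)" if "i \<in> I" for i
    unfolding h_def n_def by (rule householder_to_axis[OF I i0 that])
  have lin: "(\<Sum>i\<in>I. c i * (\<lambda>i\<in>I. \<Sum>j\<in>I. h i j * x j) i) = n * x i0" for x
  proof -
    have "(\<Sum>i\<in>I. c i * (\<lambda>i\<in>I. \<Sum>j\<in>I. h i j * x j) i) = (\<Sum>i\<in>I. \<Sum>j\<in>I. h j i * c i * x j)"
      by (simp add: sum_distrib_left h_def householder_sym[of I _ _ j for j] mult_ac)
    also have "\<dots> = (\<Sum>j\<in>I. (\<Sum>i\<in>I. h j i * c i) * x j)"
      by (subst sum.swap) (simp add: sum_distrib_right)
    also have "\<dots> = (\<Sum>j\<in>I. (if j = i0 then n else 0) * x j)"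
      by (intro sum.cong refl) (simp add: h)
    also have "\<dots> = n * x i0" using I i0 by (simp add: if_distrib[of "\<lambda>a. a * _"] cong: if_cong)
    finally show ?thesis .
  qed
  have "(\<integral>\<^sup>+x. ennreal (\<bar>\<Sum>i\<in>I. c i * x i\<bar> ^ r) \<partial>gaussian I) =
      (\<integral>\<^sup>+x. ennreal (\<bar>\<Sum>i\<in>I. c i * (\<lambda>i\<in>I. \<Sum>j\<in>I. h i j * x j) i\<bar> ^ r) \<partial>gaussian I)"
    unfolding h_def
    by (rule nn_integral_gaussian_orthogonal[symmetric, OF I _ householder_orthogonal[OF I] householder_orthogonal'[OF I]]) measurable
  also have "\<dots> = (\<integral>\<^sup>+x. ennreal (n ^ r) * ennreal (\<bar>x i0\<bar> ^ r) \<partial>gaussian I)"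
    unfolding lin using n by (simp add: abs_mult power_mult_distrib ennreal_mult)
  also have "\<dots> = ennreal (n ^ r) * (\<integral>\<^sup>+x. ennreal (\<bar>x i0\<bar> ^ r) \<partial>gaussian I)"
    using i0 by (intro nn_integral_cmult) measurable
  also have "(\<integral>\<^sup>+x. ennreal (\<bar>x i0\<bar> ^ r) \<partial>gaussian I) = ennreal (abs_moment r)"
    using nn_integral_gaussian_component[OF I i0, of "\<lambda>x. ennreal (\<bar>x\<bar> ^ r)"] nn_integral_abs_moment by simp
  finally show ?thesis using n abs_moment_pos[of r] by (simp add: ennreal_mult n_def)
qed

text \<open>A Gaussian test vector \<open>z\<close> detects the operator norm of \<open>N\<close>: project \<open>N z\<close> onto the direction \<open>N y\<close>.\<close>

lemma operator_norm_le_gaussian_average: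
  fixes N :: "'j \<Rightarrow> 'i \<Rightarrow> real"
  assumes I: "finite I" and J: "finite J" and r: "r \<ge> 1"
  shows "ennreal (sqrt (\<Sum>j\<in>J. (\<Sum>i\<in>I. N j i * y i)\<^sup>2) ^ r * abs_moment r)
    \<le> ennreal (sqrt (\<Sum>i\<in>I. (y i)\<^sup>2) ^ r) * (\<integral>\<^sup>+z. ennreal (sqrt (\<Sum>j\<in>J. (\<Sum>i\<in>I. N j i * z i)\<^sup>2) ^ r) \<partial>gaussian I)"
proof -
  define p where "p j = (\<Sum>i\<in>I. N j i * y i)" for j
  define P where "P = sqrt (\<Sum>j\<in>J. (p j)\<^sup>2)"
  define Y where "Y = sqrt (\<Sum>i\<in>I. (y i)\<^sup>2)"
  \<comment> \<open>The transpose of \<open>N\<close> applied to \<open>N y\<close>, so that the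
    linear form <c, z> equals <N y, N z>. At z = y it is P^2, which forces |c| to be large.\<close>
  define c where "c i = (\<Sum>j\<in>J. p j * N j i)" for i
  define X where "X = (\<integral>\<^sup>+z. ennreal (sqrt (\<Sum>j\<in>J. (\<Sum>i\<in>I. N j i * z i)\<^sup>2) ^ r) \<partial>gaussian I)"
  have cz: "(\<Sum>i\<in>I. c i * z i) = (\<Sum>j\<in>J. p j * (\<Sum>i\<in>I. N j i * z i))" for z
    unfolding c_def sum_distrib_left sum_distrib_right by (subst sum.swap) (simp add: mult.assoc)
  have CS: "\<bar>\<Sum>i\<in>K. u i * w i\<bar> \<le> sqrt (\<Sum>i\<in>K. (u i)\<^sup>2) * sqrt (\<Sum>i\<in>K. (w i)\<^sup>2)" for K and u w :: "'k \<Rightarrow> real"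
  proof -
    have "\<bar>\<Sum>i\<in>K. u i * w i\<bar> \<le> (\<Sum>i\<in>K. \<bar>u i\<bar> * \<bar>w i\<bar>)"
      using sum_abs[of "\<lambda>i. u i * w i" K] by (simp add: abs_mult)
    also have "\<dots> \<le> L2_set u K * L2_set w K" by (rule L2_set_mult_ineq)
    finally show ?thesis by (simp add: L2_set_def)
  qed
  have "P\<^sup>2 = (\<Sum>i\<in>I. c i * y i)"
    unfolding cz p_def[symmetric] by (simp add: P_def sum_nonneg power2_eq_square)
  also have "\<dots> \<le> sqrt (\<Sum>i\<in>I. (c i)\<^sup>2) * Y" using CS[of c y I] by (simp add: Y_def)
  finally have P2: "P\<^sup>2 \<le> sqrt (\<Sum>i\<in>I. (c i)\<^sup>2) * Y" .
  have nn: "P \<ge> 0" "Y \<ge> 0" "sqrt (\<Sum>i\<in>I. (c i)\<^sup>2) \<ge> 0" by (simp_all add: P_def Y_def sum_nonneg)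
  have "ennreal (sqrt (\<Sum>i\<in>I. (c i)\<^sup>2) ^ r * abs_moment r) = (\<integral>\<^sup>+z. ennreal (\<bar>\<Sum>i\<in>I. c i * z i\<bar> ^ r) \<partial>gaussian I)"
    by (rule nn_integral_gaussian_linear_form_power[OF I r, symmetric])
  also have "\<dots> \<le> (\<integral>\<^sup>+z. ennreal (P ^ r) * ennreal (sqrt (\<Sum>j\<in>J. (\<Sum>i\<in>I. N j i * z i)\<^sup>2) ^ r) \<partial>gaussian I)"
  proof (rule nn_integral_mono)
    fix z
    have "\<bar>\<Sum>i\<in>I. c i * z i\<bar> ^ r \<le> (P * sqrt (\<Sum>j\<in>J. (\<Sum>i\<in>I. N j i * z i)\<^sup>2)) ^ r"
      unfolding cz P_def by (intro power_mono CS) simp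
    then show "ennreal (\<bar>\<Sum>i\<in>I. c i * z i\<bar> ^ r) \<le> ennreal (P ^ r) * ennreal (sqrt (\<Sum>j\<in>J. (\<Sum>i\<in>I. N j i * z i)\<^sup>2) ^ r)"
      using nn by (simp add: ennreal_mult[symmetric] power_mult_distrib sum_nonneg ennreal_leI)
  qed
  also have "\<dots> = ennreal (P ^ r) * X"
    unfolding X_def by (rule nn_integral_cmult) measurable
  finally have *: "ennreal (sqrt (\<Sum>i\<in>I. (c i)\<^sup>2) ^ r * abs_moment r) \<le> ennreal (P ^ r) * X" .
  have "ennreal (P ^ r * abs_moment r) \<le> ennreal (Y ^ r) * X"
  proof (cases "P = 0")
    case True
    then show ?thesis using r by (simp add: power_0_left)
  next
    case False
    with nn have P: "P > 0" by simp
    \<comment> \<open>Both sides carry an extra factor \<open>P ^ r\<close>. It is finite and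
      positive, so it can be cancelled at the end even if \<open>X\<close> is infinite.\<close>
    have "ennreal (P ^ r) * ennreal (P ^ r * abs_moment r) = ennreal ((P\<^sup>2) ^ r * abs_moment r)"
      using nn abs_moment_pos[of r] by (subst ennreal_mult[symmetric]) (auto simp: power2_eq_square power_mult_distrib mult_ac)
    also have "\<dots> \<le> ennreal ((sqrt (\<Sum>i\<in>I. (c i)\<^sup>2) * Y) ^ r * abs_moment r)"
      using P2 nn abs_moment_pos[of r] by (intro ennreal_leI mult_right_mono power_mono) auto
    also have "\<dots> = ennreal (Y ^ r) * ennreal (sqrt (\<Sum>i\<in>I. (c i)\<^sup>2) ^ r * abs_moment r)"
      using nn abs_moment_pos[of r] by (subst ennreal_mult[symmetric]) (auto simp: power_mult_distrib mult_ac)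
    also have "\<dots> \<le> ennreal (Y ^ r) * (ennreal (P ^ r) * X)" by (intro mult_left_mono *) simp
    also have "\<dots> = ennreal (P ^ r) * (ennreal (Y ^ r) * X)" by (simp add: mult_ac)
    finally show ?thesis using P by (subst (asm) ennreal_mult_le_mult_iff) auto
  qed
  then show ?thesis by (simp add: P_def Y_def X_def p_def)
qed

text \<open>Rotating the columns turns \<open>a\<close> into a multiple of a coordinate vector, so
  the product of the Gaussian matrix with \<open>a\<close> is distributed as |a| times a single
  column.\<close>

lemma nn_integral_gaussian_matrix_vector_power_le:
  fixes s :: "'i \<Rightarrow> real" and a :: "'j \<Rightarrow> real"
  assumes I: "finite I" and J: "finite J" and r: "r \<ge> 1"
    and S: "\<And>i. i \<in> I \<Longrightarrow> (s i)\<^sup>2 \<le> S" "0 \<le> S"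
  shows "(\<integral>\<^sup>+x. ennreal (sqrt (\<Sum>i\<in>I. (s i)\<^sup>2 * (\<Sum>c\<in>J. x (i, c) * a c)\<^sup>2) ^ r) \<partial>gaussian (I \<times> J))
    \<le> ennreal (sqrt (\<Sum>c\<in>J. (a c)\<^sup>2) ^ r * sqrt ((\<Sum>i\<in>I. (s i)\<^sup>2) + r * S) ^ r)"
proof (cases "J = {}")
  case True
  then show ?thesis using r by (simp add: power_0_left)
next
  case False
  then obtain c0 where c0: "c0 \<in> J" by auto
  define n where "n = sqrt (\<Sum>c\<in>J. (a c)\<^sup>2)"
  have n: "n \<ge> 0" by (simp add: n_def sum_nonneg)
  define h where "h = householder J (\<lambda>i. a i - (if i = c0 then n else 0))"
  have h: "(\<Sum>j\<in>J. h i j * a j) = (if i = c0 then n else 0)" if "i \<in> J" for i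
    unfolding h_def n_def by (rule householder_to_axis[OF J c0 that])
  let ?T = "\<lambda>x. \<lambda>(i, c)\<in>I \<times> J. \<Sum>c'\<in>J. h c c' * x (i, c')"
  have lin: "(\<Sum>c\<in>J. ?T x (i, c) * a c) = n * x (i, c0)" if "i \<in> I" for i x
  proof -
    have "(\<Sum>c\<in>J. ?T x (i, c) * a c) = (\<Sum>c\<in>J. \<Sum>c'\<in>J. h c' c * a c * x (i, c'))"
      using that by (simp add: sum_distrib_right sum_distrib_left h_def householder_sym[of J _ _ j for j] mult_ac)
    also have "\<dots> = (\<Sum>j\<in>J. (\<Sum>i\<in>J. h j i * a i) * x (i, j))"
      by (subst sum.swap) (simp add: sum_distrib_right)
    also have "\<dots> = (\<Sum>j\<in>J. (if j = c0 then n else 0) * x (i, j))"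
      by (intro sum.cong refl) (simp add: h)
    also have "\<dots> = n * x (i, c0)" using J c0 by (simp add: if_distrib[of "\<lambda>a. a * _"] cong: if_cong)
    finally show ?thesis .
  qed
  \<comment> \<open>Weights that vanish off the column \<open>c0\<close> keep the integral on the
    full product, so that no marginal distribution has to be formed.\<close>
  let ?s = "\<lambda>p. if snd p = c0 then s (fst p) else 0"
  have sum_s: "(\<Sum>p\<in>I \<times> J. (?s p)\<^sup>2 * g p) = (\<Sum>i\<in>I. (s i)\<^sup>2 * g (i, c0))" for g
    using J c0 by (simp add: sum.cartesian_product' if_distrib[of "\<lambda>a. a\<^sup>2"] if_distrib[of "\<lambda>a. a * _"] cong: if_cong)
  have mi: "(\<lambda>x. x (i, c)) \<in> borel_measurable (gaussian (I \<times> J))" if "i \<in> I" "c \<in> J" for i c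
    using that by (intro borel_measurable_gaussian_component) simp
  let ?f = "\<lambda>x. ennreal (sqrt (\<Sum>i\<in>I. (s i)\<^sup>2 * (\<Sum>c\<in>J. x (i, c) * a c)\<^sup>2) ^ r)"
  have fm: "?f \<in> borel_measurable (gaussian (I \<times> J))"
    using mi by measurable
  have "integral\<^sup>N (gaussian (I \<times> J)) ?f = (\<integral>\<^sup>+x. ?f (?T x) \<partial>gaussian (I \<times> J))"
    unfolding h_def
    by (rule nn_integral_gaussian_rotate_columns[symmetric, OF I J fm householder_orthogonal[OF J] householder_orthogonal'[OF J]])
  also have "\<dots> = (\<integral>\<^sup>+x. ennreal (n ^ r) * ennreal (sqrt (\<Sum>p\<in>I \<times> J. (?s p)\<^sup>2 * (x p)\<^sup>2) ^ r) \<partial>gaussian (I \<times> J))"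
  proof (rule nn_integral_cong)
    fix x
    have "(\<Sum>i\<in>I. (s i)\<^sup>2 * (\<Sum>c\<in>J. ?T x (i, c) * a c)\<^sup>2) = n\<^sup>2 * (\<Sum>i\<in>I. (s i)\<^sup>2 * (x (i, c0))\<^sup>2)"
      unfolding sum_distrib_left by (intro sum.cong refl, subst lin) (auto simp: power_mult_distrib)
    then show "?f (?T x) = ennreal (n ^ r) * ennreal (sqrt (\<Sum>p\<in>I \<times> J. (?s p)\<^sup>2 * (x p)\<^sup>2) ^ r)"
      unfolding sum_s using n by (simp add: real_sqrt_mult power_mult_distrib ennreal_mult sum_nonneg)
  qed
  also have "\<dots> = ennreal (n ^ r) * (\<integral>\<^sup>+x. ennreal (sqrt (\<Sum>p\<in>I \<times> J. (?s p)\<^sup>2 * (x p)\<^sup>2) ^ r) \<partial>gaussian (I \<times> J))"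
    by (rule nn_integral_cmult) measurable
  also have "\<dots> \<le> ennreal (n ^ r) * ennreal (sqrt ((\<Sum>p\<in>I \<times> J. (?s p)\<^sup>2) + r * S) ^ r)"
    using I J S by (intro mult_left_mono nn_integral_gaussian_weighted_norm_power_le r) auto
  also have "(\<Sum>p\<in>I \<times> J. (?s p)\<^sup>2) = (\<Sum>i\<in>I. (s i)\<^sup>2)" using sum_s[of "\<lambda>_. 1"] by simp
  also have "ennreal (n ^ r) * ennreal (sqrt ((\<Sum>i\<in>I. (s i)\<^sup>2) + r * S) ^ r) = ennreal (n ^ r * sqrt ((\<Sum>i\<in>I. (s i)\<^sup>2) + r * S) ^ r)"
    using n S by (simp add: ennreal_mult sum_nonneg)
  finally show ?thesis by (simp add: n_def)
qed

section \<open>The pseudo-inverse of a Gaussian matrix\<close>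

lemma borel_measurable_det:
  assumes "\<And>i j. i < n \<Longrightarrow> j < n \<Longrightarrow> (\<lambda>\<omega>. f \<omega> i j) \<in> borel_measurable M"
  shows "(\<lambda>\<omega>. det (Matrix.mat n n (\<lambda>(i, j). f \<omega> i j)) :: real) \<in> borel_measurable M"
proof -
  have "det (Matrix.mat n n (\<lambda>(i, j). f \<omega> i j)) =
      (\<Sum>p | p permutes {0..<n}. signof p * (\<Prod>i = 0..<n. f \<omega> i (p i)))" for \<omega>
    by (subst det_def'[of _ n]) (auto intro!: sum.cong prod.cong simp: permutes_in_image[of _ "{0..<n}"] permutes_nat_less)
  moreover have "(\<lambda>\<omega>. \<Sum>p | p permutes {0..<n}. signof p * (\<Prod>i = 0..<n. f \<omega> i (p i))) \<in> borel_measurable M"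
    using assms by (intro borel_measurable_sum borel_measurable_times borel_measurable_prod borel_measurable_const)
      (auto simp: permutes_nat_less)
  ultimately show ?thesis by simp
qed

lemma borel_measurable_adj_mat:
  assumes f: "\<And>i j. i < n \<Longrightarrow> j < n \<Longrightarrow> (\<lambda>\<omega>. f \<omega> i j) \<in> borel_measurable M"
    and ij: "i < n" "j < n"
  shows "(\<lambda>\<omega>. adj_mat (Matrix.mat n n (\<lambda>(i, j). f \<omega> i j)) $$ (i, j) :: real) \<in> borel_measurable M"
proof -
  have "adj_mat (Matrix.mat n n (\<lambda>(i, j). f \<omega> i j)) $$ (i, j) =
      (- 1) ^ (j + i) * det (Matrix.mat (n - 1) (n - 1)
        (\<lambda>(a, b). f \<omega> (if a < j then a else Suc a) (if b < i then b else Suc b)))" for \<omega>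
    using ij unfolding adj_mat_def cofactor_def
    by (auto simp: mat_delete_def intro!: arg_cong[of _ _ det] cong_mat)
  moreover have "(\<lambda>\<omega>. det (Matrix.mat (n - 1) (n - 1)
        (\<lambda>(a, b). f \<omega> (if a < j then a else Suc a) (if b < i then b else Suc b)))) \<in> borel_measurable M"
    by (rule borel_measurable_det, rule f) auto
  ultimately show ?thesis by simp
qed

definition gram :: "nat \<Rightarrow> nat \<Rightarrow> (nat \<times> nat \<Rightarrow> real) \<Rightarrow> real mat" where
  "gram k m G = Matrix.mat k k (\<lambda>(i, j). \<Sum>c<m. G (i, c) * G (j, c))"

text \<open>\<open>pinv k m G\<close> is the Moore-Penrose inverse \<open>G\<^sub>1\<^sup>T (G\<^sub>1 G\<^sub>1\<^sup>T)\<^sup>-\<^sup>1\<close> of the \<open>k \<times> m\<close> block \<open>G\<^sub>1\<close> of the first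
  \<open>k\<close> rows of \<open>G\<close>; it is 0 if this block does not have full row rank.\<close>

definition pinv :: "nat \<Rightarrow> nat \<Rightarrow> (nat \<times> nat \<Rightarrow> real) \<Rightarrow> nat \<Rightarrow> nat \<Rightarrow> real" where
  "pinv k m G c i = (\<Sum>l<k. G (l, c) * adj_mat (gram k m G) $$ (l, i)) / det (gram k m G)"

text \<open>By the adjugate formula each entry is a quotient of polynomials in the entries of
  \<open>G\<close>; the convention x / 0 = 0 keeps it measurable across the singular set.\<close>

lemma borel_measurable_pinv:
  assumes G: "\<And>i c. i < k \<Longrightarrow> c < m \<Longrightarrow> (\<lambda>\<omega>. G \<omega> (i, c)) \<in> borel_measurable M" and i: "i < k" "c < m"
  shows "(\<lambda>\<omega>. pinv k m (G \<omega>) c i) \<in> borel_measurable M"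
  unfolding pinv_def gram_def
proof (intro borel_measurable_divide borel_measurable_sum borel_measurable_times)
  fix l assume "l \<in> {..<k}"
  then show "(\<lambda>\<omega>. G \<omega> (l, c)) \<in> borel_measurable M" using G i by auto
  show "(\<lambda>\<omega>. adj_mat (Matrix.mat k k (\<lambda>(i, j). \<Sum>c<m. G \<omega> (i, c) * G \<omega> (j, c))) $$ (l, i)) \<in> borel_measurable M"
    using G i \<open>l \<in> {..<k}\<close> by (intro borel_measurable_adj_mat borel_measurable_sum borel_measurable_times) auto
next
  show "(\<lambda>\<omega>. det (Matrix.mat k k (\<lambda>(i, j). \<Sum>c<m. G \<omega> (i, c) * G \<omega> (j, c)))) \<in> borel_measurable M"
    using G by (intro borel_measurable_det borel_measurable_sum borel_measurable_times) auto
qed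

lemma pinv_cong:
  assumes "\<And>i c. i < k \<Longrightarrow> c < m \<Longrightarrow> G (i, c) = G' (i, c)" "c < m"
  shows "pinv k m G c i = pinv k m G' c i"
proof -
  have "gram k m G = gram k m G'"
    unfolding gram_def by (intro cong_mat) (auto simp: assms intro!: sum.cong)
  then show ?thesis using assms by (auto simp: pinv_def intro!: sum.cong arg_cong2[where f = "(/)"])
qed

lemma pinv_singular: "det (gram k m G) = 0 \<Longrightarrow> pinv k m G c i = 0"
  by (simp add: pinv_def)

text \<open>The solution lies in the row space of \<open>G\<close>, the property that distinguishes
  the minimum norm solution.\<close>

lemma pinv_row_combination:
  "(\<Sum>i<k. pinv k m G c i * z i) =
    (\<Sum>l<k. (\<Sum>i<k. adj_mat (gram k m G) $$ (l, i) * z i) / det (gram k m G) * G (l, c))"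
proof -
  have "(\<Sum>i<k. pinv k m G c i * z i) = (\<Sum>i<k. \<Sum>l<k. adj_mat (gram k m G) $$ (l, i) * z i / det (gram k m G) * G (l, c))"
    unfolding pinv_def sum_divide_distrib sum_distrib_right by (intro sum.cong) (auto simp: mult_ac)
  also have "\<dots> = (\<Sum>l<k. (\<Sum>i<k. adj_mat (gram k m G) $$ (l, i) * z i) / det (gram k m G) * G (l, c))"
    unfolding sum_divide_distrib sum_distrib_right by (rule sum.swap)
  finally show ?thesis .
qed

lemma pinv_right_inverse:
  assumes det: "det (gram k m G) \<noteq> 0" and j: "j < k"
  shows "(\<Sum>c<m. G (j, c) * (\<Sum>i<k. pinv k m G c i * z i)) = z j"
proof -
  let ?W = "gram k m G"
  have W: "?W \<in> carrier_mat k k" by (simp add: gram_def)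
  have aw: "(\<Sum>l<k. ?W $$ (j, l) * adj_mat ?W $$ (l, i)) = (if j = i then det ?W else 0)" if "i < k" for i
  proof -
    have "(?W * adj_mat ?W) $$ (j, i) = (\<Sum>l<k. ?W $$ (j, l) * adj_mat ?W $$ (l, i))"
      using W adj_mat(1)[OF W] j that by (simp add: scalar_prod_def atLeast0LessThan)
    then show ?thesis using adj_mat(2)[OF W] j that by (cases "j = i") simp_all
  qed
  have wjl: "(\<Sum>c<m. G (j, c) * G (l, c) * t) = ?W $$ (j, l) * t" if "l < k" for l t
    using j that by (simp add: gram_def sum_distrib_right)
  have "(\<Sum>c<m. G (j, c) * (\<Sum>i<k. pinv k m G c i * z i))
     = (\<Sum>c<m. \<Sum>i<k. \<Sum>l<k. G (j, c) * G (l, c) * (adj_mat ?W $$ (l, i) * z i / det ?W))"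
    unfolding pinv_def sum_divide_distrib sum_distrib_right sum_distrib_left
    by (intro sum.cong) (auto simp: mult_ac)
  also have "\<dots> = (\<Sum>i<k. \<Sum>l<k. \<Sum>c<m. G (j, c) * G (l, c) * (adj_mat ?W $$ (l, i) * z i / det ?W))"
    by (subst sum.swap, rule sum.cong[OF refl], rule sum.swap)
  also have "\<dots> = (\<Sum>i<k. \<Sum>l<k. ?W $$ (j, l) * (adj_mat ?W $$ (l, i) * z i / det ?W))"
    by (intro sum.cong refl wjl) simp
  also have "\<dots> = (\<Sum>i<k. (\<Sum>l<k. ?W $$ (j, l) * adj_mat ?W $$ (l, i)) * z i / det ?W)"
    by (simp add: sum_distrib_left sum_distrib_right sum_divide_distrib mult_ac)
  also have "\<dots> = (\<Sum>i<k. if j = i then z i else 0)"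
    using det aw by (intro sum.cong) auto
  finally show ?thesis using j by simp
qed

text \<open>After a rotation of the rows one may take \<open>z\<close> along the first axis. The minimum norm solution \<open>a\<close> then
  satisfies \<open>\<bar>a\<bar> * dist \<le> \<bar>z\<bar>\<close>, where \<open>dist\<close> is the distance of the first row from the span of the others.\<close>

lemma pinv_norm_rotated:
  fixes v :: "nat \<Rightarrow> nat \<Rightarrow> real"
  assumes k: "k \<ge> 1"
    and h1: "\<And>i j. i < k \<Longrightarrow> j < k \<Longrightarrow> (\<Sum>l<k. h l i * h l j) = (if i = j then 1 else 0)"
    and hz: "\<And>i. i < k \<Longrightarrow> (\<Sum>j<k. h j i * z j) = (if i = 0 then n else 0)"
    and v: "\<And>i i'. i < m \<Longrightarrow> i' < m \<Longrightarrow> (\<Sum>c<m. v i c * v i' c) = (if i = i' then 1 else 0)"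
    and orth: "\<And>i j. i < b \<Longrightarrow> 1 \<le> j \<Longrightarrow> j < k \<Longrightarrow> (\<Sum>c<m. G (j, c) * v i c) = 0"
    and b: "b \<le> m" and n: "n \<ge> 0"
    and G': "\<And>i c. i < k \<Longrightarrow> c < m \<Longrightarrow> G' (i, c) = (\<Sum>i'<k. h i i' * G (i', c))"
  shows "(\<Sum>c<m. (\<Sum>i<k. pinv k m G' c i * z i)\<^sup>2) * (\<Sum>i<b. (\<Sum>c<m. v i c * G (0, c))\<^sup>2) \<le> n\<^sup>2"
proof (cases "det (gram k m G') = 0")
  case True
  then show ?thesis by (simp add: pinv_singular)
next
  case False
  define a where "a c = (\<Sum>i<k. pinv k m G' c i * z i)" for c
  define \<beta> where "\<beta> l = (\<Sum>i<k. adj_mat (gram k m G') $$ (l, i) * z i) / det (gram k m G')" for l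
  \<comment> \<open>The coefficients of \<open>a\<close> with respect to the unrotated rows of
    \<open>G\<close>, whereas \<open>\<beta>\<close> refers to the rotated rows.\<close>
  define \<gamma> where "\<gamma> i = (\<Sum>l<k. h l i * \<beta> l)" for i
  define N where "N = (\<Sum>c<m. (a c)\<^sup>2)"
  define D where "D = (\<Sum>i<b. (\<Sum>c<m. v i c * G (0, c))\<^sup>2)"
  have N0: "N \<ge> 0" and D0: "D \<ge> 0" by (simp_all add: N_def D_def sum_nonneg)
  have a: "a c = (\<Sum>i<k. \<gamma> i * G (i, c))" if "c < m" for c
  proof -
    have "a c = (\<Sum>l<k. \<beta> l * G' (l, c))" unfolding a_def pinv_row_combination \<beta>_def by (rule refl)
    also have "\<dots> = (\<Sum>l<k. \<Sum>i<k. h l i * \<beta> l * G (i, c))"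
      using that by (simp add: G' sum_distrib_left mult_ac)
    also have "\<dots> = (\<Sum>i<k. \<gamma> i * G (i, c))"
      unfolding \<gamma>_def sum_distrib_right by (rule sum.swap)
    finally show ?thesis .
  qed
  have z: "(\<Sum>i'<k. h j i' * (\<Sum>c<m. G (i', c) * a c)) = z j" if "j < k" for j
  proof -
    have "z j = (\<Sum>c<m. G' (j, c) * a c)" using pinv_right_inverse[OF False that, of z] by (simp add: a_def)
    also have "\<dots> = (\<Sum>c<m. \<Sum>i'<k. h j i' * (G (i', c) * a c))"
      using that by (simp add: G' sum_distrib_right sum_distrib_left mult_ac)
    also have "\<dots> = (\<Sum>i'<k. h j i' * (\<Sum>c<m. G (i', c) * a c))"
      unfolding sum_distrib_left by (rule sum.swap)
    finally show ?thesis by simp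
  qed
  have Ga: "(\<Sum>c<m. G (i, c) * a c) = (if i = 0 then n else 0)" if i: "i < k" for i
  proof -
    define g where "g i = (\<Sum>c<m. G (i, c) * a c)" for i
    have "(if i = 0 then n else 0) = (\<Sum>j<k. h j i * (\<Sum>i'<k. h j i' * g i'))"
      using hz[OF i] z by (simp add: g_def)
    also have "\<dots> = (\<Sum>j<k. \<Sum>i'<k. h j i * h j i' * g i')"
      by (simp add: sum_distrib_left mult.assoc)
    also have "\<dots> = (\<Sum>i'<k. (\<Sum>j<k. h j i * h j i') * g i')"
      unfolding sum_distrib_right by (rule sum.swap)
    also have "\<dots> = (\<Sum>i'<k. if i = i' then g i' else 0)"
      using i by (intro sum.cong) (auto simp: h1)
    also have "\<dots> = g i" using i by simp
    finally show ?thesis by (simp add: g_def)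
  qed
  \<comment> \<open>The scalar product of \<open>a\<close> with row \<open>i\<close> is 0 except for
    row 0, where it is \<open>n\<close>; so |a|^2 only sees the coefficient
    \<open>\<gamma> 0\<close>.\<close>
  have "N = (\<Sum>c<m. (\<Sum>i<k. \<gamma> i * G (i, c)) * a c)"
    unfolding N_def power2_eq_square by (intro sum.cong) (auto simp: a[symmetric])
  also have "\<dots> = (\<Sum>i<k. \<gamma> i * (\<Sum>c<m. G (i, c) * a c))"
    unfolding sum_distrib_left sum_distrib_right by (subst sum.swap) (simp add: mult.assoc)
  also have "\<dots> = (\<Sum>i<k. if i = 0 then \<gamma> 0 * n else 0)"
    by (intro sum.cong) (auto simp: Ga)
  finally have N: "N = \<gamma> 0 * n" using k by simp
  have va: "(\<Sum>c<m. v i c * a c) = \<gamma> 0 * (\<Sum>c<m. v i c * G (0, c))" if "i < b" for i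
  proof -
    have "(\<Sum>c<m. v i c * a c) = (\<Sum>c<m. \<Sum>j<k. \<gamma> j * (G (j, c) * v i c))"
      by (intro sum.cong) (auto simp: a sum_distrib_left mult_ac)
    also have "\<dots> = (\<Sum>j<k. \<gamma> j * (\<Sum>c<m. G (j, c) * v i c))"
      unfolding sum_distrib_left by (rule sum.swap)
    also have "\<dots> = (\<Sum>j<k. if j = 0 then \<gamma> 0 * (\<Sum>c<m. G (0, c) * v i c) else 0)"
      using orth that by (intro sum.cong) auto
    finally show ?thesis using k by (simp add: mult.commute)
  qed
  have bessel: "(\<Sum>i<b. (\<Sum>c<m. v i c * a c)\<^sup>2) \<le> N"
  proof -
    have "(\<Sum>i<b. (\<Sum>c<m. v i c * a c)\<^sup>2) \<le> (\<Sum>i<m. (\<Sum>c<m. v i c * a c)\<^sup>2)"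
      using b by (intro sum_mono2) auto
    also have "\<dots> = (\<Sum>i<m. \<Sum>c<m. \<Sum>c'<m. (v i c * v i c') * (a c * a c'))"
      by (simp add: power2_eq_square sum_product mult_ac)
    also have "\<dots> = (\<Sum>c<m. \<Sum>c'<m. \<Sum>i<m. (v i c * v i c') * (a c * a c'))"
      by (subst sum.swap, rule sum.cong[OF refl], rule sum.swap)
    also have "\<dots> = (\<Sum>c<m. \<Sum>c'<m. if c = c' then a c * a c' else 0)"
      using orthonormal_rows_imp_columns[OF v] by (intro sum.cong refl) (simp add: sum_distrib_right[symmetric])
    finally show ?thesis by (simp add: N_def power2_eq_square)
  qed
  \<comment> \<open>Bessel's inequality for the frame \<open>v\<close>, in which only row 0
    contributes to \<open>a\<close>. Cancelling one \<open>\<gamma> 0\<close> and multiplying by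
    \<open>n\<close> gives the claim; if \<open>\<gamma> 0\<close> is not positive then N =
    0.\<close>
  have "(\<gamma> 0)\<^sup>2 * D \<le> \<gamma> 0 * n"
    using bessel N by (simp add: va power_mult_distrib sum_distrib_left[symmetric] D_def)
  moreover have "\<gamma> 0 > 0 \<or> N = 0" using N N0 n by (cases "\<gamma> 0 > 0") (auto simp: mult_le_0_iff zero_le_mult_iff)
  ultimately have "N * D \<le> n\<^sup>2"
  proof (elim disjE)
    assume *: "(\<gamma> 0)\<^sup>2 * D \<le> \<gamma> 0 * n" "\<gamma> 0 > 0"
    then have "\<gamma> 0 * D \<le> n" by (simp add: power2_eq_square mult.assoc)
    then have "n * (\<gamma> 0 * D) \<le> n * n" using n by (intro mult_left_mono)
    then show ?thesis by (simp add: N power2_eq_square mult_ac)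
  qed simp
  then show ?thesis by (simp add: N_def D_def a_def)
qed

lemma borel_measurable_sqrt_comp: "f \<in> borel_measurable M \<Longrightarrow> (\<lambda>x. sqrt (f x)) \<in> borel_measurable M"
  by measurable

text \<open>Given rows 1, ..., k - 1, the orthogonal complement of their span contains r + 2 = m -
  (k - 1) orthonormal directions. The components of the independent row 0 along them are standard
  normal, and the norm of the solution is at most |z| divided by the norm of these
  components.\<close>

lemma nn_integral_gaussian_pinv_power_le:
  fixes z :: "nat \<Rightarrow> real"
  assumes k: "k \<ge> 1" and r: "r \<ge> 1" and m: "m = k + r + 1"
  shows "(\<integral>\<^sup>+G. ennreal (sqrt (\<Sum>c<m. (\<Sum>i<k. pinv k m G c i * z i)\<^sup>2) ^ r) \<partial>gaussian ({..<k} \<times> {..<m}))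
    \<le> ennreal (sqrt (\<Sum>i<k. (z i)\<^sup>2) ^ r * (abs_moment r / fact r))"
proof -
  let ?I = "{..<k} \<times> {..<m}"
  let ?R = "{1..<k} \<times> {..<m}" and ?T = "{0::nat} \<times> {..<m}"
  define n where "n = sqrt (\<Sum>i<k. (z i)\<^sup>2)"
  have n: "n \<ge> 0" by (simp add: n_def sum_nonneg)
  \<comment> \<open>The value of \<open>exp_mixture r 1\<close>, the constant relating
    \<open>exp_mixture r y\<close> to y^(- r / 2).\<close>
  define E where "E = fact r / (r * sqrt 2 ^ r * abs_moment r)"
  have E: "E > 0" using r abs_moment_pos[of r] by (simp add: E_def)
  define h where "h = householder {..<k} (\<lambda>i. z i - (if i = 0 then n else 0))"
  have hz: "(\<Sum>j<k. h j i * z j) = (if i = 0 then n else 0)" if "i < k" for i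
    using householder_to_axis[of "{..<k}" 0 i z] k that unfolding h_def n_def
    by (subst householder_sym) simp
  have h1: "(\<Sum>l<k. h l i * h l j) = (if i = j then 1 else 0)" if "i < k" "j < k" for i j
    using householder_orthogonal'[of "{..<k}" i j] that by (simp add: h_def)
  have h2: "(\<Sum>l<k. h i l * h j l) = (if i = j then 1 else 0)" if "i < k" "j < k" for i j
    using householder_orthogonal[of "{..<k}" i j] that by (simp add: h_def)
  let ?rot = "\<lambda>G. \<lambda>(i, c)\<in>?I. \<Sum>i'<k. h i i' * G (i', c)"
  let ?norm = "\<lambda>G. sqrt (\<Sum>c<m. (\<Sum>i<k. pinv k m G c i * z i)\<^sup>2)"
  have comp: "(\<lambda>G. G (i, c)) \<in> borel_measurable (gaussian ?I)" if "i < k" "c < m" for i c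
    using that by (intro borel_measurable_gaussian_component) simp
  have fm[measurable]: "(\<lambda>G. ennreal (?norm G ^ r)) \<in> borel_measurable (gaussian ?I)"
    by (intro measurable_compose[OF _ measurable_ennreal] borel_measurable_power
      borel_measurable_sqrt_comp borel_measurable_sum borel_measurable_times borel_measurable_pinv comp) auto
  have rm[measurable]: "?rot \<in> measurable (gaussian ?I) (gaussian ?I)"
  proof -
    have "(\<lambda>G. \<Sum>i'<k. h i i' * G (i', c)) \<in> borel_measurable (gaussian ?I)" if "c < m" for i c
      using that by (intro borel_measurable_sum borel_measurable_times comp) auto
    then show ?thesis
      by (simp cong: measurable_cong_sets add: sets_gaussian) (intro measurable_restrict, auto)
  qed
  \<comment> \<open>With \<open>N\<close> the norm on the left and \<open>D\<close> the sum of
    squares on the right, this is N^2 * D \<le> n^2 solved for N^r. Writing D^(- r / 2) as a mixture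
    includes the case D = 0, where the right-hand side may be infinite.\<close>
  have key: "ennreal (?norm (?rot G) ^ r)
      \<le> ennreal (n ^ r / E) * exp_mixture r (\<Sum>i<r + 2. (\<Sum>c<m. v i c * G (0, c))\<^sup>2)"
    if v: "\<And>i i'. i < m \<Longrightarrow> i' < m \<Longrightarrow> (\<Sum>c<m. v i c * v i' c) = (if i = i' then 1 else 0)"
      and orth: "\<And>i j. i < r + 2 \<Longrightarrow> 1 \<le> j \<Longrightarrow> j < k \<Longrightarrow> (\<Sum>c<m. G (j, c) * v i c) = 0"
    for v :: "nat \<Rightarrow> nat \<Rightarrow> real" and G
  proof (cases "?norm (?rot G) = 0")
    case True
    then show ?thesis using r by (simp add: power_0_left)
  next
    case False
    define N where "N = ?norm (?rot G)"
    define D where "D = (\<Sum>i<r + 2. (\<Sum>c<m. v i c * G (0, c))\<^sup>2)"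
    have N: "N > 0" using False by (simp add: N_def sum_nonneg less_le)
    have b: "r + 2 \<le> m" using m k by simp
    have "(\<Sum>c<m. (\<Sum>i<k. pinv k m (?rot G) c i * z i)\<^sup>2) * D \<le> n\<^sup>2"
      unfolding D_def by (rule pinv_norm_rotated[OF k h1 hz v orth b n]) auto
    moreover have "N\<^sup>2 = (\<Sum>c<m. (\<Sum>i<k. pinv k m (?rot G) c i * z i)\<^sup>2)"
      unfolding N_def by (rule real_sqrt_pow2) (simp add: sum_nonneg)
    ultimately have "N\<^sup>2 * D \<le> n\<^sup>2" by simp
    have "n \<noteq> 0"
    proof
      assume "n = 0"
      then have "\<forall>i<k. z i = 0" by (simp add: n_def sum_nonneg_eq_0_iff)
      then have "N = 0" by (simp add: N_def)
      then show False using N by simp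
    qed
    with \<open>N\<^sup>2 * D \<le> n\<^sup>2\<close> have D: "D \<le> (n / N)\<^sup>2" and nN: "n / N > 0" using N n by (simp_all add: field_simps)
    have "ennreal E = ennreal ((n / N) ^ r) * exp_mixture r ((n / N)\<^sup>2)"
    proof -
      have sq: "sqrt ((n / N)\<^sup>2) = n / N" using nN by (intro real_sqrt_unique) auto
      have pos: "(n / N)\<^sup>2 > 0" using nN by (rule zero_less_power)
      show ?thesis using exp_mixture_scale[OF r pos] unfolding sq exp_mixture_one[OF r] E_def .
    qed
    also have "\<dots> \<le> ennreal ((n / N) ^ r) * exp_mixture r D"
      by (intro mult_left_mono exp_mixture_antimono D) simp
    finally have "ennreal (N ^ r / E) * ennreal E \<le> ennreal (N ^ r / E) * (ennreal ((n / N) ^ r) * exp_mixture r D)"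
      by (rule mult_left_mono) simp
    also have "\<dots> = ennreal (n ^ r / E) * exp_mixture r D"
      using N n E nN by (simp add: mult.assoc[symmetric] ennreal_mult[symmetric] power_divide)
    also have "ennreal (N ^ r / E) * ennreal E = ennreal (N ^ r)"
      using N E by (simp add: ennreal_mult[symmetric])
    finally show ?thesis by (simp add: N_def D_def)
  qed
  have split: "?R \<union> ?T = ?I" "?R \<inter> ?T = {}" using k by auto
  have "integral\<^sup>N (gaussian ?I) (\<lambda>G. ennreal (?norm G ^ r)) = (\<integral>\<^sup>+G. ennreal (?norm (?rot G) ^ r) \<partial>gaussian ?I)"
    by (rule nn_integral_gaussian_rotate_rows[symmetric, OF _ _ fm]) (auto simp: h1 h2)
  also have "\<dots> = (\<integral>\<^sup>+x. \<integral>\<^sup>+y. ennreal (?norm (?rot (merge ?R ?T (x, y))) ^ r) \<partial>gaussian ?T \<partial>gaussian ?R)"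
  proof -
    have "(\<lambda>G. ennreal (?norm (?rot G) ^ r)) \<in> borel_measurable (gaussian (?R \<union> ?T))"
      unfolding split by measurable
    from nn_integral_gaussian_fold[OF split(2) _ _ this] show ?thesis unfolding split by simp
  qed
  also have "\<dots> \<le> (\<integral>\<^sup>+x. ennreal (n ^ r / E * (1 / (r * sqrt 2 ^ r))) \<partial>gaussian ?R)"
  proof (rule nn_integral_mono)
    fix x :: "nat \<times> nat \<Rightarrow> real"
    \<comment> \<open>The frame \<open>v\<close> is chosen separately for each \<open>x\<close>.
      This raises no measurability question in \<open>x\<close>, because the bound obtained for the
      inner integral is a constant.\<close>
    have "k - 1 + (r + 2) = m" using m k by simp
    from exists_orthonormal_basis_orthogonal_to[OF this, of "\<lambda>j c. x (j + 1, c)"]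
    obtain v where v': "\<forall>i<m. \<forall>i'<m. (\<Sum>c<m. v i c * v i' c) = (if i = i' then 1 else 0)"
      and orth': "\<forall>i<r + 2. \<forall>j<k - 1. (\<Sum>c<m. x (j + 1, c) * v i c) = 0"
      by (elim exE conjE)
    note v = v'[rule_format] and orth = orth'[rule_format]
    have comp': "(\<lambda>y. y (0, c)) \<in> borel_measurable (gaussian ?T)" if "c < m" for c
    using that by (intro borel_measurable_gaussian_component) simp
    have gm: "(\<lambda>y. exp_mixture r (\<Sum>i<r + 2. (y (0, i))\<^sup>2)) \<in> borel_measurable (gaussian ?T)"
      using m k by (intro measurable_compose[OF _ exp_mixture_measurable] borel_measurable_sum borel_measurable_power comp') auto
    have gm': "(\<lambda>y. exp_mixture r (\<Sum>i<r + 2. (\<Sum>c<m. v i c * y (0, c))\<^sup>2)) \<in> borel_measurable (gaussian ?T)"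
      by (intro measurable_compose[OF _ exp_mixture_measurable] borel_measurable_sum borel_measurable_power borel_measurable_times comp') auto
    have "(\<integral>\<^sup>+y. ennreal (?norm (?rot (merge ?R ?T (x, y))) ^ r) \<partial>gaussian ?T)
      \<le> (\<integral>\<^sup>+y. ennreal (n ^ r / E) * exp_mixture r (\<Sum>i<r + 2. (\<Sum>c<m. v i c * y (0, c))\<^sup>2) \<partial>gaussian ?T)"
    proof (rule nn_integral_mono)
      fix y :: "nat \<times> nat \<Rightarrow> real"
      let ?G = "merge ?R ?T (x, y)"
      have "(\<Sum>c<m. ?G (j, c) * v i c) = 0" if "i < r + 2" "1 \<le> j" "j < k" for i j
        using orth[of i "j - 1"] that by (simp add: merge_def)
      from key[OF v this]
      have "ennreal (?norm (?rot ?G) ^ r) \<le> ennreal (n ^ r / E) * exp_mixture r (\<Sum>i<r + 2. (\<Sum>c<m. v i c * ?G (0, c))\<^sup>2)"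
        by simp
      moreover have "?G (0, c) = y (0, c)" if "c < m" for c using that by (simp add: merge_def)
      ultimately show "ennreal (?norm (?rot ?G) ^ r) \<le> ennreal (n ^ r / E) * exp_mixture r (\<Sum>i<r + 2. (\<Sum>c<m. v i c * y (0, c))\<^sup>2)"
        by simp
    qed
    also have "\<dots> = ennreal (n ^ r / E) * (\<integral>\<^sup>+y. exp_mixture r (\<Sum>i<r + 2. (\<Sum>c<m. v i c * y (0, c))\<^sup>2) \<partial>gaussian ?T)"
      by (rule nn_integral_cmult[OF gm'])
    also have "(\<integral>\<^sup>+y. exp_mixture r (\<Sum>i<r + 2. (\<Sum>c<m. v i c * y (0, c))\<^sup>2) \<partial>gaussian ?T)
      = (\<integral>\<^sup>+y. exp_mixture r (\<Sum>i<r + 2. ((\<lambda>(i, c)\<in>?T. \<Sum>c'<m. v c c' * y (i, c')) (0, i))\<^sup>2) \<partial>gaussian ?T)"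
      using m k by (intro nn_integral_cong arg_cong[of _ _ "exp_mixture r"] sum.cong) auto
    \<comment> \<open>The frame depends only on \<open>x\<close>, hence is fixed while row 0 varies;
      rotating row 0 by \<open>v\<close> replaces its components along the frame by single
      coordinates.\<close>
    also have "\<dots> = (\<integral>\<^sup>+y. exp_mixture r (\<Sum>i<r + 2. (y (0, i))\<^sup>2) \<partial>gaussian ?T)"
      using v orthonormal_rows_imp_columns[of m v, OF v]
      by (intro nn_integral_gaussian_rotate_columns[OF _ _ gm]) auto
    also have "\<dots> = (\<integral>\<^sup>+y. exp_mixture r (\<Sum>p\<in>{0} \<times> {..<r + 2}. (y p)\<^sup>2) \<partial>gaussian ?T)"
      by (simp only: sum.cartesian_product') simp
    also have "\<dots> = ennreal (1 / (r * sqrt 2 ^ r))"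
      using m k r by (intro nn_integral_gaussian_exp_mixture) auto
    also have "ennreal (n ^ r / E) * ennreal (1 / (r * sqrt 2 ^ r)) = ennreal (n ^ r / E * (1 / (r * sqrt 2 ^ r)))"
      using n E by (intro ennreal_mult[symmetric]) auto
    finally show "(\<integral>\<^sup>+y. ennreal (?norm (?rot (merge ?R ?T (x, y))) ^ r) \<partial>gaussian ?T)
      \<le> ennreal (n ^ r / E * (1 / (r * sqrt 2 ^ r)))" .
  qed
  also have "\<dots> = ennreal (n ^ r / E * (1 / (r * sqrt 2 ^ r)))"
  proof -
    interpret prob_space "gaussian ?R" by (rule prob_space_gaussian)
    show ?thesis by (subst nn_integral_const) (simp only: emeasure_space_1 mult_1_right)
  qed
  also have "n ^ r / E * (1 / (r * sqrt 2 ^ r)) = n ^ r * (abs_moment r / fact r)"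
    using r by (simp add: E_def)
  finally show ?thesis by (simp add: n_def)
qed

text \<open>The expectation of \<open>\<bar>\<Sigma>\<^sub>2 G\<^sub>2 G\<^sub>1\<^sup>\<dagger> z\<bar> ^ r\<close>, where \<open>z\<close> is an additional Gaussian vector. Given \<open>G\<^sub>1\<close> and \<open>z\<close>, the
  vector \<open>G\<^sub>2 G\<^sub>1\<^sup>\<dagger> z\<close> is Gaussian, so no estimate for the norm of a Gaussian matrix is needed.\<close>

definition test_moment :: "nat \<Rightarrow> nat \<Rightarrow> nat \<Rightarrow> nat \<Rightarrow> (nat \<Rightarrow> real) \<Rightarrow> (nat \<times> nat \<Rightarrow> real) \<Rightarrow> ennreal" where
  "test_moment d k m r \<mu> G = (\<integral>\<^sup>+z. ennreal (sqrt (\<Sum>j\<in>{k..<d}. (\<mu> j)\<^sup>2 *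
      (\<Sum>c<m. G (j, c) * (\<Sum>i<k. pinv k m G c i * z i))\<^sup>2) ^ r) \<partial>gaussian {..<k})"

lemma test_moment_integrand_measurable:
  assumes "k \<le> d"
  shows "(\<lambda>(G, z). ennreal (sqrt (\<Sum>j\<in>{k..<d}. (\<mu> j)\<^sup>2 *
      (\<Sum>c<m. G (j, c) * (\<Sum>i<k. pinv k m G c i * z i))\<^sup>2) ^ r))
    \<in> borel_measurable (gaussian ({..<d} \<times> {..<m}) \<Otimes>\<^sub>M gaussian {..<k})"
proof -
  have comp: "(\<lambda>\<omega>. fst \<omega> (i, c)) \<in> borel_measurable (gaussian ({..<d} \<times> {..<m}) \<Otimes>\<^sub>M gaussian {..<k})"
    if "i < d" "c < m" for i c
  proof -
    have "(i, c) \<in> {..<d} \<times> {..<m}" using that by simp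
    then show ?thesis by measurable
  qed
  have comp2: "(\<lambda>\<omega>. snd \<omega> i) \<in> borel_measurable (gaussian ({..<d} \<times> {..<m}) \<Otimes>\<^sub>M gaussian {..<k})"
    if "i < k" for i
  proof -
    have "i \<in> {..<k}" using that by simp
    then show ?thesis by measurable
  qed
  show ?thesis unfolding case_prod_beta using assms
    by (intro measurable_compose[OF _ measurable_ennreal] borel_measurable_power borel_measurable_const
      borel_measurable_sqrt_comp borel_measurable_sum borel_measurable_times borel_measurable_pinv comp comp2) auto
qed

lemma test_moment_measurable:
  assumes "k \<le> d"
  shows "test_moment d k m r \<mu> \<in> borel_measurable (gaussian ({..<d} \<times> {..<m}))"
proof -
  interpret prob_space "gaussian {..<k} :: (nat \<Rightarrow> real) measure" by (rule prob_space_gaussian)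
  show ?thesis unfolding test_moment_def[abs_def]
    by (rule borel_measurable_nn_integral[OF test_moment_integrand_measurable[OF assms]])
qed

text \<open>Fubini makes the test vector \<open>z\<close> the outermost variable. The three factors
  then arise from inside out: the square root with \<open>S\<close> from \<open>G\<^sub>2\<close>
  applied to the fixed vector a = \<open>G\<^sub>1\<^sup>\<dagger> z\<close>,
  \<open>abs_moment r / fact r\<close> from |a|^r, and \<open>sqrt (real (k + r)) ^ r\<close> from
  |z|^r with unit weights.\<close>

lemma nn_integral_test_moment_le:
  fixes \<mu> :: "nat \<Rightarrow> real"
  assumes k: "k \<ge> 1" "k \<le> d" and r: "r \<ge> 1" and m: "m = k + r + 1"
    and S: "\<And>j. k \<le> j \<Longrightarrow> j < d \<Longrightarrow> (\<mu> j)\<^sup>2 \<le> S" "0 \<le> S"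
  shows "integral\<^sup>N (gaussian ({..<d} \<times> {..<m})) (test_moment d k m r \<mu>)
    \<le> ennreal (sqrt ((\<Sum>j\<in>{k..<d}. (\<mu> j)\<^sup>2) + r * S) ^ r * sqrt (real (k + r)) ^ r * (abs_moment r / fact r))"
proof -
  let ?D = "{..<d} \<times> {..<m}" and ?I = "{..<k} \<times> {..<m}" and ?J = "{k..<d} \<times> {..<m}"
  define B where "B = sqrt ((\<Sum>j\<in>{k..<d}. (\<mu> j)\<^sup>2) + r * S)"
  have B: "B \<ge> 0" using S by (simp add: B_def sum_nonneg)
  let ?f = "\<lambda>G z. ennreal (sqrt (\<Sum>j\<in>{k..<d}. (\<mu> j)\<^sup>2 *
      (\<Sum>c<m. G (j, c) * (\<Sum>i<k. pinv k m G c i * z i))\<^sup>2) ^ r)"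
  let ?norm = "\<lambda>z G. sqrt (\<Sum>c<m. (\<Sum>i<k. pinv k m G c i * z i)\<^sup>2)"
  have am: "abs_moment r / fact r > 0" using abs_moment_pos[of r] by simp
  interpret D: prob_space "gaussian ?D" by (rule prob_space_gaussian)
  interpret K: prob_space "gaussian {..<k} :: (nat \<Rightarrow> real) measure" by (rule prob_space_gaussian)
  interpret pair_sigma_finite "gaussian ?D" "gaussian {..<k}" by standard
  note fm = test_moment_integrand_measurable[OF k(2), of \<mu> m r]
  have split: "?I \<union> ?J = ?D" "?I \<inter> ?J = {}" using k by auto
  have comp: "(\<lambda>G. G (i, c)) \<in> borel_measurable (gaussian ?I)" if "i < k" "c < m" for i c
    using that by (intro borel_measurable_gaussian_component) simp
  have inner: "(\<integral>\<^sup>+G. ?f G z \<partial>gaussian ?D) \<le> ennreal (B ^ r * (abs_moment r / fact r)) * ennreal (sqrt (\<Sum>i<k. (z i)\<^sup>2) ^ r)"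
    if z: "z \<in> space (gaussian {..<k})" for z
  proof -
    have "(\<lambda>G. ?f G z) \<in> borel_measurable (gaussian ?D)"
      using measurable_compose[OF measurable_Pair2'[OF z] fm] by simp
    then have fz: "(\<lambda>G. ?f G z) \<in> borel_measurable (gaussian (?I \<union> ?J))" by (simp only: split)
    have nm: "(\<lambda>G. ennreal (?norm z G ^ r)) \<in> borel_measurable (gaussian ?I)"
      by (intro measurable_compose[OF _ measurable_ennreal] borel_measurable_power
        borel_measurable_sqrt_comp borel_measurable_sum borel_measurable_times borel_measurable_pinv comp) auto
    have "(\<integral>\<^sup>+G. ?f G z \<partial>gaussian ?D) = (\<integral>\<^sup>+x. \<integral>\<^sup>+y. ?f (merge ?I ?J (x, y)) z \<partial>gaussian ?J \<partial>gaussian ?I)"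
      using nn_integral_gaussian_fold[OF split(2) _ _ fz] unfolding split by simp
    also have "\<dots> \<le> (\<integral>\<^sup>+x. ennreal (B ^ r) * ennreal (?norm z x ^ r) \<partial>gaussian ?I)"
    proof (rule nn_integral_mono)
      fix x :: "nat \<times> nat \<Rightarrow> real"
      have pc: "pinv k m (merge ?I ?J (x, y)) c i = pinv k m x c i" if "c < m" for y c i
        using that by (intro pinv_cong) (auto simp: merge_def)
      have "(\<integral>\<^sup>+y. ?f (merge ?I ?J (x, y)) z \<partial>gaussian ?J) =
        (\<integral>\<^sup>+y. ennreal (sqrt (\<Sum>j\<in>{k..<d}. (\<mu> j)\<^sup>2 * (\<Sum>c\<in>{..<m}. y (j, c) * (\<Sum>i<k. pinv k m x c i * z i))\<^sup>2) ^ r) \<partial>gaussian ?J)"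
      proof (intro nn_integral_cong)
        fix y :: "nat \<times> nat \<Rightarrow> real"
        have eq: "(\<Sum>c<m. merge ?I ?J (x, y) (j, c) * (\<Sum>i<k. pinv k m (merge ?I ?J (x, y)) c i * z i)) =
          (\<Sum>c<m. y (j, c) * (\<Sum>i<k. pinv k m x c i * z i))" if "j \<in> {k..<d}" for j
        proof (intro sum.cong refl arg_cong2[of _ _ _ _ "(*)"])
          fix c assume "c \<in> {..<m}"
          then show "merge ?I ?J (x, y) (j, c) = y (j, c)" using that by (simp add: merge_def)
        qed (auto simp: pc)
        have "(\<Sum>j\<in>{k..<d}. (\<mu> j)\<^sup>2 * (\<Sum>c<m. merge ?I ?J (x, y) (j, c) * (\<Sum>i<k. pinv k m (merge ?I ?J (x, y)) c i * z i))\<^sup>2)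
          = (\<Sum>j\<in>{k..<d}. (\<mu> j)\<^sup>2 * (\<Sum>c<m. y (j, c) * (\<Sum>i<k. pinv k m x c i * z i))\<^sup>2)"
          by (rule sum.cong[OF refl]) (simp only: eq)
        then show "?f (merge ?I ?J (x, y)) z = ennreal (sqrt (\<Sum>j\<in>{k..<d}. (\<mu> j)\<^sup>2 *
            (\<Sum>c\<in>{..<m}. y (j, c) * (\<Sum>i<k. pinv k m x c i * z i))\<^sup>2) ^ r)"
          by simp
      qed
      also have "\<dots> \<le> ennreal (?norm z x ^ r * B ^ r)"
        unfolding B_def using S by (intro nn_integral_gaussian_matrix_vector_power_le r) auto
      finally show "(\<integral>\<^sup>+y. ?f (merge ?I ?J (x, y)) z \<partial>gaussian ?J) \<le> ennreal (B ^ r) * ennreal (?norm z x ^ r)"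
        using B by (simp add: ennreal_mult[symmetric] sum_nonneg mult.commute)
    qed
    also have "\<dots> = ennreal (B ^ r) * (\<integral>\<^sup>+x. ennreal (?norm z x ^ r) \<partial>gaussian ?I)"
      by (rule nn_integral_cmult[OF nm])
    also have "\<dots> \<le> ennreal (B ^ r) * ennreal (sqrt (\<Sum>i<k. (z i)\<^sup>2) ^ r * (abs_moment r / fact r))"
      by (intro mult_left_mono nn_integral_gaussian_pinv_power_le k r m) simp
    also have "\<dots> = ennreal (B ^ r * (abs_moment r / fact r)) * ennreal (sqrt (\<Sum>i<k. (z i)\<^sup>2) ^ r)"
      using B am by (simp add: ennreal_mult[symmetric] sum_nonneg mult_ac abs_moment_pos[THEN less_imp_le])
    finally show ?thesis .
  qed
  have "integral\<^sup>N (gaussian ?D) (test_moment d k m r \<mu>) = (\<integral>\<^sup>+z. \<integral>\<^sup>+G. ?f G z \<partial>gaussian ?D \<partial>gaussian {..<k})"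
    unfolding test_moment_def by (rule Fubini'[symmetric, OF fm])
  also have "\<dots> \<le> (\<integral>\<^sup>+z. ennreal (B ^ r * (abs_moment r / fact r)) * ennreal (sqrt (\<Sum>i<k. (z i)\<^sup>2) ^ r) \<partial>gaussian {..<k})"
    by (rule nn_integral_mono) (rule inner)
  also have "\<dots> = ennreal (B ^ r * (abs_moment r / fact r)) * (\<integral>\<^sup>+z. ennreal (sqrt (\<Sum>i<k. (z i)\<^sup>2) ^ r) \<partial>gaussian {..<k})"
    by (rule nn_integral_cmult) measurable
  also have "\<dots> \<le> ennreal (B ^ r * (abs_moment r / fact r)) * ennreal (sqrt (real (k + r)) ^ r)"
    using nn_integral_gaussian_weighted_norm_power_le[of "{..<k}" r "\<lambda>_. 1" 1] r
    by (intro mult_left_mono) simp_all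
  also have "\<dots> = ennreal (B ^ r * sqrt (real (k + r)) ^ r * (abs_moment r / fact r))"
    using B am by (simp add: ennreal_mult[symmetric] mult_ac abs_moment_pos[THEN less_imp_le])
  finally show ?thesis by (simp add: B_def)
qed

section \<open>Almost sure full rank of Gaussian blocks\<close>

abbreviation leading_block :: "nat \<Rightarrow> (nat \<times> nat \<Rightarrow> real) \<Rightarrow> real mat" where
  "leading_block j G \<equiv> Matrix.mat j j (\<lambda>(i, c). G (i, c))"

lemma emeasure_std_normal_singleton: "emeasure std_normal {t} = 0"
proof -
  have "emeasure std_normal {t} = (\<integral>\<^sup>+x. ennreal (std_normal_density x) * indicator {t} x \<partial>lborel)"
    unfolding std_normal_def by (rule emeasure_density) auto
  also have "AE x in lborel. ennreal (std_normal_density x) * indicator {t} x = 0"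
    using AE_lborel_singleton[of t] by eventually_elim auto
  then have "(\<integral>\<^sup>+x. ennreal (std_normal_density x) * indicator {t} x \<partial>lborel) = 0"
    by (subst nn_integral_0_iff_AE) auto
  finally show ?thesis .
qed

text \<open>Laplace expansion along the last column: its cofactors do not involve that column, so
  the determinant is affine in the corner entry, with the smaller leading minor as slope.\<close>

lemma det_leading_block_Suc:
  "det (leading_block (Suc j) (G((j, j) := y))) =
    y * det (leading_block j G) + det (leading_block (Suc j) (G((j, j) := 0)))"
proof -
  let ?A = "\<lambda>y. leading_block (Suc j) (G((j, j) := y))"
  have cof: "cofactor (?A y) i j = cofactor (?A 0) i j" if "i \<le> j" for i y
    unfolding cofactor_def using that
    by (intro arg_cong2[where f = "(*)"] refl arg_cong[of _ _ det]) (auto simp: mat_delete_def intro!: cong_mat)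
  have exp: "det (?A y) = (\<Sum>i<Suc j. ?A y $$ (i, j) * cofactor (?A y) i j)" for y
    by (rule laplace_expansion_column) auto
  have last: "cofactor (?A 0) j j = det (leading_block j G)"
  proof -
    have "mat_delete (?A 0) j j = leading_block j G" unfolding mat_delete_def by (intro eq_matI) auto
    then show ?thesis unfolding cofactor_def by (simp only: minus_one_power_iff even_add simp_thms if_True mult_1_left)
  qed
  have det: "det (?A y) = (\<Sum>i<j. ?A 0 $$ (i, j) * cofactor (?A 0) i j) + y * cofactor (?A 0) j j" for y
    unfolding exp sum.lessThan_Suc
    by (intro arg_cong2[of _ _ _ _ "(+)"] arg_cong2[of _ _ _ _ "(*)"] sum.cong refl cof) auto
  show ?thesis
    unfolding det[of y] det[of 0] last mult_zero_left add_0_right by (rule add.commute)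
qed

text \<open>Induction on the size: if the smaller minor is nonzero, at most one value of the corner
  entry makes the next minor vanish, and a single value has Gaussian measure 0 for fixed other
  entries.\<close>

lemma AE_gaussian_det_leading_block:
  assumes "j \<le> d" "j \<le> m"
  shows "AE G in gaussian ({..<d} \<times> {..<m}). det (leading_block j G) \<noteq> 0"
  using assms
proof (induction j)
  case (Suc j)
  let ?D = "{..<d} \<times> {..<m}" and ?J = "{(j, j)}"
  let ?I = "?D - ?J"
  have split: "?I \<union> ?J = ?D" "?I \<inter> ?J = {}" using Suc.prems by auto
  have comp: "(\<lambda>G. G (i, c)) \<in> borel_measurable (gaussian ?D)" if "i < d" "c < m" for i c
    using that by (intro borel_measurable_gaussian_component) simp
  have dm[measurable]: "(\<lambda>G. det (leading_block l G)) \<in> borel_measurable (gaussian ?D)" if "l \<le> Suc j" for l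
    using Suc.prems that by (intro borel_measurable_det comp) auto
  define f where "f G = (if det (leading_block (Suc j) G) = 0 \<and> det (leading_block j G) \<noteq> 0 then 1 else 0 :: ennreal)" for G
  have fm: "f \<in> borel_measurable (gaussian ?D)"
    unfolding f_def[abs_def] by measurable
  have "integral\<^sup>N (gaussian ?D) f = (\<integral>\<^sup>+x. \<integral>\<^sup>+y. f (merge ?I ?J (x, y)) \<partial>gaussian ?J \<partial>gaussian ?I)"
    using nn_integral_gaussian_fold[OF split(2), of f] fm unfolding split by simp
  also have "\<dots> = (\<integral>\<^sup>+x. 0 \<partial>gaussian ?I)"
  proof (rule nn_integral_cong)
    fix x :: "nat \<times> nat \<Rightarrow> real"
    define b where "b = det (leading_block j x)"
    define q where "q = det (leading_block (Suc j) (x((j, j) := 0)))"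
    define t where "t = - q / b"
    \<comment> \<open>If \<open>b\<close> is nonzero, \<open>t\<close> is the only zero of the
      affine function y * b + q; if \<open>b\<close> is zero, \<open>f\<close> vanishes by its
      second condition and the default value of \<open>t\<close> is harmless.\<close>
    have "f (merge ?I ?J (x, y)) \<le> indicator {t} (y (j, j))" for y
    proof -
      have e1: "leading_block (Suc j) (merge ?I ?J (x, y)) = leading_block (Suc j) (x((j, j) := y (j, j)))"
        using Suc.prems by (intro cong_mat) (auto simp: merge_def)
      have d1: "det (leading_block (Suc j) (merge ?I ?J (x, y))) = y (j, j) * b + q"
        unfolding e1 b_def q_def by (rule det_leading_block_Suc)
      have "leading_block j (merge ?I ?J (x, y)) = leading_block j x"
        using Suc.prems by (intro cong_mat) (auto simp: merge_def)
      then have d2: "det (leading_block j (merge ?I ?J (x, y))) = b" by (simp only: b_def)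
      have "y (j, j) = t" if "y (j, j) * b + q = 0" "b \<noteq> 0"
        using that by (simp add: t_def field_simps)
      then show ?thesis unfolding f_def d1 d2 by auto
    qed
    then have "(\<integral>\<^sup>+y. f (merge ?I ?J (x, y)) \<partial>gaussian ?J) \<le> (\<integral>\<^sup>+y. indicator {t} (y (j, j)) \<partial>gaussian ?J)"
      by (intro nn_integral_mono)
    also have "\<dots> = integral\<^sup>N std_normal (indicator {t})"
      by (rule nn_integral_gaussian_component) auto
    also have "\<dots> = 0" by (simp add: emeasure_std_normal_singleton)
    finally show "(\<integral>\<^sup>+y. f (merge ?I ?J (x, y)) \<partial>gaussian ?J) = 0" by simp
  qed
  finally have "integral\<^sup>N (gaussian ?D) f = 0" by simp
  then have "AE G in gaussian ?D. f G = 0" using fm by (simp add: nn_integral_0_iff_AE)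
  with Suc.IH Suc.prems show ?case by (auto simp: f_def split: if_splits)
qed simp

text \<open>For a kernel vector \<open>v\<close> of the Gram matrix, the quadratic form <v, W v> =
  |\<open>G\<^sub>1\<^sup>T v\<close>|^2 vanishes, so \<open>v\<close> is killed by the transpose of
  every square block of columns. This reduces full row rank to one determinant.\<close>

lemma gram_nonsingular:
  assumes k: "k \<le> m" and det: "det (leading_block k G) \<noteq> 0"
  shows "det (gram k m G) \<noteq> 0"
proof
  assume "det (gram k m G) = 0"
  then obtain v where v: "v \<in> carrier_vec k" "v \<noteq> 0\<^sub>v k" "gram k m G *\<^sub>v v = 0\<^sub>v k"
    using det_0_iff_vec_prod_zero[of "gram k m G" k] by (auto simp: gram_def)
  have "(\<Sum>c<m. (\<Sum>i<k. v $ i * G (i, c))\<^sup>2) = (\<Sum>c<m. \<Sum>i<k. \<Sum>j<k. v $ i * (G (i, c) * G (j, c) * v $ j))"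
    by (simp add: power2_eq_square sum_product mult_ac)
  also have "\<dots> = (\<Sum>i<k. \<Sum>j<k. \<Sum>c<m. v $ i * (G (i, c) * G (j, c) * v $ j))"
    by (subst sum.swap, rule sum.cong[OF refl], rule sum.swap)
  also have "\<dots> = (\<Sum>i<k. v $ i * (gram k m G *\<^sub>v v) $ i)"
    using v(1) by (intro sum.cong refl) (simp add: gram_def scalar_prod_def atLeast0LessThan sum_distrib_left sum_distrib_right)
  also have "\<dots> = 0" unfolding v(3) by simp
  finally have "\<forall>c<m. (\<Sum>i<k. v $ i * G (i, c)) = 0"
    by (subst (asm) sum_nonneg_eq_0_iff) auto
  then have "(leading_block k G)\<^sup>T *\<^sub>v v = 0\<^sub>v k"
    using v(1) k by (intro eq_vecI) (auto simp: scalar_prod_def atLeast0LessThan mult.commute)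
  then have "det ((leading_block k G)\<^sup>T) = 0"
    using v by (subst det_0_iff_vec_prod_zero[of _ k]) auto
  then show False using det det_transpose[of "leading_block k G" k] by simp
qed

section \<open>Spectral decomposition\<close>

definition orthogonal_mat :: "nat \<Rightarrow> real mat \<Rightarrow> bool" where
  "orthogonal_mat n U \<longleftrightarrow> U \<in> carrier_mat n n \<and> U\<^sup>T * U = 1\<^sub>m n \<and> U * U\<^sup>T = 1\<^sub>m n"

lemma orthogonal_mat_mult:
  assumes "orthogonal_mat n U" "orthogonal_mat n V"
  shows "orthogonal_mat n (U * V)"
proof -
  have U: "U \<in> carrier_mat n n" and V: "V \<in> carrier_mat n n" using assms by (auto simp: orthogonal_mat_def)
  let ?U = "U\<^sup>T" and ?V = "V\<^sup>T"
  have T: "?U \<in> carrier_mat n n" "?V \<in> carrier_mat n n" using U V by auto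
  have "(?V * ?U) * (U * V) = ?V * ((?U * U) * V)"
    using U V T by (simp add: assoc_mult_mat[of _ n n _ n _ n])
  also have "\<dots> = 1\<^sub>m n" using assms V by (simp add: orthogonal_mat_def)
  finally have 1: "(?V * ?U) * (U * V) = 1\<^sub>m n" .
  have "(U * V) * (?V * ?U) = U * ((V * ?V) * ?U)"
    using U V T by (simp add: assoc_mult_mat[of _ n n _ n _ n])
  also have "\<dots> = 1\<^sub>m n" using assms by (simp add: orthogonal_mat_def left_mult_one_mat[OF T(1)])
  finally have 2: "(U * V) * (?V * ?U) = 1\<^sub>m n" .
  from 1 2 show ?thesis using U V by (simp add: orthogonal_mat_def transpose_mult[OF U V])
qed

lemma orthogonal_mat_householder_to_axis:
  assumes v: "v \<in> carrier_vec n" and n: "n > 0"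
  obtains H where "orthogonal_mat n H" "H\<^sup>T = H"
    "H *\<^sub>v v = sqrt (scalar_prod v v) \<cdot>\<^sub>v unit_vec n 0"
proof -
  define h where "h = householder {..<n} (\<lambda>i. v $ i - (if i = 0 then sqrt (\<Sum>l<n. (v $ l)\<^sup>2) else 0))"
  define H where "H = Matrix.mat n n (\<lambda>(i, j). h i j)"
  have H: "H \<in> carrier_mat n n" by (simp add: H_def)
  have sym: "H\<^sup>T = H"
    unfolding H_def h_def by (intro eq_matI) (auto simp: householder_sym)
  have HH: "H * H = 1\<^sub>m n"
  proof (intro eq_matI)
    fix i j assume "i < dim_row (1\<^sub>m n :: real mat)" "j < dim_col (1\<^sub>m n :: real mat)"
    then have ij: "i < n" "j < n" by auto
    have "(H * H) $$ (i, j) = (\<Sum>l<n. h i l * h l j)"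
      using ij by (simp add: H_def scalar_prod_def atLeast0LessThan)
    also have "\<dots> = (\<Sum>l<n. h i l * h j l)" by (simp add: h_def householder_sym)
    also have "\<dots> = (if i = j then 1 else 0)"
      unfolding h_def using ij by (intro householder_orthogonal) auto
    finally show "(H * H) $$ (i, j) = 1\<^sub>m n $$ (i, j)" using ij by simp
  qed (use H in auto)
  have nv: "scalar_prod v v = (\<Sum>l<n. (v $ l)\<^sup>2)"
    using v by (simp add: scalar_prod_def atLeast0LessThan power2_eq_square)
  have "H *\<^sub>v v = sqrt (scalar_prod v v) \<cdot>\<^sub>v unit_vec n 0"
  proof (intro eq_vecI)
    fix i assume "i < dim_vec (sqrt (scalar_prod v v) \<cdot>\<^sub>v unit_vec n 0)"
    then have i: "i < n" by simp
    have "(H *\<^sub>v v) $ i = (\<Sum>j<n. h i j * v $ j)"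
      using i v by (simp add: H_def scalar_prod_def atLeast0LessThan)
    also have "\<dots> = (if i = 0 then sqrt (scalar_prod v v) else 0)"
      unfolding h_def nv using i n by (intro householder_to_axis) auto
    finally show "(H *\<^sub>v v) $ i = (sqrt (scalar_prod v v) \<cdot>\<^sub>v unit_vec n 0) $ i" using i n by auto
  qed (use H in auto)
  with that[of H] H sym HH show ?thesis by (simp add: orthogonal_mat_def)
qed

lemma scalar_prod_self_pos:
  assumes "v \<in> carrier_vec n" "v \<noteq> 0\<^sub>v n"
  shows "scalar_prod v v > (0::real)"
proof -
  have "scalar_prod v v = (\<Sum>l<n. (v $ l)\<^sup>2)"
    using assms by (simp add: scalar_prod_def atLeast0LessThan power2_eq_square)
  moreover have "(\<Sum>l<n. (v $ l)\<^sup>2) \<noteq> 0"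
  proof
    assume "(\<Sum>l<n. (v $ l)\<^sup>2) = 0"
    then have "\<forall>l<n. v $ l = 0" by (simp add: sum_nonneg_eq_0_iff)
    then have "v = 0\<^sub>v n" using assms(1) by (intro eq_vecI) auto
    then show False using assms by simp
  qed
  ultimately show ?thesis by (simp add: sum_nonneg less_le)
qed

text \<open>Deflation: the reflection carrying an eigenvector to the first axis splits off a 1 x 1
  block, by symmetry in the row as well as in the column, and cancelling a linear factor gives the
  characteristic polynomial of the rest. Induction over the list keeps the eigenvalues in the
  prescribed order.\<close>

lemma real_spectral_theorem:
  fixes A :: "real mat"
  assumes "A \<in> carrier_mat n n" "A\<^sup>T = A" "char_poly A = (\<Prod>e\<leftarrow>es. [:- e, 1:])"
  shows "\<exists>U. orthogonal_mat n U \<and> A = U * mat_diag n (\<lambda>i. es ! i) * U\<^sup>T"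
  using assms
proof (induction es arbitrary: n A)
  case Nil
  then have "n = 0" using degree_monic_char_poly[of A n] by simp
  then show ?case using Nil by (intro exI[of _ "1\<^sub>m 0"]) (auto simp: orthogonal_mat_def)
next
  case (Cons e es)
  note A = Cons.prems(1)
  have ne: "(\<Prod>e\<leftarrow>es. [:- e, 1:]) \<noteq> 0" by (auto simp: prod_list_zero_iff)
  have "degree (char_poly A) = Suc (degree (\<Prod>e\<leftarrow>es. [:- e, 1:]))"
    unfolding Cons.prems(3) list.map prod_list.Cons by (subst degree_mult_eq[OF _ ne]) auto
  then obtain m where n: "n = Suc m" using degree_monic_char_poly[OF A] by auto
  have "poly (char_poly A) e = 0" using Cons.prems(3) by simp
  then have "eigenvalue A e" using eigenvalue_root_char_poly[OF A] by simp
  then obtain v where v: "v \<in> carrier_vec n" "v \<noteq> 0\<^sub>v n" "A *\<^sub>v v = e \<cdot>\<^sub>v v"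
    using A by (auto simp: eigenvalue_def eigenvector_def)
  obtain H where HO: "orthogonal_mat n H" and Hsym: "H\<^sup>T = H"
    and Hv: "H *\<^sub>v v = sqrt (scalar_prod v v) \<cdot>\<^sub>v unit_vec n 0"
    by (rule orthogonal_mat_householder_to_axis[OF v(1)]) (simp add: n)
  define c where "c = sqrt (scalar_prod v v)"
  have c: "c \<noteq> 0" using scalar_prod_self_pos[OF v(1,2)] by (simp add: c_def)
  have H: "H \<in> carrier_mat n n" and HH: "H * H = 1\<^sub>m n" using HO Hsym by (auto simp: orthogonal_mat_def)
  define A' where "A' = H * A * H"
  have A': "A' \<in> carrier_mat n n" using A H by (simp add: A'_def)
  have A'sym: "A'\<^sup>T = A'"
    unfolding A'_def using A H Cons.prems(2) Hsym
    by (simp add: transpose_mult[of _ n n _ n] assoc_mult_mat[of _ n n _ n _ n])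
  have HAH: "H * A' * H = A"
  proof -
    have "H * A' * H = (H * H) * A * (H * H)"
      unfolding A'_def using A H by (simp add: assoc_mult_mat[of _ n n _ n _ n])
    then show ?thesis using A HH by simp
  qed
  have "A' *\<^sub>v (H *\<^sub>v v) = H *\<^sub>v (A *\<^sub>v ((H * H) *\<^sub>v v))"
    unfolding A'_def using A H v(1) by (simp add: assoc_mult_mat_vec[of _ n n _ n])
  also have "\<dots> = e \<cdot>\<^sub>v (H *\<^sub>v v)"
    using v H by (simp add: HH mult_mat_vec)
  finally have "A' *\<^sub>v (c \<cdot>\<^sub>v unit_vec n 0) = e \<cdot>\<^sub>v (c \<cdot>\<^sub>v unit_vec n 0)" unfolding Hv c_def .
  then have "c \<cdot>\<^sub>v (A' *\<^sub>v unit_vec n 0) = e \<cdot>\<^sub>v (c \<cdot>\<^sub>v unit_vec n 0)"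
    using A' by (simp add: mult_mat_vec)
  then have col0: "A' $$ (i, 0) = (if i = 0 then e else 0)" if "i < n" for i
  proof -
    assume "c \<cdot>\<^sub>v (A' *\<^sub>v unit_vec n 0) = e \<cdot>\<^sub>v (c \<cdot>\<^sub>v unit_vec n 0)"
    then have "(c \<cdot>\<^sub>v (A' *\<^sub>v unit_vec n 0)) $ i = (e \<cdot>\<^sub>v (c \<cdot>\<^sub>v unit_vec n 0)) $ i" by simp
    then show ?thesis using that A' c n by (auto split: if_splits)
  qed
  have row0: "A' $$ (0, j) = (if j = 0 then e else 0)" if "j < n" for j
  proof -
    have "A' $$ (0, j) = A'\<^sup>T $$ (j, 0)" using that A' n by simp
    then show ?thesis using col0[OF that] A'sym by simp
  qed
  define A3 where "A3 = Matrix.mat m m (\<lambda>(i, j). A' $$ (Suc i, Suc j))"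
  have A3: "A3 \<in> carrier_mat m m" by (simp add: A3_def)
  define E where "E = Matrix.mat 1 1 (\<lambda>_. e)"
  have E: "E \<in> carrier_mat 1 1" by (simp add: E_def)
  have blockA: "A' = four_block_mat E (0\<^sub>m 1 m) (0\<^sub>m m 1) A3"
    using A' n by (intro eq_matI) (auto simp: E_def A3_def col0 row0 less_Suc_eq_0_disj)
  have "similar_mat A' A"
    unfolding similar_mat_def similar_mat_wit_def Let_def using A H A' HH
    by (intro exI[of _ H]) (auto simp: A'_def)
  then have "char_poly A' = char_poly A" by (rule char_poly_similar)
  moreover have "char_poly A' = char_poly E * char_poly A3"
    unfolding blockA by (rule char_poly_four_block_zeros_col[OF E _ A3]) simp
  moreover have "char_poly E = [:- e, 1:]"
    unfolding E_def char_poly_defs by (simp add: det_single)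
  ultimately have "[:- e, 1:] * char_poly A3 = [:- e, 1:] * (\<Prod>e\<leftarrow>es. [:- e, 1:])"
    using Cons.prems(3) by simp
  then have cp3: "char_poly A3 = (\<Prod>e\<leftarrow>es. [:- e, 1:])"
    by (subst (asm) mult_left_cancel) auto
  have A3sym: "A3\<^sup>T = A3"
  proof (intro eq_matI)
    fix i j assume "i < dim_row A3" "j < dim_col A3"
    then have ij: "i < m" "j < m" using A3 by auto
    have "A' $$ (Suc j, Suc i) = A'\<^sup>T $$ (Suc i, Suc j)" using ij A' n by simp
    then show "A3\<^sup>T $$ (i, j) = A3 $$ (i, j)" using ij A'sym by (simp add: A3_def)
  qed (use A3 in auto)
  from Cons.IH[OF A3 A3sym cp3] obtain U3 where U3: "orthogonal_mat m U3"
    and A3eq: "A3 = U3 * mat_diag m (\<lambda>i. es ! i) * U3\<^sup>T" by auto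
  have U3c: "U3 \<in> carrier_mat m m" using U3 by (simp add: orthogonal_mat_def)
  have U3t: "U3\<^sup>T \<in> carrier_mat m m" using U3c by simp
  define V where "V = four_block_mat (1\<^sub>m 1) (0\<^sub>m 1 m) (0\<^sub>m m 1) U3"
  have Vt: "V\<^sup>T = four_block_mat (1\<^sub>m 1) (0\<^sub>m 1 m) (0\<^sub>m m 1) (U3\<^sup>T)"
    unfolding V_def by (subst transpose_four_block_mat[of _ 1 1 _ m _ m]) (auto simp: U3c)
  have one: "four_block_mat (1\<^sub>m 1) (0\<^sub>m 1 m) (0\<^sub>m m 1) (1\<^sub>m m) = (1\<^sub>m n :: real mat)"
    unfolding n by (intro eq_matI) auto
  have V: "orthogonal_mat n V"
    unfolding orthogonal_mat_def
  proof (intro conjI)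
    show "V \<in> carrier_mat n n" unfolding V_def n using U3c by auto
    show "V\<^sup>T * V = 1\<^sub>m n"
      unfolding Vt unfolding V_def
      by (subst mult_four_block_mat[of _ 1 1 _ m _ m _ _ 1 _ m]) (use U3 U3c U3t in \<open>auto simp: orthogonal_mat_def one n\<close>)
    show "V * V\<^sup>T = 1\<^sub>m n"
      unfolding Vt unfolding V_def
      by (subst mult_four_block_mat[of _ 1 1 _ m _ m _ _ 1 _ m]) (use U3 U3c U3t in \<open>auto simp: orthogonal_mat_def one n\<close>)
  qed
  let ?D = "mat_diag n (\<lambda>i. (e # es) ! i)"
  have D: "?D = four_block_mat E (0\<^sub>m 1 m) (0\<^sub>m m 1) (mat_diag m (\<lambda>i. es ! i))"
    unfolding n mat_diag_def E_def by (intro eq_matI) (auto simp: nth_Cons split: nat.split)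
  define W where "W = U3 * mat_diag m (\<lambda>i. es ! i)"
  have Wc: "W \<in> carrier_mat m m" unfolding W_def using U3c by (rule mult_carrier_mat) simp
  have z1: "0\<^sub>m (Suc 0) m * mat_diag m f = 0\<^sub>m (Suc 0) m" for f :: "nat \<Rightarrow> real"
    by (rule left_mult_zero_mat) simp
  have z2: "W * 0\<^sub>m m (Suc 0) = 0\<^sub>m m (Suc 0)" by (rule right_mult_zero_mat[OF Wc])
  have z3: "0\<^sub>m m m + W * U3\<^sup>T = W * U3\<^sup>T"
    by (rule left_add_zero_mat, rule mult_carrier_mat[OF Wc U3t])
  have VD: "V * ?D = four_block_mat E (0\<^sub>m 1 m) (0\<^sub>m m 1) W"
    unfolding V_def D by (subst mult_four_block_mat[of _ 1 1 _ m _ m _ _ 1 _ m]) (use U3c E in \<open>auto simp: z1 W_def\<close>)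
  have VDV: "V * ?D * V\<^sup>T = A'"
    unfolding VD Vt
    by (subst mult_four_block_mat[of _ 1 1 _ m _ m _ _ 1 _ m])
      (use Wc U3t E in \<open>auto simp: blockA A3eq W_def[symmetric] z2 z3\<close>)
  have Vc: "V \<in> carrier_mat n n" using V by (simp add: orthogonal_mat_def)
  have "A = H * (V * ?D * V\<^sup>T) * H" unfolding VDV HAH ..
  also have "\<dots> = (H * V) * ?D * (H * V)\<^sup>T"
    using H Vc Hsym by (simp add: transpose_mult[OF H Vc] assoc_mult_mat[of _ n n _ n _ n] mult_carrier_mat[of _ n n _ n])
  finally show ?case using orthogonal_mat_mult[OF HO V] by blast
qed

section \<open>The deterministic error bound\<close>

abbreviation compl_proj :: "real mat \<Rightarrow> real vec \<Rightarrow> real vec" where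
  "compl_proj Q x \<equiv> x - Q *\<^sub>v (Q\<^sup>T *\<^sub>v x)"

lemma euclidean_norm_L2_set: "v \<in> carrier_vec n \<Longrightarrow> euclidean_norm v = L2_set (($) v) {..<n}"
  by (auto simp: euclidean_norm_def L2_set_def scalar_prod_def power2_eq_square atLeast0LessThan intro!: sum.cong)

lemma euclidean_norm_nonneg: "euclidean_norm v \<ge> 0"
  by (simp add: euclidean_norm_L2_set[of v "dim_vec v"] L2_set_nonneg)

lemma euclidean_norm_square: "(euclidean_norm v)\<^sup>2 = scalar_prod v v"
  using euclidean_norm_nonneg[of v]
  by (simp add: euclidean_norm_def)

lemma scalar_prod_le_euclidean_norm:
  assumes "v \<in> carrier_vec n" "w \<in> carrier_vec n"
  shows "scalar_prod v w \<le> euclidean_norm v * euclidean_norm w"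
proof -
  have "scalar_prod v w \<le> (\<Sum>i<n. \<bar>v $ i\<bar> * \<bar>w $ i\<bar>)"
    using assms by (auto simp: scalar_prod_def atLeast0LessThan abs_mult[symmetric] intro!: sum_mono)
  also have "\<dots> \<le> L2_set (($) v) {..<n} * L2_set (($) w) {..<n}" by (rule L2_set_mult_ineq)
  finally show ?thesis using assms by (simp add: euclidean_norm_L2_set)
qed

lemma euclidean_norm_orthonormal_columns:
  assumes Q: "Q \<in> carrier_mat d m" and QQ: "Q\<^sup>T * Q = 1\<^sub>m m" and x: "x \<in> carrier_vec m"
  shows "euclidean_norm (Q *\<^sub>v x) = euclidean_norm x"
proof -
  have "scalar_prod (Q *\<^sub>v x) (Q *\<^sub>v x) = scalar_prod (Q\<^sup>T *\<^sub>v (Q *\<^sub>v x)) x"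
    using Q x by (intro transpose_vec_mult_scalar[symmetric]) auto
  also have "Q\<^sup>T *\<^sub>v (Q *\<^sub>v x) = x"
    using Q x QQ by (subst assoc_mult_mat_vec[symmetric, of _ m d _ m]) auto
  finally show ?thesis by (simp add: euclidean_norm_def)
qed

context
  fixes Q :: "real mat" and d m :: nat
  assumes Q: "Q \<in> carrier_mat d m" and QQ: "Q\<^sup>T * Q = 1\<^sub>m m"
begin

lemma compl_proj_carrier: "x \<in> carrier_vec d \<Longrightarrow> compl_proj Q x \<in> carrier_vec d"
  using Q by auto

lemma transpose_compl_proj:
  assumes x: "x \<in> carrier_vec d"
  shows "Q\<^sup>T *\<^sub>v compl_proj Q x = 0\<^sub>v m"
proof -
  let ?c = "Q\<^sup>T *\<^sub>v x"
  have c: "?c \<in> carrier_vec m" using Q x by auto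
  have "Q\<^sup>T *\<^sub>v compl_proj Q x = ?c - Q\<^sup>T *\<^sub>v (Q *\<^sub>v ?c)"
    using Q x by (intro mult_minus_distrib_mat_vec[of _ m d]) auto
  also have "Q\<^sup>T *\<^sub>v (Q *\<^sub>v ?c) = ?c"
    using Q c QQ by (subst assoc_mult_mat_vec[symmetric, of _ m d _ m]) auto
  finally show ?thesis using c by simp
qed

lemma scalar_prod_compl_proj:
  assumes x: "x \<in> carrier_vec d" and y: "y \<in> carrier_vec d"
  shows "scalar_prod (compl_proj Q x) y = scalar_prod (compl_proj Q x) (compl_proj Q y)"
proof -
  have "scalar_prod (compl_proj Q x) (Q *\<^sub>v (Q\<^sup>T *\<^sub>v y)) =
      scalar_prod (Q\<^sup>T *\<^sub>v compl_proj Q x) (Q\<^sup>T *\<^sub>v y)"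
    using Q x y by (intro transpose_vec_mult_scalar[symmetric]) auto
  also have "\<dots> = 0" using Q y by (simp add: transpose_compl_proj[OF x])
  finally have "scalar_prod (compl_proj Q x) (Q *\<^sub>v (Q\<^sup>T *\<^sub>v y)) = 0" .
  moreover have "scalar_prod (compl_proj Q x) (compl_proj Q y) =
      scalar_prod (compl_proj Q x) y - scalar_prod (compl_proj Q x) (Q *\<^sub>v (Q\<^sup>T *\<^sub>v y))"
    using Q x y by (intro scalar_prod_minus_distrib[of _ d]) auto
  ultimately show ?thesis by simp
qed

text \<open>Pythagoras: the two sides differ by a vector in the range of \<open>Q\<close>, which is
  orthogonal to the residual.\<close>

lemma compl_proj_le_dist:
  assumes x: "x \<in> carrier_vec d" and w: "w \<in> carrier_vec m"
  shows "euclidean_norm (compl_proj Q x) \<le> euclidean_norm (x - Q *\<^sub>v w)"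
proof -
  let ?p = "compl_proj Q x" and ?e = "Q\<^sup>T *\<^sub>v x - w"
  have e: "?e \<in> carrier_vec m" using Q x w by auto
  have p: "?p \<in> carrier_vec d" by (rule compl_proj_carrier[OF x])
  have eq: "x - Q *\<^sub>v w = ?p + Q *\<^sub>v ?e"
    using Q x w by (subst mult_minus_distrib_mat_vec[of _ d m]) auto
  have Qe: "Q *\<^sub>v ?e \<in> carrier_vec d" using Q e by auto
  have 0: "scalar_prod ?p (Q *\<^sub>v ?e) = 0"
    using Q e p by (subst transpose_vec_mult_scalar[symmetric, of _ d m]) (auto simp: transpose_compl_proj[OF x])
  have "scalar_prod (x - Q *\<^sub>v w) (x - Q *\<^sub>v w) = scalar_prod ?p ?p + scalar_prod (Q *\<^sub>v ?e) (Q *\<^sub>v ?e)"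
    unfolding eq using p Qe 0 comm_scalar_prod[OF p Qe]
    by (simp add: scalar_prod_add_distrib[of _ d] add_scalar_prod_distrib[of _ d])
  moreover have "scalar_prod (Q *\<^sub>v ?e) (Q *\<^sub>v ?e) \<ge> 0"
    using euclidean_norm_square[of "Q *\<^sub>v ?e"] by (metis zero_le_power2)
  ultimately show ?thesis unfolding euclidean_norm_def by (intro real_sqrt_le_mono) linarith
qed

lemma compl_proj_norm_le:
  assumes x: "x \<in> carrier_vec d"
  shows "euclidean_norm (compl_proj Q x) \<le> euclidean_norm x"
proof -
  have "Q *\<^sub>v 0\<^sub>v m = 0\<^sub>v d" using Q by auto
  then show ?thesis using compl_proj_le_dist[OF x, of "0\<^sub>v m"] x by simp
qed

end

text \<open>Jensen's inequality for x^(n + 1) with normalized weights, multiplied out so that total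
  weight 0 is included.\<close>

lemma power_mean_sum:
  fixes a w :: "'i \<Rightarrow> real"
  assumes I: "finite I" and "\<And>i. i \<in> I \<Longrightarrow> a i \<ge> 0" "\<And>i. i \<in> I \<Longrightarrow> w i \<ge> 0"
  shows "(\<Sum>i\<in>I. w i * a i) ^ Suc n \<le> (\<Sum>i\<in>I. w i) ^ n * (\<Sum>i\<in>I. w i * a i ^ Suc n)"
proof (cases "(\<Sum>i\<in>I. w i) = 0")
  case True
  then have "\<forall>i\<in>I. w i = 0" using assms by (subst (asm) sum_nonneg_eq_0_iff) auto
  then show ?thesis by simp
next
  case False
  define W where "W = (\<Sum>i\<in>I. w i)"
  have W: "W > 0" using False assms by (simp add: W_def sum_nonneg less_le)
  have "(\<Sum>i\<in>I. (w i / W) *\<^sub>R a i) ^ Suc n \<le> (\<Sum>i\<in>I. (w i / W) * a i ^ Suc n)"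
  proof (rule convex_on_sum[OF I])
    show "I \<noteq> {}" using False by auto
    show "convex_on {0::real..} (\<lambda>x. x ^ Suc n)"
    proof (cases "even (Suc n)")
      case True
      then show ?thesis using convex_power_even[of "Suc n"] convex_on_subset by blast
    qed (rule convex_power_odd)
    show "(\<Sum>i\<in>I. w i / W) = 1" using W by (simp add: sum_divide_distrib[symmetric] W_def)
  qed (use assms W in auto)
  then have "(\<Sum>i\<in>I. w i * a i) ^ Suc n / W ^ Suc n \<le> (\<Sum>i\<in>I. w i * a i ^ Suc n) / W"
    by (simp add: sum_divide_distrib[symmetric] power_divide del: power_Suc)
  then have "(\<Sum>i\<in>I. w i * a i) ^ Suc n / W ^ Suc n * W ^ Suc n \<le> (\<Sum>i\<in>I. w i * a i ^ Suc n) / W * W ^ Suc n"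
    using W by (intro mult_right_mono) auto
  then show ?thesis using W by (simp add: W_def[symmetric] mult.commute)
qed

text \<open>The power of a symmetric matrix taken in its eigenbasis. With the exponent as a
  parameter, \<open>M\<close> and \<open>M ^ (q + 1)\<close> share one representation.\<close>

definition eig_power :: "nat \<Rightarrow> real mat \<Rightarrow> (nat \<Rightarrow> real) \<Rightarrow> nat \<Rightarrow> real mat" where
  "eig_power d U \<nu> e = U * mat_diag d (\<lambda>i. \<nu> i ^ e) * U\<^sup>T"

context
  fixes U :: "real mat" and d :: nat
  assumes U: "orthogonal_mat d U"
begin

lemma eig_power_carrier[simp]: "eig_power d U \<nu> e \<in> carrier_mat d d"
  using U by (auto simp: eig_power_def orthogonal_mat_def)

lemma eig_power_transpose: "(eig_power d U \<nu> e)\<^sup>T = eig_power d U \<nu> e"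
proof -
  have Uc: "U \<in> carrier_mat d d" using U by (simp add: orthogonal_mat_def)
  have D: "transpose_mat (mat_diag d (\<lambda>i. \<nu> i ^ e)) = mat_diag d (\<lambda>i. \<nu> i ^ e)"
    by (intro eq_matI) (auto simp: mat_diag_def)
  let ?D = "mat_diag d (\<lambda>i. \<nu> i ^ e)"
  have "(U * ?D * U\<^sup>T)\<^sup>T = U * (U * ?D)\<^sup>T"
    using Uc by (subst transpose_mult[of _ d d _ d]) auto
  also have "\<dots> = U * (?D * U\<^sup>T)"
    using Uc D by (subst transpose_mult[of _ d d _ d]) auto
  also have "\<dots> = U * ?D * U\<^sup>T"
    using Uc by (intro assoc_mult_mat[symmetric, of _ d d _ d _ d]) auto
  finally show ?thesis unfolding eig_power_def .
qed

lemma eig_power_mult: "eig_power d U \<nu> a * eig_power d U \<nu> b = eig_power d U \<nu> (a + b)"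
proof -
  have Uc: "U \<in> carrier_mat d d" and UU: "U\<^sup>T * U = 1\<^sub>m d" using U by (auto simp: orthogonal_mat_def)
  let ?T = "U\<^sup>T" and ?A = "mat_diag d (\<lambda>i. \<nu> i ^ a)" and ?B = "mat_diag d (\<lambda>i. \<nu> i ^ b)"
  have T: "?T \<in> carrier_mat d d" using Uc by simp
  have "eig_power d U \<nu> a * eig_power d U \<nu> b = U * (?A * ((?T * U) * (?B * ?T)))"
    unfolding eig_power_def using Uc T by (simp add: assoc_mult_mat[of _ d d _ d _ d] mult_carrier_mat[of _ d d _ d])
  also have "\<dots> = U * (?A * (?B * ?T))" unfolding UU using T by (simp add: left_mult_one_mat[of _ d d] mult_carrier_mat[of _ d d _ d])
  also have "\<dots> = U * (?A * ?B) * ?T"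
    using Uc T by (simp add: assoc_mult_mat[of _ d d _ d _ d] mult_carrier_mat[of _ d d _ d] del: mat_diag_diag)
  finally show ?thesis by (simp add: eig_power_def power_add)
qed

lemma eig_power_coord:
  assumes x: "x \<in> carrier_vec d" and i: "i < d"
  shows "(U\<^sup>T *\<^sub>v (eig_power d U \<nu> e *\<^sub>v x)) $ i = \<nu> i ^ e * (U\<^sup>T *\<^sub>v x) $ i"
proof -
  have Uc: "U \<in> carrier_mat d d" and UU: "U\<^sup>T * U = 1\<^sub>m d" using U by (auto simp: orthogonal_mat_def)
  let ?T = "U\<^sup>T" and ?D = "mat_diag d (\<lambda>i. \<nu> i ^ e)"
  have T: "?T \<in> carrier_mat d d" using Uc by simp
  have Tx: "?T *\<^sub>v x \<in> carrier_vec d" using T x by simp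
  have diag: "(?D *\<^sub>v y) $ i = \<nu> i ^ e * y $ i" if y: "y \<in> carrier_vec d" for y
  proof -
    have "(?D *\<^sub>v y) $ i = (\<Sum>j<d. (if i = j then \<nu> j ^ e else 0) * y $ j)"
      using i y by (auto simp: mat_diag_def scalar_prod_def atLeast0LessThan intro!: sum.cong)
    then show ?thesis using i by (simp add: if_distrib[of "\<lambda>a. a * _"] cong: if_cong)
  qed
  have "?T *\<^sub>v (eig_power d U \<nu> e *\<^sub>v x) = (?T * U) *\<^sub>v (?D *\<^sub>v (?T *\<^sub>v x))"
    unfolding eig_power_def using Uc T x Tx by (simp add: assoc_mult_mat_vec[of _ d d _ d] mult_carrier_mat[of _ d d _ d] mult_mat_vec_carrier[of _ d d])
  also have "\<dots> = ?D *\<^sub>v (?T *\<^sub>v x)" unfolding UU using Tx by (simp add: mult_mat_vec_carrier[of _ d d])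
  also have "\<dots> $ i = \<nu> i ^ e * (?T *\<^sub>v x) $ i" by (rule diag[OF Tx])
  finally show ?thesis .
qed

lemma euclidean_norm_transpose_orthogonal:
  assumes x: "x \<in> carrier_vec d"
  shows "euclidean_norm (U\<^sup>T *\<^sub>v x) = euclidean_norm x"
  using U x by (intro euclidean_norm_orthonormal_columns[of _ d d]) (auto simp: orthogonal_mat_def)

lemma euclidean_norm_eig_power:
  assumes x: "x \<in> carrier_vec d"
  shows "(euclidean_norm (eig_power d U \<nu> e *\<^sub>v x))\<^sup>2 = (\<Sum>i<d. ((U\<^sup>T *\<^sub>v x) $ i)\<^sup>2 * ((\<nu> i)\<^sup>2) ^ e)"
proof -
  have y: "eig_power d U \<nu> e *\<^sub>v x \<in> carrier_vec d" using x by (simp add: mult_mat_vec_carrier[of _ d d])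
  have "U\<^sup>T *\<^sub>v (eig_power d U \<nu> e *\<^sub>v x) \<in> carrier_vec d"
    using U y by (auto simp: orthogonal_mat_def)
  then have "(euclidean_norm (eig_power d U \<nu> e *\<^sub>v x))\<^sup>2 = (\<Sum>i<d. ((U\<^sup>T *\<^sub>v (eig_power d U \<nu> e *\<^sub>v x)) $ i)\<^sup>2)"
    unfolding euclidean_norm_transpose_orthogonal[OF y, symmetric]
    by (subst euclidean_norm_L2_set) (auto simp: L2_set_def sum_nonneg)
  also have "\<dots> = (\<Sum>i<d. ((U\<^sup>T *\<^sub>v x) $ i)\<^sup>2 * ((\<nu> i)\<^sup>2) ^ e)"
    using x by (intro sum.cong) (auto simp: eig_power_coord power_mult_distrib power_mult[symmetric] mult.commute)
  finally show ?thesis .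
qed

text \<open>\<open>\<bar>P M x\<bar> ^ (q + 1) \<le> \<bar>P M ^ (q + 1)\<bar>\<close> for an orthogonal projection \<open>P\<close>: with \<open>v = P M x\<close> one has
  \<open>\<bar>v\<bar>\<^sup>2 \<le> \<bar>M v\<bar>\<close>, and the power mean inequality in the eigenbasis bounds \<open>\<bar>M v\<bar>\<close> by \<open>\<bar>M ^ (q + 1) v\<bar>\<close>.\<close>

lemma compl_proj_power_le:
  assumes Q: "Q \<in> carrier_mat d m" "Q\<^sup>T * Q = 1\<^sub>m m"
    and D: "\<And>x. x \<in> carrier_vec d \<Longrightarrow> euclidean_norm (compl_proj Q (eig_power d U \<nu> (Suc q) *\<^sub>v x)) \<le> D * euclidean_norm x"
    and x: "x \<in> carrier_vec d" "euclidean_norm x \<le> 1" and D0: "D \<ge> 0"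
  shows "euclidean_norm (compl_proj Q (eig_power d U \<nu> 1 *\<^sub>v x)) ^ Suc q \<le> D"
proof -
  let ?M = "eig_power d U \<nu> 1" and ?B = "eig_power d U \<nu> (Suc q)"
  define v where "v = compl_proj Q (?M *\<^sub>v x)"
  define t where "t = euclidean_norm v"
  have Mx: "?M *\<^sub>v x \<in> carrier_vec d" using x by (simp add: mult_mat_vec_carrier[of _ d d])
  have v: "v \<in> carrier_vec d" unfolding v_def by (rule compl_proj_carrier[OF Q Mx])
  have Mv: "?M *\<^sub>v v \<in> carrier_vec d" and Bv: "?B *\<^sub>v v \<in> carrier_vec d"
    using v by (simp_all add: mult_mat_vec_carrier[of _ d d])
  have t0: "t \<ge> 0" by (simp add: t_def euclidean_norm_nonneg)
  have sp: "scalar_prod v y = scalar_prod v (compl_proj Q y)" if "y \<in> carrier_vec d" for y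
    unfolding v_def by (rule scalar_prod_compl_proj[OF Q Mx that])
  have "t\<^sup>2 = scalar_prod v (?M *\<^sub>v x)"
    unfolding t_def euclidean_norm_square using sp[OF Mx] by (simp add: v_def)
  also have "\<dots> = scalar_prod (?M *\<^sub>v v) x"
    using transpose_vec_mult_scalar[symmetric, of ?M d d x v] v x by (simp add: eig_power_transpose)
  also have "\<dots> \<le> euclidean_norm (?M *\<^sub>v v) * euclidean_norm x"
    by (rule scalar_prod_le_euclidean_norm[OF Mv x(1)])
  also have "\<dots> \<le> euclidean_norm (?M *\<^sub>v v) * 1"
    using x by (intro mult_left_mono euclidean_norm_nonneg)
  finally have tM: "t\<^sup>2 \<le> euclidean_norm (?M *\<^sub>v v)" by simp
  \<comment> \<open>|B v|^2 = <v, B (B v)>, and \<open>v\<close> lies in the range of the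
    projection, which can therefore be inserted before \<open>B (B v)\<close>; the hypothesis on
    \<open>D\<close> at the vector \<open>B v\<close> yields |B v| \<le> t * D.\<close>
  have "(euclidean_norm (?B *\<^sub>v v))\<^sup>2 = scalar_prod v (?B *\<^sub>v (?B *\<^sub>v v))"
    using transpose_vec_mult_scalar[symmetric, of ?B d d "?B *\<^sub>v v" v] v Bv
    by (simp add: eig_power_transpose euclidean_norm_square)
  also have "\<dots> = scalar_prod v (compl_proj Q (?B *\<^sub>v (?B *\<^sub>v v)))"
    using Bv by (intro sp) (simp add: mult_mat_vec_carrier[of _ d d])
  also have "\<dots> \<le> t * euclidean_norm (compl_proj Q (?B *\<^sub>v (?B *\<^sub>v v)))"
    unfolding t_def using Bv by (intro scalar_prod_le_euclidean_norm[OF v] compl_proj_carrier[OF Q]) (simp add: mult_mat_vec_carrier[of _ d d])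
  also have "\<dots> \<le> t * (D * euclidean_norm (?B *\<^sub>v v))"
    using t0 by (intro mult_left_mono D Bv)
  finally have "euclidean_norm (?B *\<^sub>v v) * euclidean_norm (?B *\<^sub>v v) \<le> (t * D) * euclidean_norm (?B *\<^sub>v v)"
    by (simp add: power2_eq_square mult.assoc)
  then have Bt: "euclidean_norm (?B *\<^sub>v v) \<le> t * D"
    using euclidean_norm_nonneg[of "?B *\<^sub>v v"] t0 D0
    by (cases "euclidean_norm (?B *\<^sub>v v) = 0") auto
  \<comment> \<open>The squared eigencoordinates of \<open>v\<close> are the weights, of total t^2,
    for the power mean inequality applied to the squared eigenvalues. With t^2 \<le> |M v| and |B v|
    \<le> t * D it gives t^(4 (q + 1)) \<le> t^(2 q) * (t * D)^2.\<close>
  let ?y = "\<lambda>i. ((U\<^sup>T *\<^sub>v v) $ i)\<^sup>2"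
  have ny: "t\<^sup>2 = (\<Sum>i<d. ?y i)"
  proof -
    have "U\<^sup>T *\<^sub>v v \<in> carrier_vec d" using U v by (auto simp: orthogonal_mat_def)
    then show ?thesis unfolding t_def euclidean_norm_transpose_orthogonal[OF v, symmetric]
      by (subst euclidean_norm_L2_set) (auto simp: L2_set_def sum_nonneg)
  qed
  have "((t\<^sup>2)\<^sup>2) ^ Suc q \<le> ((euclidean_norm (?M *\<^sub>v v))\<^sup>2) ^ Suc q"
    using tM by (intro power_mono) auto
  also have "\<dots> = (\<Sum>i<d. ?y i * (\<nu> i)\<^sup>2) ^ Suc q"
    unfolding euclidean_norm_eig_power[OF v] by simp
  also have "\<dots> \<le> (\<Sum>i<d. ?y i) ^ q * (\<Sum>i<d. ?y i * ((\<nu> i)\<^sup>2) ^ Suc q)"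
    by (rule power_mean_sum) auto
  also have "\<dots> = (t\<^sup>2) ^ q * (euclidean_norm (?B *\<^sub>v v))\<^sup>2"
    unfolding ny euclidean_norm_eig_power[OF v] by simp
  also have "\<dots> \<le> (t\<^sup>2) ^ q * (t * D)\<^sup>2"
    using Bt euclidean_norm_nonneg by (intro mult_left_mono power_mono) auto
  finally have "(t ^ Suc q * t ^ Suc q)\<^sup>2 \<le> (t ^ Suc q * D)\<^sup>2"
    by (simp add: power2_eq_square power_mult_distrib mult_ac)
  then have "t ^ Suc q * t ^ Suc q \<le> t ^ Suc q * D"
    by (rule power2_le_imp_le) (use t0 D0 in \<open>auto intro: mult_nonneg_nonneg\<close>)
  then have "t ^ Suc q \<le> D" using t0 D0 by (cases "t = 0") (auto simp: zero_less_mult_iff)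
  then show ?thesis by (simp add: t_def v_def)
qed

text \<open>\<open>Q\<close> spans at least the range of \<open>B \<Omega>\<close>, so the distance to any vector of this range bounds the error.
  The vector \<open>B \<Omega> w\<close> is chosen to agree with \<open>B x\<close> in the first \<open>k\<close> eigendirections.\<close>

lemma compl_proj_deterministic_bound:
  fixes \<mu> :: "nat \<Rightarrow> real"
  defines "B \<equiv> U * mat_diag d \<mu> * U\<^sup>T"
  assumes Q: "Q \<in> carrier_mat d m" "Q\<^sup>T * Q = 1\<^sub>m m"
    and Om: "Om \<in> carrier_mat d m" and R: "R \<in> carrier_mat m m" and BOm: "B * Om = Q * R"
    and \<mu>: "\<And>i. k \<le> i \<Longrightarrow> i < d \<Longrightarrow> 0 \<le> \<mu> i \<and> \<mu> i \<le> s" and s: "s \<ge> 0" and kd: "k \<le> d"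
    and x: "x \<in> carrier_vec d"
    and w: "w \<in> carrier_vec m"
    and w1: "\<And>i. i < k \<Longrightarrow> (U\<^sup>T *\<^sub>v (Om *\<^sub>v w)) $ i = (U\<^sup>T *\<^sub>v x) $ i"
    and w2: "L2_set (\<lambda>i. \<mu> i * (U\<^sup>T *\<^sub>v (Om *\<^sub>v w)) $ i) {k..<d} \<le> \<tau> * euclidean_norm x"
  shows "euclidean_norm (compl_proj Q (B *\<^sub>v x)) \<le> (s + \<tau>) * euclidean_norm x"
proof -
  have Be: "B = eig_power d U \<mu> 1" by (simp add: B_def eig_power_def)
  have Bc: "B \<in> carrier_mat d d" unfolding Be by simp
  have Uc: "U \<in> carrier_mat d d" using U by (simp add: orthogonal_mat_def)
  let ?T = "U\<^sup>T"
  have Ow: "Om *\<^sub>v w \<in> carrier_vec d" and Rw: "R *\<^sub>v w \<in> carrier_vec m" using Om R w by auto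
  have e: "x - Om *\<^sub>v w \<in> carrier_vec d" using x Ow by simp
  have "Q *\<^sub>v (R *\<^sub>v w) = B *\<^sub>v (Om *\<^sub>v w)"
    using Q(1) R Bc Om w BOm by (metis assoc_mult_mat_vec)
  then have "B *\<^sub>v x - Q *\<^sub>v (R *\<^sub>v w) = B *\<^sub>v (x - Om *\<^sub>v w)"
    using Bc x Ow by (simp add: mult_minus_distrib_mat_vec[of _ d d])
  then have "euclidean_norm (compl_proj Q (B *\<^sub>v x)) \<le> euclidean_norm (B *\<^sub>v (x - Om *\<^sub>v w))"
    using compl_proj_le_dist[OF Q _ Rw, of "B *\<^sub>v x"] Bc x by simp
  also have "\<dots> = L2_set (\<lambda>i. (?T *\<^sub>v (B *\<^sub>v (x - Om *\<^sub>v w))) $ i) {..<d}"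
  proof -
    have "B *\<^sub>v (x - Om *\<^sub>v w) \<in> carrier_vec d" using Bc e by simp
    moreover from this have "?T *\<^sub>v (B *\<^sub>v (x - Om *\<^sub>v w)) \<in> carrier_vec d" using Uc by simp
    ultimately show ?thesis
      using euclidean_norm_transpose_orthogonal euclidean_norm_L2_set by metis
  qed
  also have "\<dots> = L2_set (\<lambda>i. \<mu> i * ((?T *\<^sub>v x) $ i - (?T *\<^sub>v (Om *\<^sub>v w)) $ i)) {..<d}"
  proof (rule L2_set_cong[OF refl])
    fix i assume "i \<in> {..<d}"
    then show "(?T *\<^sub>v (B *\<^sub>v (x - Om *\<^sub>v w))) $ i = \<mu> i * ((?T *\<^sub>v x) $ i - (?T *\<^sub>v (Om *\<^sub>v w)) $ i)"
      unfolding Be using eig_power_coord[OF e, of i \<mu> 1] Uc x Ow by (simp add: mult_minus_distrib_mat_vec[of _ d d])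
  qed
  \<comment> \<open>By \<open>w1\<close> the first \<open>k\<close> eigencoordinates of
    \<open>x - Om w\<close> vanish. The remaining ones are split so that one part is controlled by
    \<open>s\<close> and the other by \<open>\<tau>\<close>.\<close>
  also have "\<dots> = L2_set (\<lambda>i. \<mu> i * (?T *\<^sub>v x) $ i + - (\<mu> i * (?T *\<^sub>v (Om *\<^sub>v w)) $ i)) {k..<d}"
    unfolding L2_set_def using w1 kd
    by (intro arg_cong[of _ _ sqrt] sum.mono_neutral_cong_right) (auto simp: right_diff_distrib not_le)
  also have "\<dots> \<le> L2_set (\<lambda>i. \<mu> i * (?T *\<^sub>v x) $ i) {k..<d} + L2_set (\<lambda>i. - (\<mu> i * (?T *\<^sub>v (Om *\<^sub>v w)) $ i)) {k..<d}"
    by (rule L2_set_triangle_ineq)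
  also have "L2_set (\<lambda>i. - (\<mu> i * (?T *\<^sub>v (Om *\<^sub>v w)) $ i)) {k..<d} \<le> \<tau> * euclidean_norm x"
    using w2 by (simp add: L2_set_def)
  also have "L2_set (\<lambda>i. \<mu> i * (?T *\<^sub>v x) $ i) {k..<d} \<le> s * euclidean_norm x"
  proof -
    have Tx: "?T *\<^sub>v x \<in> carrier_vec d" using Uc x by simp
    have "L2_set (\<lambda>i. \<mu> i * (?T *\<^sub>v x) $ i) {k..<d} \<le> sqrt (\<Sum>i\<in>{..<d}. s\<^sup>2 * ((?T *\<^sub>v x) $ i)\<^sup>2)"
      unfolding L2_set_def
    proof (rule real_sqrt_le_mono, rule order_trans)
      show "(\<Sum>i = k..<d. (\<mu> i * (?T *\<^sub>v x) $ i)\<^sup>2) \<le> (\<Sum>i = k..<d. s\<^sup>2 * ((?T *\<^sub>v x) $ i)\<^sup>2)"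
        using \<mu> unfolding power_mult_distrib by (intro sum_mono mult_right_mono power_mono) auto
      show "(\<Sum>i = k..<d. s\<^sup>2 * ((?T *\<^sub>v x) $ i)\<^sup>2) \<le> (\<Sum>i\<in>{..<d}. s\<^sup>2 * ((?T *\<^sub>v x) $ i)\<^sup>2)"
        by (intro sum_mono2) auto
    qed
    also have "\<dots> = s * euclidean_norm (?T *\<^sub>v x)"
      using s by (simp add: euclidean_norm_L2_set[OF Tx] L2_set_def sum_distrib_left[symmetric] real_sqrt_mult)
    finally show ?thesis by (simp add: euclidean_norm_transpose_orthogonal[OF x])
  qed
  finally show ?thesis by (simp add: distrib_right)
qed

end

text \<open>\<open>R\<close> collects the triangular factors dropped by the iteration. The equation
  also holds for rank deficient factorizations, where \<open>R\<close> is singular; it gives the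
  range of \<open>Y\<close> as a superspace only.\<close>

lemma subspace_iterate_range:
  assumes U: "orthogonal_mat d U" and Om: "Om \<in> carrier_mat d m"
    and it: "subspace_iterate (eig_power d U \<nu> 1) Om i Y"
  shows "Y \<in> carrier_mat d m \<and> (\<exists>R\<in>carrier_mat m m. eig_power d U \<nu> (Suc i) * Om = Y * R)"
  using it
proof induction
  case init
  have "eig_power d U \<nu> 1 * Om \<in> carrier_mat d m"
    using eig_power_carrier[OF U] Om by (rule mult_carrier_mat)
  then show ?case by (auto intro!: bexI[of _ "1\<^sub>m m"])
next
  case (step i Y Q R')
  then obtain R where R: "R \<in> carrier_mat m m" and eq: "eig_power d U \<nu> (Suc i) * Om = Y * R"
    and Y: "Y \<in> carrier_mat d m" by auto
  from step.hyps(2) Y have Q: "Q \<in> carrier_mat d m" and R': "R' \<in> carrier_mat m m" and YQ: "Y = Q * R'"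
    by (auto simp: thin_QR_def)
  have M: "eig_power d U \<nu> 1 \<in> carrier_mat d d" by (rule eig_power_carrier[OF U])
  have "eig_power d U \<nu> (Suc (Suc i)) * Om = eig_power d U \<nu> 1 * eig_power d U \<nu> (Suc i) * Om"
    by (simp add: eig_power_mult[OF U])
  also have "\<dots> = eig_power d U \<nu> 1 * (Q * R' * R)"
    using M eig_power_carrier[OF U] Om by (simp add: assoc_mult_mat[of _ d d _ d _ m] eq YQ)
  also have "Q * R' * R = Q * (R' * R)" by (rule assoc_mult_mat[OF Q R' R])
  also have "eig_power d U \<nu> 1 * (Q * (R' * R)) = eig_power d U \<nu> 1 * Q * (R' * R)"
    by (rule assoc_mult_mat[symmetric, OF M Q]) (rule mult_carrier_mat[OF R' R])
  finally show ?case using mult_carrier_mat[OF M Q] mult_carrier_mat[OF R' R] by blast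
qed

lemma subspace_iteration_output_range:
  assumes U: "orthogonal_mat d U" and Om: "Om \<in> carrier_mat d m"
    and out: "subspace_iteration_output (eig_power d U \<nu> 1) Om q Q"
  obtains R where "Q \<in> carrier_mat d m" "Q\<^sup>T * Q = 1\<^sub>m m" "R \<in> carrier_mat m m"
    "eig_power d U \<nu> (Suc q) * Om = Q * R"
proof -
  from out obtain Y R' where it: "subspace_iterate (eig_power d U \<nu> 1) Om q Y" and qr: "thin_QR Y Q R'"
    by (auto simp: subspace_iteration_output_def)
  from subspace_iterate_range[OF U Om it] obtain R where R: "R \<in> carrier_mat m m"
    and eq: "eig_power d U \<nu> (Suc q) * Om = Y * R" and Y: "Y \<in> carrier_mat d m" by auto
  from qr Y have Q: "Q \<in> carrier_mat d m" "Q\<^sup>T * Q = 1\<^sub>m m" and R': "R' \<in> carrier_mat m m" and YQ: "Y = Q * R'"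
    by (auto simp: thin_QR_def)
  have "eig_power d U \<nu> (Suc q) * Om = Q * (R' * R)"
    unfolding eq YQ using Q R R' by (intro assoc_mult_mat[of _ d m _ m _ m])
  with that[of "R' * R"] Q R R' show ?thesis by auto
qed

section \<open>Spectral norm: bounds, continuity and measurability\<close>

lemma mult_mat_vec_index:
  assumes "A \<in> carrier_mat n m" "w \<in> carrier_vec m" "i < n"
  shows "(A *\<^sub>v w) $ i = (\<Sum>c<m. A $$ (i, c) * w $ c)"
  using assms by (auto simp: scalar_prod_def atLeast0LessThan intro!: sum.cong)

text \<open>A crude entrywise bound with two uses: it makes the supremum in
  \<open>spectral_norm\<close> finite and the spectral norm Lipschitz in the entries.\<close>

lemma euclidean_norm_mult_le_sum:
  assumes B: "B \<in> carrier_mat n m" and v: "v \<in> carrier_vec m" "euclidean_norm v \<le> 1"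
  shows "euclidean_norm (B *\<^sub>v v) \<le> (\<Sum>i<n. \<Sum>j<m. \<bar>B $$ (i, j)\<bar>)"
proof -
  have "euclidean_norm (B *\<^sub>v v) \<le> (\<Sum>i<n. \<bar>(B *\<^sub>v v) $ i\<bar>)"
    unfolding euclidean_norm_L2_set[OF mult_mat_vec_carrier[OF B v(1)]] by (rule L2_set_le_sum_abs)
  also have "\<dots> \<le> (\<Sum>i<n. \<Sum>j<m. \<bar>B $$ (i, j)\<bar>)"
  proof (rule sum_mono)
    fix i assume i: "i \<in> {..<n}"
    have "\<bar>(B *\<^sub>v v) $ i\<bar> = \<bar>\<Sum>j<m. B $$ (i, j) * v $ j\<bar>"
      using i B v by (simp add: scalar_prod_def atLeast0LessThan)
    also have "\<dots> \<le> (\<Sum>j<m. \<bar>B $$ (i, j) * v $ j\<bar>)" by (rule sum_abs)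
    also have "\<dots> \<le> (\<Sum>j<m. \<bar>B $$ (i, j)\<bar> * 1)"
    proof (rule sum_mono)
      fix j assume j: "j \<in> {..<m}"
      have "\<bar>v $ j\<bar> \<le> L2_set (\<lambda>i. \<bar>v $ i\<bar>) {..<m}" using j by (intro member_le_L2_set) auto
      also have "\<dots> \<le> 1" using v by (simp add: euclidean_norm_L2_set L2_set_def)
      finally show "\<bar>B $$ (i, j) * v $ j\<bar> \<le> \<bar>B $$ (i, j)\<bar> * 1"
        unfolding abs_mult by (intro mult_left_mono) auto
    qed
    finally show "\<bar>(B *\<^sub>v v) $ i\<bar> \<le> (\<Sum>j<m. \<bar>B $$ (i, j)\<bar>)" by simp
  qed
  finally show ?thesis .
qed

lemma euclidean_norm_zero[simp]: "euclidean_norm (0\<^sub>v n) = 0"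
  by (simp add: euclidean_norm_def)

lemma euclidean_norm_le_spectral_norm:
  assumes B: "B \<in> carrier_mat n m" and v: "v \<in> carrier_vec m" "euclidean_norm v \<le> 1"
  shows "euclidean_norm (B *\<^sub>v v) \<le> spectral_norm B"
  unfolding spectral_norm_def
proof (rule cSUP_upper)
  show "v \<in> {v \<in> carrier_vec (dim_col B). euclidean_norm v \<le> 1}" using B v by auto
  show "bdd_above ((\<lambda>v. euclidean_norm (B *\<^sub>v v)) ` {v \<in> carrier_vec (dim_col B). euclidean_norm v \<le> 1})"
    using B by (intro bdd_aboveI2[of _ _ "\<Sum>i<n. \<Sum>j<m. \<bar>B $$ (i, j)\<bar>"] euclidean_norm_mult_le_sum) auto
qed

lemma spectral_norm_le:
  assumes "\<And>v. v \<in> carrier_vec (dim_col B) \<Longrightarrow> euclidean_norm v \<le> 1 \<Longrightarrow> euclidean_norm (B *\<^sub>v v) \<le> c"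
  shows "spectral_norm B \<le> c"
  unfolding spectral_norm_def
proof (rule cSUP_least)
  show "{v \<in> carrier_vec (dim_col B). euclidean_norm v \<le> 1} \<noteq> {}"
    by (auto intro!: exI[of _ "0\<^sub>v (dim_col B)"])
qed (use assms in auto)

lemma spectral_norm_nonneg: "spectral_norm B \<ge> 0"
  using euclidean_norm_le_spectral_norm[of B "dim_row B" "dim_col B" "0\<^sub>v (dim_col B)"]
    euclidean_norm_nonneg[of "B *\<^sub>v 0\<^sub>v (dim_col B)"] by auto

lemma spectral_norm_perturbation:
  assumes B: "B \<in> carrier_mat n m" and C: "C \<in> carrier_mat n m"
  shows "spectral_norm B \<le> spectral_norm C + (\<Sum>i<n. \<Sum>j<m. \<bar>B $$ (i, j) - C $$ (i, j)\<bar>)"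
proof (rule spectral_norm_le)
  fix v assume "v \<in> carrier_vec (dim_col B)" and v1: "euclidean_norm v \<le> 1"
  then have v: "v \<in> carrier_vec m" using B by auto
  have "B *\<^sub>v v = C *\<^sub>v v + (B - C) *\<^sub>v v"
    using B C v by (subst minus_mult_distrib_mat_vec[of _ n m]) auto
  then have "(B *\<^sub>v v) $ i = (C *\<^sub>v v) $ i + ((B - C) *\<^sub>v v) $ i" if "i < n" for i
    using B C v that by (metis index_add_vec(1) dim_mult_mat_vec carrier_matD(1) minus_carrier_mat)
  then have "euclidean_norm (B *\<^sub>v v) = L2_set (\<lambda>i. (C *\<^sub>v v) $ i + ((B - C) *\<^sub>v v) $ i) {..<n}"
    unfolding euclidean_norm_L2_set[OF mult_mat_vec_carrier[OF B v]] by (intro L2_set_cong) auto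
  also have "\<dots> \<le> L2_set (($) (C *\<^sub>v v)) {..<n} + L2_set (($) ((B - C) *\<^sub>v v)) {..<n}"
    by (rule L2_set_triangle_ineq)
  also have "\<dots> = euclidean_norm (C *\<^sub>v v) + euclidean_norm ((B - C) *\<^sub>v v)"
    using euclidean_norm_L2_set[OF mult_mat_vec_carrier[OF C v]]
      euclidean_norm_L2_set[OF mult_mat_vec_carrier[OF minus_carrier_mat[OF C] v], of B] by simp
  also have "\<dots> \<le> spectral_norm C + (\<Sum>i<n. \<Sum>j<m. \<bar>(B - C) $$ (i, j)\<bar>)"
    using B C v v1 by (intro add_mono euclidean_norm_le_spectral_norm euclidean_norm_mult_le_sum) auto
  also have "(\<Sum>i<n. \<Sum>j<m. \<bar>(B - C) $$ (i, j)\<bar>) = (\<Sum>i<n. \<Sum>j<m. \<bar>B $$ (i, j) - C $$ (i, j)\<bar>)"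
    using B C by (intro sum.cong refl) auto
  finally show "euclidean_norm (B *\<^sub>v v) \<le> spectral_norm C + (\<Sum>i<n. \<Sum>j<m. \<bar>B $$ (i, j) - C $$ (i, j)\<bar>)" .
qed

text \<open>The supremum runs over an uncountable set, so measurability is obtained from continuity:
  the norm is a continuous function of finitely many coordinates in the product topology.\<close>

lemma borel_measurable_spectral_norm:
  fixes f :: "'a \<Rightarrow> nat \<Rightarrow> nat \<Rightarrow> real"
  assumes f: "\<And>i j. i < n \<Longrightarrow> j < m \<Longrightarrow> (\<lambda>\<omega>. f \<omega> i j) \<in> borel_measurable M"
  shows "(\<lambda>\<omega>. spectral_norm (Matrix.mat n m (\<lambda>(i, j). f \<omega> i j))) \<in> borel_measurable M"
proof -
  define g :: "(nat \<times> nat \<Rightarrow> real) \<Rightarrow> real" where "g x = spectral_norm (Matrix.mat n m x)" for x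
  have le: "g x \<le> g y + (\<Sum>i<n. \<Sum>j<m. \<bar>x (i, j) - y (i, j)\<bar>)" for x y
    using spectral_norm_perturbation[of "Matrix.mat n m x" n m "Matrix.mat n m y"] by (simp add: g_def)
  have "continuous_on UNIV g"
    unfolding continuous_on_def
  proof
    fix x :: "nat \<times> nat \<Rightarrow> real"
    have *: "((\<lambda>y. y (i, j)) \<longlongrightarrow> x (i, j)) (at x within UNIV)" for i j
      using continuous_on_product_coordinates[of "(i, j)"] by (auto simp: continuous_on_def)
    have "((\<lambda>y. \<Sum>i<n. \<Sum>j<m. \<bar>y (i, j) - x (i, j)\<bar>) \<longlongrightarrow> (\<Sum>i<n. \<Sum>j<m. \<bar>x (i, j) - x (i, j)\<bar>)) (at x within UNIV)"
      by (intro tendsto_sum tendsto_rabs tendsto_diff * tendsto_const)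
    then have lim: "((\<lambda>y. \<Sum>i<n. \<Sum>j<m. \<bar>y (i, j) - x (i, j)\<bar>) \<longlongrightarrow> 0) (at x within UNIV)" by simp
    have "\<bar>g y - g x\<bar> \<le> (\<Sum>i<n. \<Sum>j<m. \<bar>y (i, j) - x (i, j)\<bar>)" for y
      using le[of x y] le[of y x] by (simp add: abs_minus_commute)
    then have "((\<lambda>y. g y - g x) \<longlongrightarrow> 0) (at x within UNIV)"
      by (intro Lim_null_comparison[OF _ lim]) auto
    then show "(g \<longlongrightarrow> g x) (at x within UNIV)" by (simp add: LIM_zero_iff)
  qed
  then have g: "g \<in> borel_measurable borel" by (rule borel_measurable_continuous_onI)
  \<comment> \<open>The function space has coordinates for all index pairs; those outside the matrix
    are filled with 0.\<close>
  have h: "(\<lambda>\<omega> p. if fst p < n \<and> snd p < m then f \<omega> (fst p) (snd p) else 0) \<in> borel_measurable M"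
  proof (rule measurable_coordinatewise_then_product)
    fix p :: "nat \<times> nat"
    show "(\<lambda>\<omega>. if fst p < n \<and> snd p < m then f \<omega> (fst p) (snd p) else 0) \<in> borel_measurable M"
      using f by (cases "fst p < n \<and> snd p < m") auto
  qed
  have "spectral_norm (Matrix.mat n m (\<lambda>(i, j). f \<omega> i j)) =
      g (\<lambda>p. if fst p < n \<and> snd p < m then f \<omega> (fst p) (snd p) else 0)" for \<omega>
    unfolding g_def by (intro arg_cong[of _ _ spectral_norm] cong_mat) auto
  then show ?thesis using measurable_compose[OF h g] by simp
qed

section \<open>Bounds for the approximation error\<close>

lemma approximation_error_residual:
  assumes M: "M \<in> carrier_mat d d" and Q: "Q \<in> carrier_mat d m" and v: "v \<in> carrier_vec d"
  shows "(M - Q * Q\<^sup>T * M) *\<^sub>v v = compl_proj Q (M *\<^sub>v v)"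
proof -
  have T: "Q\<^sup>T \<in> carrier_mat m d" using Q by simp
  have "(M - Q * Q\<^sup>T * M) *\<^sub>v v = M *\<^sub>v v - (Q * Q\<^sup>T * M) *\<^sub>v v"
    using M Q T v by (intro minus_mult_distrib_mat_vec[of _ d d] mult_carrier_mat[of _ d d] mult_carrier_mat[of _ d m]) auto
  also have "(Q * Q\<^sup>T * M) *\<^sub>v v = (Q * Q\<^sup>T) *\<^sub>v (M *\<^sub>v v)"
    using M Q T v by (intro assoc_mult_mat_vec[of _ d d _ d] mult_carrier_mat[of _ d m]) auto
  also have "\<dots> = Q *\<^sub>v (Q\<^sup>T *\<^sub>v (M *\<^sub>v v))"
    using M Q T v by (intro assoc_mult_mat_vec[of _ d m _ d]) auto
  finally show ?thesis .
qed

lemma approximation_error_nonneg: "approximation_error M Q \<ge> 0"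
  unfolding approximation_error_def by (rule spectral_norm_nonneg)

lemma approximation_error_le_spectral_norm:
  assumes M: "M \<in> carrier_mat d d" and Q: "Q \<in> carrier_mat d m" "Q\<^sup>T * Q = 1\<^sub>m m"
  shows "approximation_error M Q \<le> spectral_norm M"
  unfolding approximation_error_def
proof (rule spectral_norm_le)
  fix v assume "v \<in> carrier_vec (dim_col (M - Q * Q\<^sup>T * M))" and v1: "euclidean_norm v \<le> 1"
  then have v: "v \<in> carrier_vec d" using M by simp
  have "euclidean_norm (compl_proj Q (M *\<^sub>v v)) \<le> euclidean_norm (M *\<^sub>v v)"
    using M v by (intro compl_proj_norm_le[OF Q]) auto
  also have "\<dots> \<le> spectral_norm M" by (rule euclidean_norm_le_spectral_norm[OF M v v1])
  finally show "euclidean_norm ((M - Q * Q\<^sup>T * M) *\<^sub>v v) \<le> spectral_norm M"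
    by (simp add: approximation_error_residual[OF M Q(1) v])
qed

text \<open>The bound for single vectors concerns a power; taking the root first lets it pass to the
  supremum over the unit ball.\<close>

lemma approximation_error_power_le:
  assumes U: "orthogonal_mat d U" and Q: "Q \<in> carrier_mat d m" "Q\<^sup>T * Q = 1\<^sub>m m"
    and D: "\<And>x. x \<in> carrier_vec d \<Longrightarrow> euclidean_norm (compl_proj Q (eig_power d U \<nu> (Suc q) *\<^sub>v x)) \<le> D * euclidean_norm x"
    and D0: "D \<ge> 0"
  shows "approximation_error (eig_power d U \<nu> 1) Q ^ Suc q \<le> D"
proof -
  let ?M = "eig_power d U \<nu> 1"
  have M: "?M \<in> carrier_mat d d" by (rule eig_power_carrier[OF U])
  have "approximation_error ?M Q \<le> root (Suc q) D"
    unfolding approximation_error_def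
  proof (rule spectral_norm_le)
    fix v assume "v \<in> carrier_vec (dim_col (?M - Q * Q\<^sup>T * ?M))" and v1: "euclidean_norm v \<le> 1"
    then have v: "v \<in> carrier_vec d" using M by simp
    have "euclidean_norm (compl_proj Q (?M *\<^sub>v v)) = root (Suc q) (euclidean_norm (compl_proj Q (?M *\<^sub>v v)) ^ Suc q)"
      using euclidean_norm_nonneg by (simp only: real_root_power_cancel[OF zero_less_Suc])
    also have "\<dots> \<le> root (Suc q) D"
      by (intro real_root_le_mono compl_proj_power_le[OF U Q D v v1 D0]) auto
    finally show "euclidean_norm ((?M - Q * Q\<^sup>T * ?M) *\<^sub>v v) \<le> root (Suc q) D"
      unfolding approximation_error_residual[OF M Q(1) v] .
  qed
  then have "approximation_error ?M Q ^ Suc q \<le> root (Suc q) D ^ Suc q"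
    by (intro power_mono approximation_error_nonneg)
  also have "\<dots> = D" using D0 by (intro real_root_pow_pos2) auto
  finally show ?thesis .
qed

text \<open>An infinite test moment leaves nothing to prove. Otherwise \<open>\<tau>\<close> is
  defined by \<tau>^r * abs_moment r = T, and comparison with a Gaussian test vector shows that
  \<open>\<tau>\<close> bounds the operator norm of
  \<open>\<Sigma>\<^sub>2 G\<^sub>2 G\<^sub>1\<^sup>\<dagger>\<close>; the deterministic bound
  applies with this \<open>\<tau>\<close>.\<close>

lemma approximation_error_test_moment:
  fixes \<nu> :: "nat \<Rightarrow> real"
  assumes U: "orthogonal_mat d U" and Q: "Q \<in> carrier_mat d m" "Q\<^sup>T * Q = 1\<^sub>m m"
    and Om: "Om \<in> carrier_mat d m" and R: "R \<in> carrier_mat m m" and BOm: "eig_power d U \<nu> (Suc q) * Om = Q * R"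
    and \<nu>: "\<And>i. k \<le> i \<Longrightarrow> i < d \<Longrightarrow> 0 \<le> \<nu> i \<and> \<nu> i ^ Suc q \<le> s" and s: "s \<ge> 0" and kd: "k \<le> d"
    and G: "\<And>i c. i < d \<Longrightarrow> c < m \<Longrightarrow> G (i, c) = (U\<^sup>T * Om) $$ (i, c)"
    and det: "det (gram k m G) \<noteq> 0" and r: "r \<ge> 1"
  shows "ennreal (max 0 (approximation_error (eig_power d U \<nu> 1) Q ^ Suc q - s) ^ r * abs_moment r)
    \<le> test_moment d k m r (\<lambda>i. \<nu> i ^ Suc q) G"
proof (cases "test_moment d k m r (\<lambda>i. \<nu> i ^ Suc q) G")
  case (real T)
  define \<mu> where "\<mu> = (\<lambda>i. \<nu> i ^ Suc q)"
  define \<tau> where "\<tau> = root r (T / abs_moment r)"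
  have am: "abs_moment r > 0" by (rule abs_moment_pos)
  have T: "T \<ge> 0" using real by simp
  have \<tau>: "\<tau> \<ge> 0" "\<tau> ^ r = T / abs_moment r" using T am r by (auto simp: \<tau>_def)
  have Uc: "U \<in> carrier_mat d d" using U by (simp add: orthogonal_mat_def)
  have TU: "U\<^sup>T \<in> carrier_mat d d" using Uc by simp
  have Beq: "eig_power d U \<nu> (Suc q) = U * mat_diag d \<mu> * U\<^sup>T" by (simp add: eig_power_def \<mu>_def)
  have "euclidean_norm (compl_proj Q (U * mat_diag d \<mu> * U\<^sup>T *\<^sub>v x)) \<le> (s + \<tau>) * euclidean_norm x"
    if x: "x \<in> carrier_vec d" for x
  proof -
    define y where "y i = (U\<^sup>T *\<^sub>v x) $ i" for i
    \<comment> \<open>The minimum norm solution of \<open>G\<^sub>1 w\<close> = (first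
      \<open>k\<close> eigencoordinates of \<open>x\<close>), so that \<open>Om w\<close> agrees
      with \<open>x\<close> in these directions.\<close>
    define w where "w = Matrix.vec m (\<lambda>c. \<Sum>i<k. pinv k m G c i * y i)"
    have w: "w \<in> carrier_vec m" by (simp add: w_def)
    have Gw: "(U\<^sup>T *\<^sub>v (Om *\<^sub>v w)) $ i = (\<Sum>c<m. G (i, c) * (\<Sum>i<k. pinv k m G c i * y i))" if "i < d" for i
    proof -
      have "U\<^sup>T *\<^sub>v (Om *\<^sub>v w) = (U\<^sup>T * Om) *\<^sub>v w"
        using TU Om w by (intro assoc_mult_mat_vec[symmetric, of _ d d _ m]) auto
      also have "\<dots> $ i = (\<Sum>c<m. (U\<^sup>T * Om) $$ (i, c) * w $ c)"
        by (rule mult_mat_vec_index[OF mult_carrier_mat[OF TU Om] w that])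
      finally show ?thesis using that by (simp add: G w_def)
    qed
    have w1: "(U\<^sup>T *\<^sub>v (Om *\<^sub>v w)) $ i = (U\<^sup>T *\<^sub>v x) $ i" if "i < k" for i
      using that kd by (simp add: Gw pinv_right_inverse[OF det] y_def)
    define n where "n = L2_set (\<lambda>i. \<mu> i * (U\<^sup>T *\<^sub>v (Om *\<^sub>v w)) $ i) {k..<d}"
    define N where "N j i = (\<Sum>c<m. \<mu> j * G (j, c) * pinv k m G c i)" for j i
    have N: "(\<Sum>i<k. N j i * z i) = \<mu> j * (\<Sum>c<m. G (j, c) * (\<Sum>i<k. pinv k m G c i * z i))" for j z
      unfolding N_def sum_distrib_left sum_distrib_right by (subst sum.swap) (simp add: mult.assoc)
    have n: "n = sqrt (\<Sum>j\<in>{k..<d}. (\<Sum>i<k. N j i * y i)\<^sup>2)"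
      unfolding n_def L2_set_def by (intro arg_cong[of _ _ sqrt] sum.cong) (auto simp: N Gw)
    have tm: "ennreal T = (\<integral>\<^sup>+z. ennreal (sqrt (\<Sum>j\<in>{k..<d}. (\<Sum>i<k. N j i * z i)\<^sup>2) ^ r) \<partial>gaussian {..<k})"
      unfolding N power_mult_distrib using real by (simp add: test_moment_def \<mu>_def)
    have "ennreal (n ^ r * abs_moment r) \<le> ennreal (sqrt (\<Sum>i<k. (y i)\<^sup>2) ^ r) * ennreal T"
      unfolding n tm by (rule operator_norm_le_gaussian_average) (use r in auto)
    also have "\<dots> \<le> ennreal (euclidean_norm x ^ r) * ennreal T"
    proof (intro mult_right_mono ennreal_leI power_mono)
      have "U\<^sup>T *\<^sub>v x \<in> carrier_vec d" using TU x by simp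
      then have "euclidean_norm x = sqrt (\<Sum>i<d. (y i)\<^sup>2)"
        unfolding euclidean_norm_transpose_orthogonal[OF U x, symmetric] y_def
        by (simp add: euclidean_norm_L2_set L2_set_def)
      then show "sqrt (\<Sum>i<k. (y i)\<^sup>2) \<le> euclidean_norm x" using kd by (auto intro!: sum_mono2)
    qed (auto simp: sum_nonneg)
    also have "\<dots> = ennreal (euclidean_norm x ^ r * T)"
      using T by (simp add: ennreal_mult euclidean_norm_nonneg)
    finally have "n ^ r * abs_moment r \<le> euclidean_norm x ^ r * T"
      using T euclidean_norm_nonneg[of x] by (subst (asm) ennreal_le_iff) auto
    then have "n ^ r \<le> (\<tau> * euclidean_norm x) ^ r"
      using am by (simp add: power_mult_distrib \<tau>(2) field_simps)
    then have "n \<le> \<tau> * euclidean_norm x"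
      using r \<tau> euclidean_norm_nonneg[of x] by (subst (asm) power_mono_iff) (auto simp: n_def L2_set_nonneg)
    then have w2: "L2_set (\<lambda>i. \<mu> i * (U\<^sup>T *\<^sub>v (Om *\<^sub>v w)) $ i) {k..<d} \<le> \<tau> * euclidean_norm x"
      by (simp add: n_def)
    show ?thesis
      by (rule compl_proj_deterministic_bound[OF U Q Om R BOm[unfolded Beq] _ s kd x w w1 w2])
        (use \<nu> in \<open>auto simp: \<mu>_def simp del: power_Suc\<close>)
  qed
  then have "approximation_error (eig_power d U \<nu> 1) Q ^ Suc q \<le> s + \<tau>"
    using s \<tau> by (intro approximation_error_power_le[OF U Q]) (auto simp: Beq)
  then have "max 0 (approximation_error (eig_power d U \<nu> 1) Q ^ Suc q - s) ^ r \<le> \<tau> ^ r"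
    using \<tau> by (intro power_mono) auto
  then have "max 0 (approximation_error (eig_power d U \<nu> 1) Q ^ Suc q - s) ^ r * abs_moment r \<le> T"
    using am by (simp add: \<tau>(2) field_simps)
  then show ?thesis unfolding real by (rule ennreal_leI)
qed simp

section \<open>The expected error\<close>

lemma measurable_completion_AE:
  assumes g: "g \<in> borel_measurable M" and ae: "AE x in M. f x = g x"
  shows "(f :: 'a \<Rightarrow> real) \<in> borel_measurable (completion M)"
proof (rule measurableI)
  fix A :: "real set" assume A: "A \<in> sets borel"
  have "Measurable.pred (completion M) (\<lambda>x. f x \<in> A \<and> f x \<noteq> g x)"
    by (rule sets_completion_AE) (use ae in eventually_elim, auto)
  moreover have "Measurable.pred (completion M) (\<lambda>x. f x \<noteq> g x)"
    by (rule sets_completion_AE) (use ae in eventually_elim, auto)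
  moreover have "Measurable.pred (completion M) (\<lambda>x. g x \<in> A)"
    by (rule measurable_completion) (use g A in measurable)
  ultimately have "({x \<in> space (completion M). g x \<in> A} - {x \<in> space (completion M). f x \<noteq> g x}) \<union>
      {x \<in> space (completion M). f x \<in> A \<and> f x \<noteq> g x} \<in> sets (completion M)"
    unfolding pred_def by (intro sets.Un sets.Diff)
  also have "({x \<in> space (completion M). g x \<in> A} - {x \<in> space (completion M). f x \<noteq> g x}) \<union>
      {x \<in> space (completion M). f x \<in> A \<and> f x \<noteq> g x} = f -` A \<inter> space (completion M)"
    by auto
  finally show "f -` A \<inter> space (completion M) \<in> sets (completion M)" .
qed simp

text \<open>The tangent of x^(n + 1) at \<open>a\<close>. Integrated at a = E X it gives Jensen's
  inequality for powers.\<close>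

lemma power_tangent_le:
  fixes x a :: real
  assumes "x \<ge> 0" "a \<ge> 0"
  shows "a ^ Suc n + real (Suc n) * a ^ n * (x - a) \<le> x ^ Suc n"
proof (induction n)
  case (Suc n)
  have "0 \<le> real (Suc n) * a ^ n * (x - a)\<^sup>2" using assms by simp
  moreover have "x * (a ^ Suc n + real (Suc n) * a ^ n * (x - a)) \<le> x * x ^ Suc n"
    using Suc assms(1) by (rule mult_left_mono)
  ultimately show ?case by (simp add: algebra_simps power2_eq_square)
qed simp

lemma (in prob_space) expectation_power_le:
  fixes X :: "'a \<Rightarrow> real"
  assumes X: "X \<in> borel_measurable M" "\<And>x. x \<in> space M \<Longrightarrow> 0 \<le> X x \<and> X x \<le> C"
  shows "expectation X ^ Suc n \<le> expectation (\<lambda>x. X x ^ Suc n)"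
proof -
  define a where "a = expectation X"
  have a: "a \<ge> 0" unfolding a_def using X by (intro Bochner_Integration.integral_nonneg) auto
  have iX: "integrable M X"
    using X by (intro integrable_const_bound[of _ C]) auto
  have iP: "integrable M (\<lambda>x. X x ^ Suc n)"
    using X by (intro integrable_const_bound[of _ "C ^ Suc n"] AE_I2) (auto intro!: power_mono simp del: power_Suc)
  have "a ^ Suc n = expectation (\<lambda>x. a ^ Suc n + real (Suc n) * a ^ n * (X x - a))"
    using iX by (simp add: prob_space a_def)
  also have "\<dots> \<le> expectation (\<lambda>x. X x ^ Suc n)"
    using iX iP X(2) a by (intro integral_mono power_tangent_le) auto
  finally show ?thesis by (simp add: a_def)
qed

section \<open>The law of the sketch and of its rotations\<close>

lemma distr_gaussian_rotate_rows:
  fixes v :: "'i \<Rightarrow> 'i \<Rightarrow> real" and J :: "'j set"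
  assumes I: "finite I" and J: "finite J"
    and rows: "\<And>i i'. i \<in> I \<Longrightarrow> i' \<in> I \<Longrightarrow> (\<Sum>j\<in>I. v i j * v i' j) = (if i = i' then 1 else 0)"
    and cols: "\<And>j j'. j \<in> I \<Longrightarrow> j' \<in> I \<Longrightarrow> (\<Sum>i\<in>I. v i j * v i j') = (if j = j' then 1 else 0)"
  defines "\<rho> \<equiv> \<lambda>x. \<lambda>(i, c)\<in>I \<times> J. \<Sum>i'\<in>I. v i i' * x (i', c)"
  shows "\<rho> \<in> measurable (gaussian (I \<times> J)) (gaussian (I \<times> J))"
    and "distr (gaussian (I \<times> J)) (gaussian (I \<times> J)) \<rho> = gaussian (I \<times> J)"
proof -
  have comp: "(\<lambda>x. x (i, c)) \<in> borel_measurable (gaussian (I \<times> J))" if "i \<in> I" "c \<in> J" for i c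
    using that by (intro borel_measurable_gaussian_component) simp
  have "(\<lambda>x. \<Sum>i'\<in>I. v i i' * x (i', c)) \<in> borel_measurable (gaussian (I \<times> J))" if "c \<in> J" for i c
    using that by (intro borel_measurable_sum borel_measurable_times comp) auto
  then show m: "\<rho> \<in> measurable (gaussian (I \<times> J)) (gaussian (I \<times> J))"
    unfolding \<rho>_def
    by (simp cong: measurable_cong_sets add: sets_gaussian) (intro measurable_restrict, auto)
  show "distr (gaussian (I \<times> J)) (gaussian (I \<times> J)) \<rho> = gaussian (I \<times> J)"
  proof (rule measure_eqI)
    fix A assume "A \<in> sets (distr (gaussian (I \<times> J)) (gaussian (I \<times> J)) \<rho>)"
    then have A: "A \<in> sets (gaussian (I \<times> J))" by simp
    have "emeasure (distr (gaussian (I \<times> J)) (gaussian (I \<times> J)) \<rho>) A = (\<integral>\<^sup>+x. indicator A (\<rho> x) \<partial>gaussian (I \<times> J))"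
      using A m by (subst nn_integral_indicator[symmetric], simp, subst nn_integral_distr) auto
    also have "\<dots> = (\<integral>\<^sup>+x. indicator A x \<partial>gaussian (I \<times> J))"
      unfolding \<rho>_def using A by (intro nn_integral_gaussian_rotate_rows[OF I J _ rows cols]) auto
    finally show "emeasure (distr (gaussian (I \<times> J)) (gaussian (I \<times> J)) \<rho>) A = emeasure (gaussian (I \<times> J)) A"
      using A by simp
  qed simp
qed

lemma distr_standard_gaussian_matrix:
  assumes P: "prob_space P" and g: "standard_gaussian_matrix P d m Omega" and dm: "d > 0" "m > 0"
  defines "X \<equiv> \<lambda>\<omega>. \<lambda>p\<in>{..<d} \<times> {..<m}. Omega \<omega> $$ p"
  shows "X \<in> measurable P (gaussian ({..<d} \<times> {..<m}))"
    and "distr P (gaussian ({..<d} \<times> {..<m})) X = gaussian ({..<d} \<times> {..<m})"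
proof -
  interpret prob_space P by (rule P)
  let ?D = "{..<d} \<times> {..<m}"
  have ind: "indep_vars (\<lambda>_. borel) (\<lambda>p \<omega>. Omega \<omega> $$ p) ?D"
    and dens: "\<And>p. p \<in> ?D \<Longrightarrow> distributed P lborel (\<lambda>\<omega>. Omega \<omega> $$ p) (\<lambda>x. ennreal (std_normal_density x))"
    using g by (auto simp: standard_gaussian_matrix_def)
  have rv: "random_variable borel (\<lambda>\<omega>. Omega \<omega> $$ p)" if "p \<in> ?D" for p
    using distributed_measurable[OF dens[OF that]] by simp
  have Xm: "X \<in> measurable P (\<Pi>\<^sub>M p\<in>?D. borel)"
    unfolding X_def using rv by (intro measurable_restrict) auto
  then show "X \<in> measurable P (gaussian ?D)"
    by (simp cong: measurable_cong_sets add: sets_gaussian)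
  have ne: "?D \<noteq> {}" using dm by auto
  have "distr P (gaussian ?D) X = distr P (\<Pi>\<^sub>M p\<in>?D. borel) X"
    by (rule distr_cong) (simp_all add: sets_gaussian)
  also have "\<dots> = (\<Pi>\<^sub>M p\<in>?D. distr P borel (\<lambda>\<omega>. Omega \<omega> $$ p))"
    unfolding X_def using indep_vars_iff_distr_eq_PiM'[OF ne, where M' = "\<lambda>_. borel" and X = "\<lambda>p \<omega>. Omega \<omega> $$ p"] rv ind by auto
  also have "\<dots> = gaussian ?D"
    unfolding gaussian_def
  proof (rule PiM_cong[OF refl])
    fix p assume p: "p \<in> ?D"
    have "distr P borel (\<lambda>\<omega>. Omega \<omega> $$ p) = distr P lborel (\<lambda>\<omega>. Omega \<omega> $$ p)"
      by (rule distr_cong) simp_all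
    also have "\<dots> = std_normal"
      unfolding std_normal_def by (rule distributed_distr_eq_density[OF dens[OF p]])
    finally show "distr P borel (\<lambda>\<omega>. Omega \<omega> $$ p) = std_normal" .
  qed
  finally show "distr P (gaussian ?D) X = gaussian ?D" .
qed

section \<open>The projection as a function of the sketch\<close>

lemma mult_mat_index:
  assumes "A \<in> carrier_mat n m" "B \<in> carrier_mat m p" "i < n" "j < p"
  shows "(A * B) $$ (i, j) = (\<Sum>l<m. A $$ (i, l) * B $$ (l, j))"
  using assms by (auto simp: scalar_prod_def atLeast0LessThan intro!: sum.cong)

text \<open>If \<open>B \<Omega>\<close> has full column rank, then \<open>Q Q\<^sup>T\<close> is the orthogonal projection onto its range, whatever
  QR factorization was chosen.\<close>

lemma projection_eq_pinv:
  assumes Q: "Q \<in> carrier_mat d m" "Q\<^sup>T * Q = 1\<^sub>m m" and R: "R \<in> carrier_mat m m"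
    and Y: "Y = Q * R" and inj: "\<And>v. v \<in> carrier_vec m \<Longrightarrow> Y *\<^sub>v v = 0\<^sub>v d \<Longrightarrow> v = 0\<^sub>v m"
    and cc: "c < d" "c' < d"
  shows "(Q * Q\<^sup>T) $$ (c, c') = (\<Sum>i<m. pinv m d (\<lambda>(i, c). Y $$ (c, i)) c i * Y $$ (c', i))"
proof -
  \<comment> \<open>The rows of \<open>?G\<close> are the columns of \<open>Y\<close>, so
    \<open>pinv m d ?G\<close> is \<open>Y (Y\<^sup>T Y)\<^sup>-\<^sup>1\<close>.\<close>
  let ?G = "\<lambda>(i, c). Y $$ (c, i)"
  have Yc: "Y \<in> carrier_mat d m" using Q R Y by auto
  have T: "Q\<^sup>T \<in> carrier_mat m d" "R\<^sup>T \<in> carrier_mat m m" "Y\<^sup>T \<in> carrier_mat m d"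
    using Q R Yc by auto
  define W where "W = gram m d ?G"
  have Wc: "W \<in> carrier_mat m m" by (simp add: W_def gram_def)
  have "W = Y\<^sup>T * Y"
    unfolding W_def gram_def using Yc by (intro eq_matI) (auto simp: scalar_prod_def atLeast0LessThan)
  also have "\<dots> = R\<^sup>T * Q\<^sup>T * (Q * R)"
    unfolding Y using Q R by (subst transpose_mult[of _ d m _ m]) auto
  also have "\<dots> = R\<^sup>T * (Q\<^sup>T * (Q * R))"
    using Q R T by (intro assoc_mult_mat[of _ m m _ d _ m]) auto
  also have "Q\<^sup>T * (Q * R) = Q\<^sup>T * Q * R"
    using Q R T by (intro assoc_mult_mat[symmetric, of _ m d _ m _ m]) auto
  also have "\<dots> = R" unfolding Q(2) by (rule left_mult_one_mat[OF R])
  finally have W: "W = R\<^sup>T * R" .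
  have "det R \<noteq> 0"
  proof
    assume "det R = 0"
    then obtain v where v: "v \<in> carrier_vec m" "v \<noteq> 0\<^sub>v m" "R *\<^sub>v v = 0\<^sub>v m"
      using det_0_iff_vec_prod_zero[OF R] by auto
    have "Y *\<^sub>v v = Q *\<^sub>v (R *\<^sub>v v)" unfolding Y by (rule assoc_mult_mat_vec[OF Q(1) R v(1)])
    then have "Y *\<^sub>v v = 0\<^sub>v d" using Q v by auto
    then show False using inj v by auto
  qed
  then have dW: "det W \<noteq> 0" unfolding W using det_mult[OF T(2) R] det_transpose[OF R] by simp
  define V where "V = (1 / det W) \<cdot>\<^sub>m adj_mat W"
  have V: "V \<in> carrier_mat m m" using adj_mat(1)[OF Wc] by (simp add: V_def)
  have WV: "W * V = 1\<^sub>m m"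
    unfolding V_def using Wc adj_mat[OF Wc] dW
    by (subst mult_smult_distrib[of _ m m _ m]) (auto intro!: eq_matI)
  have RV: "R * V \<in> carrier_mat m m" using R V by auto
  have "R\<^sup>T * (R * V) = 1\<^sub>m m"
    using WV unfolding W using T R V by (subst assoc_mult_mat[symmetric, of _ m m _ m _ m]) auto
  \<comment> \<open>For square matrices the right inverse \<open>R * V\<close> of
    \<open>R\<^sup>T\<close> is also a left inverse. This makes \<open>Y * V * Y\<^sup>T\<close>
    collapse to \<open>Q * Q\<^sup>T\<close>, independent of \<open>R\<close>.\<close>
  from mat_mult_left_right_inverse[OF T(2) RV this] have RVR: "R * V * R\<^sup>T = 1\<^sub>m m" .
  have "Y * V * Y\<^sup>T = Q * (R * V * R\<^sup>T) * Q\<^sup>T"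
  proof -
    have "Y * V * Y\<^sup>T = Q * (R * V) * (R\<^sup>T * Q\<^sup>T)"
      unfolding Y using Q R V T
      by (subst transpose_mult[of _ d m _ m], simp, simp, subst assoc_mult_mat[of _ d m _ m _ m]) auto
    also have "\<dots> = Q * ((R * V) * (R\<^sup>T * Q\<^sup>T))"
      using Q RV T by (intro assoc_mult_mat[of _ d m _ m _ d]) auto
    also have "(R * V) * (R\<^sup>T * Q\<^sup>T) = (R * V * R\<^sup>T) * Q\<^sup>T"
      using RV T by (intro assoc_mult_mat[symmetric, of _ m m _ m _ d]) auto
    also have "Q * ((R * V * R\<^sup>T) * Q\<^sup>T) = Q * (R * V * R\<^sup>T) * Q\<^sup>T"
      using Q RV T by (intro assoc_mult_mat[symmetric, of _ d m _ m _ d]) auto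
    finally show ?thesis .
  qed
  also have "\<dots> = Q * Q\<^sup>T" unfolding RVR using Q by auto
  finally have "(Q * Q\<^sup>T) $$ (c, c') = (Y * V * Y\<^sup>T) $$ (c, c')" by simp
  also have "\<dots> = (\<Sum>i<m. (Y * V) $$ (c, i) * Y\<^sup>T $$ (i, c'))"
    by (rule mult_mat_index[OF mult_carrier_mat[OF Yc V] T(3) cc])
  also have "\<dots> = (\<Sum>i<m. (Y * V) $$ (c, i) * Y $$ (c', i))"
    using cc Yc by (intro sum.cong) auto
  also have "\<dots> = (\<Sum>i<m. pinv m d ?G c i * Y $$ (c', i))"
  proof (intro sum.cong refl arg_cong2[of _ _ _ _ "(*)"])
    fix i assume i: "i \<in> {..<m}"
    have "(Y * V) $$ (c, i) = (\<Sum>l<m. Y $$ (c, l) * V $$ (l, i))"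
      using i by (intro mult_mat_index[OF Yc V cc(1)]) simp
    also have "\<dots> = pinv m d ?G c i"
      using i adj_mat(1)[OF Wc] by (simp add: pinv_def V_def W_def[symmetric] sum_divide_distrib)
    finally show "(Y * V) $$ (c, i) = pinv m d ?G c i" .
  qed
  finally show ?thesis .
qed

text \<open>The eigenvalues are positive, so the power of the matrix has trivial kernel; what
  remains is the kernel of \<open>Om\<close>, trivial because of its nonsingular leading
  block.\<close>

lemma sketch_injective:
  assumes U: "orthogonal_mat d U" and Om: "Om \<in> carrier_mat d m" and md: "m \<le> d"
    and \<nu>: "\<And>i. i < d \<Longrightarrow> \<nu> i > 0" and det: "det (leading_block m (($$) Om)) \<noteq> 0"
    and v: "v \<in> carrier_vec m" and 0: "(eig_power d U \<nu> e * Om) *\<^sub>v v = 0\<^sub>v d"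
  shows "v = 0\<^sub>v m"
proof (rule ccontr)
  assume v0: "v \<noteq> 0\<^sub>v m"
  have Uc: "U \<in> carrier_mat d d" and UU: "U * U\<^sup>T = 1\<^sub>m d" using U by (auto simp: orthogonal_mat_def)
  have Ov: "Om *\<^sub>v v \<in> carrier_vec d" using Om v by auto
  have TOv: "U\<^sup>T *\<^sub>v (Om *\<^sub>v v) \<in> carrier_vec d" using Uc Ov by auto
  have "eig_power d U \<nu> e *\<^sub>v (Om *\<^sub>v v) = 0\<^sub>v d"
    using 0 assoc_mult_mat_vec[OF eig_power_carrier[OF U] Om v] by simp
  moreover have "U\<^sup>T *\<^sub>v 0\<^sub>v d = 0\<^sub>v d" using Uc by auto
  ultimately have "\<nu> i ^ e * (U\<^sup>T *\<^sub>v (Om *\<^sub>v v)) $ i = 0" if "i < d" for i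
    using eig_power_coord[OF U Ov that, of \<nu> e] that by simp
  then have "(U\<^sup>T *\<^sub>v (Om *\<^sub>v v)) $ i = 0" if "i < d" for i
    using \<nu>[OF that] that by fastforce
  then have "U\<^sup>T *\<^sub>v (Om *\<^sub>v v) = 0\<^sub>v d" using Uc by (intro eq_vecI) auto
  then have "euclidean_norm (Om *\<^sub>v v) = 0"
    using euclidean_norm_transpose_orthogonal[OF U Ov] by simp
  then have "scalar_prod (Om *\<^sub>v v) (Om *\<^sub>v v) = 0"
    using euclidean_norm_square[of "Om *\<^sub>v v"] by simp
  then have Ov0: "Om *\<^sub>v v = 0\<^sub>v d" using scalar_prod_self_pos[OF Ov] by fastforce
  have "leading_block m (($$) Om) *\<^sub>v v = 0\<^sub>v m"
  proof (rule eq_vecI)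
    fix i assume "i < dim_vec (0\<^sub>v m :: real vec)"
    then have i: "i < m" by simp
    have "(leading_block m (($$) Om) *\<^sub>v v) $ i = (\<Sum>c<m. Om $$ (i, c) * v $ c)"
      using i v by (subst mult_mat_vec_index[of _ m m]) auto
    also have "\<dots> = (Om *\<^sub>v v) $ i" using i md mult_mat_vec_index[OF Om v] by simp
    finally show "(leading_block m (($$) Om) *\<^sub>v v) $ i = 0\<^sub>v m $ i" using Ov0 i md by simp
  qed simp
  then show False using det v v0 det_0_iff_vec_prod_zero[of "leading_block m (($$) Om)" m] by auto
qed

text \<open>Taking r-th roots with r! \<ge> (l / e)^r gives the factor e / l, and sqrt (F^2 + r s^2)
  \<le> F + sqrt r * s separates the two terms. The constant 4 comes from e * r \<le> 4 * l, that
  is, e * sqrt r / l \<le> 4 / sqrt r.\<close>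

lemma error_constants:
  fixes s F E :: real
  assumes r: "r \<ge> 1" and l: "l = r + 1" and nn: "s \<ge> 0" "F \<ge> 0" "E \<ge> 0"
    and E: "E ^ r \<le> sqrt (F\<^sup>2 + r * s\<^sup>2) ^ r * sqrt (real (k + r)) ^ r / fact r"
  shows "s + E \<le> (1 + 4 * sqrt (real (k + l) / (real l - 1))) * s + exp 1 * sqrt (real (k + l)) / real l * F"
proof -
  define A where "A = sqrt (F\<^sup>2 + r * s\<^sup>2) * sqrt (real (k + r)) * (exp 1 / real l)"
  have A: "A \<ge> 0" using nn by (simp add: A_def)
  have "(real r + 1) / exp 1 * (exp 1 / real l) = 1" by (simp add: l add.commute[of 1])
  then have "((real r + 1) / exp 1) ^ r * (exp 1 / real l) ^ r = 1"
    by (simp only: power_mult_distrib[symmetric] power_one)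
  moreover have "((real r + 1) / exp 1) ^ r * (exp 1 / real l) ^ r \<le> fact r * (exp 1 / real l) ^ r"
    by (intro mult_right_mono fact_ge_power_div_exp) simp
  ultimately have f: "1 / fact r \<le> (exp 1 / real l) ^ r" by (simp add: field_simps)
  have "E ^ r \<le> sqrt (F\<^sup>2 + r * s\<^sup>2) ^ r * sqrt (real (k + r)) ^ r * (1 / fact r)" using E by simp
  also have "\<dots> \<le> sqrt (F\<^sup>2 + r * s\<^sup>2) ^ r * sqrt (real (k + r)) ^ r * (exp 1 / real l) ^ r"
    by (intro mult_left_mono f) (simp add: nn)
  also have "\<dots> = A ^ r" by (simp only: A_def power_mult_distrib)
  finally have EA: "E \<le> A" using r A nn by (subst (asm) power_mono_iff) auto
  have F: "sqrt (F\<^sup>2 + r * s\<^sup>2) \<le> F + sqrt (real r) * s"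
  proof (rule real_le_lsqrt)
    have "(F + sqrt (real r) * s)\<^sup>2 = F\<^sup>2 + r * s\<^sup>2 + 2 * F * (sqrt (real r) * s)"
      by (simp add: power2_sum power_mult_distrib)
    then show "F\<^sup>2 + r * s\<^sup>2 \<le> (F + sqrt (real r) * s)\<^sup>2" using nn by simp
  qed (use nn in auto)
  have "A \<le> (F + sqrt (real r) * s) * sqrt (real (k + l)) * (exp 1 / real l)"
    unfolding A_def using F nn by (intro mult_mono) (auto simp: l)
  also have "\<dots> = exp 1 * sqrt (real (k + l)) / real l * F + sqrt (real (k + l)) * s * (exp 1 * sqrt (real r) / real l)"
    by (simp add: algebra_simps)
  also have "exp 1 * sqrt (real r) / real l \<le> 4 / sqrt (real r)"
  proof -
    have "exp 1 * real r \<le> 3 * real r" using exp_le by (intro mult_right_mono) auto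
    also have "\<dots> \<le> 4 * real l" by (simp add: l)
    finally have "exp 1 * (sqrt (real r) * sqrt (real r)) \<le> 4 * real l" by simp
    then show ?thesis using r by (simp add: l field_simps)
  qed
  finally have "A \<le> exp 1 * sqrt (real (k + l)) / real l * F + sqrt (real (k + l)) * s * (4 / sqrt (real r))"
    using nn by (simp add: mult_left_mono)
  also have "sqrt (real (k + l)) * s * (4 / sqrt (real r)) = 4 * sqrt (real (k + l) / (real l - 1)) * s"
    by (simp add: l real_sqrt_divide)
  finally show ?thesis using EA by (simp add: algebra_simps)
qed

text \<open>The r-th moment is estimated only for the excess of err^(q + 1) over \<open>s\<close>;
  Jensen with exponent \<open>r\<close> gives its mean, and Jensen with exponent q + 1 moves the
  outer power from inside the expectation of the error to outside.\<close>

lemma expected_error_le: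
  fixes \<nu> :: "nat \<Rightarrow> real"
  assumes U: "orthogonal_mat d U"
    and pos: "\<And>i. i < d \<Longrightarrow> \<nu> i > 0" and anti: "\<And>i j. i \<le> j \<Longrightarrow> j < d \<Longrightarrow> \<nu> j \<le> \<nu> i"
    and kl: "1 \<le> k" "2 \<le> l" "k + l \<le> d"
    and P: "prob_space P" and gauss: "standard_gaussian_matrix P d (k + l) Omega"
    and out: "\<And>\<omega>. \<omega> \<in> space P \<Longrightarrow> subspace_iteration_output (eig_power d U \<nu> 1) (Omega \<omega>) q (Q \<omega>)"
  defines "err \<equiv> \<lambda>\<omega>. approximation_error (eig_power d U \<nu> 1) (Q \<omega>)"
  shows "integrable (completion P) err"
    and "integral\<^sup>L (completion P) err ^ Suc q \<le>
      (1 + 4 * sqrt (real (k + l) / (real l - 1))) * \<nu> k ^ Suc q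
      + exp 1 * sqrt (real (k + l)) / real l * sqrt (\<Sum>j\<in>{k..<d}. (\<nu> j ^ Suc q)\<^sup>2)"
proof -
  define m where "m = k + l"
  define r where "r = l - 1"
  have r: "r \<ge> 1" "m = k + r + 1" "l = r + 1" using kl by (auto simp: m_def r_def)
  have kd: "k \<le> d" "k < d" "m \<le> d" "k \<le> m" "d > 0" "m > 0" using kl by (auto simp: m_def)
  let ?D = "{..<d} \<times> {..<m}"
  let ?M = "eig_power d U \<nu> 1" and ?B = "eig_power d U \<nu> (Suc q)"
  have Mc: "?M \<in> carrier_mat d d" and Bc: "?B \<in> carrier_mat d d" by (rule eig_power_carrier[OF U])+
  have Uc: "U \<in> carrier_mat d d" and UU: "U\<^sup>T * U = 1\<^sub>m d" "U * U\<^sup>T = 1\<^sub>m d"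
    using U by (auto simp: orthogonal_mat_def)
  have TU: "U\<^sup>T \<in> carrier_mat d d" using Uc by simp
  interpret P: prob_space P by (rule P)
  interpret C: prob_space "completion P" by (rule P.prob_space_completion)
  have Om: "Omega \<omega> \<in> carrier_mat d m" if "\<omega> \<in> space P" for \<omega>
    using gauss that by (simp add: standard_gaussian_matrix_def m_def)
  have Qex: "\<exists>R. Q \<omega> \<in> carrier_mat d m \<and> (Q \<omega>)\<^sup>T * Q \<omega> = 1\<^sub>m m \<and> R \<in> carrier_mat m m \<and> ?B * Omega \<omega> = Q \<omega> * R"
    if "\<omega> \<in> space P" for \<omega>
    by (rule subspace_iteration_output_range[OF U Om[OF that] out[OF that]]) blast

  define X where "X = (\<lambda>\<omega>. \<lambda>p\<in>?D. Omega \<omega> $$ p)"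
  have Xm: "X \<in> measurable P (gaussian ?D)" and Xd: "distr P (gaussian ?D) X = gaussian ?D"
    using distr_standard_gaussian_matrix[OF P gauss[folded m_def]] kd unfolding X_def by auto
  \<comment> \<open>The indices of \<open>U\<close> are exchanged: \<open>\<rho>\<close> multiplies
    by the transpose, so \<open>G\<close> below has the entries of
    \<open>U\<^sup>T * Omega\<close>.\<close>
  define \<rho> where "\<rho> = (\<lambda>x. \<lambda>(i, c)\<in>?D. \<Sum>i'\<in>{..<d}. U $$ (i', i) * x (i', c))"
  have rows: "(\<Sum>j\<in>{..<d}. U $$ (j, i) * U $$ (j, i')) = (if i = i' then 1 else 0)" if "i \<in> {..<d}" "i' \<in> {..<d}" for i i'
    using mult_mat_index[OF TU Uc, of i i'] that Uc by (simp add: UU)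
  have cols: "(\<Sum>i\<in>{..<d}. U $$ (j, i) * U $$ (j', i)) = (if j = j' then 1 else 0)" if "j \<in> {..<d}" "j' \<in> {..<d}" for j j'
    using mult_mat_index[OF Uc TU, of j j'] that Uc by (simp add: UU)
  have \<rho>m: "\<rho> \<in> measurable (gaussian ?D) (gaussian ?D)" and \<rho>d: "distr (gaussian ?D) (gaussian ?D) \<rho> = gaussian ?D"
    unfolding \<rho>_def using distr_gaussian_rotate_rows[of "{..<d}" "{..<m}" "\<lambda>i i'. U $$ (i', i)"] rows cols by auto
  define G where "G \<omega> = \<rho> (X \<omega>)" for \<omega>
  have Gm: "G \<in> measurable P (gaussian ?D)" unfolding G_def by (rule measurable_compose[OF Xm \<rho>m])
  have Gd: "distr P (gaussian ?D) G = gaussian ?D"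
  proof -
    have "distr (distr P (gaussian ?D) X) (gaussian ?D) \<rho> = distr P (gaussian ?D) (\<rho> \<circ> X)"
      by (rule distr_distr[OF \<rho>m Xm])
    moreover have "\<rho> \<circ> X = G" by (simp add: fun_eq_iff G_def)
    ultimately show ?thesis by (simp add: Xd \<rho>d)
  qed
  have Geq: "G \<omega> (i, c) = (U\<^sup>T * Omega \<omega>) $$ (i, c)" if "\<omega> \<in> space P" "i < d" "c < m" for \<omega> i c
    using mult_mat_index[OF TU Om[OF that(1)] that(2,3)] that Uc
    by (simp add: G_def \<rho>_def X_def)

  \<comment> \<open>Two blocks matter: the m x m block of the sketch gives \<open>?B * Omega\<close>
    full column rank, and the k x k block of the rotated sketch makes \<open>pinv k m\<close> a
    genuine right inverse.\<close>
  have aeX: "AE \<omega> in P. det (leading_block m (X \<omega>)) \<noteq> 0"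
    by (rule AE_distrD[OF Xm], unfold Xd) (rule AE_gaussian_det_leading_block; use kd in simp)
  have aeG: "AE \<omega> in P. det (gram k m (G \<omega>)) \<noteq> 0"
  proof -
    have "AE \<omega> in P. det (leading_block k (G \<omega>)) \<noteq> 0"
      by (rule AE_distrD[OF Gm], unfold Gd) (rule AE_gaussian_det_leading_block; use kd in simp)
    then show ?thesis by eventually_elim (rule gram_nonsingular[OF kd(4)])
  qed

  \<comment> \<open>Stored transposed, since \<open>pinv\<close> inverts a block of rows. In
    \<open>err'\<close> the projection is written through \<open>Y\<close>, so it is a measurable
    function of the sketch alone.\<close>
  define Y where "Y \<omega> = (\<lambda>(i, c). \<Sum>a<d. ?B $$ (c, a) * Omega \<omega> $$ (a, i))" for \<omega>
  define err' where "err' \<omega> = spectral_norm (Matrix.mat d d (\<lambda>(c, c'). ?M $$ (c, c') -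
      (\<Sum>a<d. (\<Sum>i<m. pinv m d (Y \<omega>) c i * Y \<omega> (i, a)) * ?M $$ (a, c'))))" for \<omega>
  have Omm: "(\<lambda>\<omega>. Omega \<omega> $$ (a, i)) \<in> borel_measurable P" if "a < d" "i < m" for a i
    using measurable_compose[OF Xm borel_measurable_gaussian_component[of "(a, i)" ?D]] that by (simp add: X_def)
  have Ym: "(\<lambda>\<omega>. Y \<omega> (i, c)) \<in> borel_measurable P" if "i < m" for i c
    unfolding Y_def using that by (simp, intro borel_measurable_sum borel_measurable_times borel_measurable_const Omm) auto
  have err'm: "err' \<in> borel_measurable P"
    unfolding err'_def[abs_def]
    by (intro borel_measurable_spectral_norm borel_measurable_diff borel_measurable_const borel_measurable_sum
      borel_measurable_times borel_measurable_pinv Ym) auto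
  have "AE \<omega> in P. err \<omega> = err' \<omega>"
    using aeX AE_space
  proof eventually_elim
    fix \<omega> assume det: "det (leading_block m (X \<omega>)) \<noteq> 0" and \<omega>: "\<omega> \<in> space P"
    obtain R where Q: "Q \<omega> \<in> carrier_mat d m" "(Q \<omega>)\<^sup>T * Q \<omega> = 1\<^sub>m m" and R: "R \<in> carrier_mat m m"
      and BQ: "?B * Omega \<omega> = Q \<omega> * R" using Qex[OF \<omega>] by auto
    have "leading_block m (X \<omega>) = leading_block m (($$) (Omega \<omega>))"
      using kd by (intro cong_mat) (auto simp: X_def)
    with det have det': "det (leading_block m (($$) (Omega \<omega>))) \<noteq> 0" by simp
    have inj: "v = 0\<^sub>v m" if "v \<in> carrier_vec m" "(?B * Omega \<omega>) *\<^sub>v v = 0\<^sub>v d" for v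
      using sketch_injective[OF U Om[OF \<omega>] kd(3) pos det' that] .
    have Yeq: "Y \<omega> (i, c) = (?B * Omega \<omega>) $$ (c, i)" if "i < m" "c < d" for i c
      using mult_mat_index[OF Bc Om[OF \<omega>] that(2,1)] by (simp add: Y_def)
    have proj: "(Q \<omega> * (Q \<omega>)\<^sup>T) $$ (c, a) = (\<Sum>i<m. pinv m d (Y \<omega>) c i * Y \<omega> (i, a))"
      if "c < d" "a < d" for c a
    proof -
      have "(Q \<omega> * (Q \<omega>)\<^sup>T) $$ (c, a)
        = (\<Sum>i<m. pinv m d (\<lambda>(i, c). (?B * Omega \<omega>) $$ (c, i)) c i * (?B * Omega \<omega>) $$ (a, i))"
        by (rule projection_eq_pinv[OF Q R BQ inj that])
      also have "\<dots> = (\<Sum>i<m. pinv m d (Y \<omega>) c i * Y \<omega> (i, a))"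
        using that by (intro sum.cong refl arg_cong2[of _ _ _ _ "(*)"] pinv_cong) (auto simp: Yeq)
      finally show ?thesis .
    qed
    have QQ: "Q \<omega> * (Q \<omega>)\<^sup>T \<in> carrier_mat d d" using Q by auto
    let ?R = "Matrix.mat d d (\<lambda>(c, c'). ?M $$ (c, c') -
      (\<Sum>a<d. (\<Sum>i<m. pinv m d (Y \<omega>) c i * Y \<omega> (i, a)) * ?M $$ (a, c')))"
    have "?M - Q \<omega> * (Q \<omega>)\<^sup>T * ?M = ?R"
    proof (rule eq_matI)
      fix c c' assume "c < dim_row (?R)"
        "c' < dim_col (?R)"
      then have c: "c < d" "c' < d" by auto
      have "(?M - Q \<omega> * (Q \<omega>)\<^sup>T * ?M) $$ (c, c') = ?M $$ (c, c') - (Q \<omega> * (Q \<omega>)\<^sup>T * ?M) $$ (c, c')"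
        by (rule index_minus_mat(1)) (use c mult_carrier_mat[OF QQ Mc] in auto)
      also have "(Q \<omega> * (Q \<omega>)\<^sup>T * ?M) $$ (c, c') = (\<Sum>a<d. (\<Sum>i<m. pinv m d (Y \<omega>) c i * Y \<omega> (i, a)) * ?M $$ (a, c'))"
        unfolding mult_mat_index[OF QQ Mc c] using c by (intro sum.cong refl) (simp add: proj)
      finally show "(?M - Q \<omega> * (Q \<omega>)\<^sup>T * ?M) $$ (c, c') = ?R $$ (c, c')"
        using c by simp
    qed (use mult_carrier_mat[OF QQ Mc] in auto)
    then show "err \<omega> = err' \<omega>" unfolding err_def err'_def approximation_error_def by (rule arg_cong)
  qed
  with err'm have errm: "err \<in> borel_measurable (completion P)" by (rule measurable_completion_AE)

  define N where "N = spectral_norm ?M"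
  have bnd: "0 \<le> err \<omega> \<and> err \<omega> \<le> N" if "\<omega> \<in> space (completion P)" for \<omega>
    using Qex[of \<omega>] that approximation_error_le_spectral_norm[OF Mc, of "Q \<omega>" m] approximation_error_nonneg
    by (auto simp: err_def N_def)
  show int: "integrable (completion P) err"
    using errm bnd by (intro C.integrable_const_bound[of _ N] AE_I2) auto

  define s where "s = \<nu> k ^ Suc q"
  define F where "F = sqrt (\<Sum>j\<in>{k..<d}. (\<nu> j ^ Suc q)\<^sup>2)"
  \<comment> \<open>Cutting off at 0 makes the powers of \<open>E\<close> monotone, while err^(q +
    1) \<le> s + E still holds.\<close>
  define E where "E \<omega> = max 0 (err \<omega> ^ Suc q - s)" for \<omega>
  have s: "s \<ge> 0" using pos kd by (simp add: s_def less_imp_le)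
  have \<nu>s: "0 \<le> \<nu> i \<and> \<nu> i ^ Suc q \<le> s" if "k \<le> i" "i < d" for i
    unfolding s_def using that pos[of i] anti[of k i] by (auto intro!: power_mono simp del: power_Suc)
  have F: "F \<ge> 0" by (simp add: F_def sum_nonneg)
  have am: "abs_moment r > 0" by (rule abs_moment_pos)
  have Em: "E \<in> borel_measurable (completion P)" unfolding E_def[abs_def] using errm by measurable
  have Ebnd: "0 \<le> E \<omega> \<and> E \<omega> \<le> N ^ Suc q" if "\<omega> \<in> space (completion P)" for \<omega>
  proof -
    have "err \<omega> ^ Suc q \<le> N ^ Suc q" using bnd[OF that] by (intro power_mono) auto
    moreover have "0 \<le> N ^ Suc q" using spectral_norm_nonneg by (simp add: N_def)
    ultimately show ?thesis using s by (auto simp: E_def simp del: power_Suc)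
  qed
  have iE: "integrable (completion P) E"
    using Em Ebnd by (intro C.integrable_const_bound[of _ "N ^ Suc q"] AE_I2) (auto simp del: power_Suc)
  have iEr: "integrable (completion P) (\<lambda>\<omega>. E \<omega> ^ r * abs_moment r)"
    using Em Ebnd am by (intro C.integrable_const_bound[of _ "(N ^ Suc q) ^ r * abs_moment r"] AE_I2)
      (auto simp: abs_mult intro!: mult_right_mono power_mono simp del: power_Suc)
  have iq: "integrable (completion P) (\<lambda>\<omega>. err \<omega> ^ Suc q)"
    using errm bnd by (intro C.integrable_const_bound[of _ "N ^ Suc q"] AE_I2) (auto intro!: power_mono simp del: power_Suc)

  \<comment> \<open>Nonnegative integrals over the completion and over \<open>P\<close> coincide;
    the passage to \<open>P\<close> makes the law of \<open>G\<close> available.\<close>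
  have "ennreal (C.expectation (\<lambda>\<omega>. E \<omega> ^ r * abs_moment r)) = (\<integral>\<^sup>+\<omega>. ennreal (E \<omega> ^ r * abs_moment r) \<partial>completion P)"
    using iEr Ebnd am by (intro nn_integral_eq_integral[symmetric] AE_I2) auto
  also have "\<dots> = (\<integral>\<^sup>+\<omega>. ennreal (E \<omega> ^ r * abs_moment r) \<partial>P)" by (rule nn_integral_completion)
  also have "\<dots> \<le> (\<integral>\<^sup>+\<omega>. test_moment d k m r (\<lambda>i. \<nu> i ^ Suc q) (G \<omega>) \<partial>P)"
  proof (rule nn_integral_mono_AE)
    show "AE \<omega> in P. ennreal (E \<omega> ^ r * abs_moment r) \<le> test_moment d k m r (\<lambda>i. \<nu> i ^ Suc q) (G \<omega>)"
      using aeG AE_space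
    proof eventually_elim
      fix \<omega> assume det: "det (gram k m (G \<omega>)) \<noteq> 0" and \<omega>: "\<omega> \<in> space P"
      obtain R where Q: "Q \<omega> \<in> carrier_mat d m" "(Q \<omega>)\<^sup>T * Q \<omega> = 1\<^sub>m m" and R: "R \<in> carrier_mat m m"
        and BQ: "?B * Omega \<omega> = Q \<omega> * R" using Qex[OF \<omega>] by auto
      show "ennreal (E \<omega> ^ r * abs_moment r) \<le> test_moment d k m r (\<lambda>i. \<nu> i ^ Suc q) (G \<omega>)"
        unfolding E_def err_def
        by (rule approximation_error_test_moment[OF U Q Om[OF \<omega>] R BQ \<nu>s s kd(1) Geq[OF \<omega>] det r(1)])
    qed
  qed
  also have "\<dots> = integral\<^sup>N (distr P (gaussian ?D) G) (test_moment d k m r (\<lambda>i. \<nu> i ^ Suc q))"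
    by (rule nn_integral_distr[symmetric, OF Gm]) (simp add: test_moment_measurable[OF kd(1)])
  also have "\<dots> \<le> ennreal (sqrt ((\<Sum>j\<in>{k..<d}. (\<nu> j ^ Suc q)\<^sup>2) + r * s\<^sup>2) ^ r * sqrt (real (k + r)) ^ r * (abs_moment r / fact r))"
    unfolding Gd using kl(1) kd(1) r \<nu>s by (intro nn_integral_test_moment_le power_mono) (auto simp del: power_Suc)
  also have "(\<Sum>j\<in>{k..<d}. (\<nu> j ^ Suc q)\<^sup>2) = F\<^sup>2" by (simp add: F_def sum_nonneg)
  finally have "C.expectation (\<lambda>\<omega>. E \<omega> ^ r * abs_moment r) \<le> sqrt (F\<^sup>2 + r * s\<^sup>2) ^ r * sqrt (real (k + r)) ^ r * (abs_moment r / fact r)"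
    using am by (subst (asm) ennreal_le_iff) (auto simp: less_imp_le)
  then have Er: "C.expectation (\<lambda>\<omega>. E \<omega> ^ r) \<le> sqrt (F\<^sup>2 + r * s\<^sup>2) ^ r * sqrt (real (k + r)) ^ r / fact r"
    using am by (simp add: field_simps)
  have "C.expectation E ^ r \<le> C.expectation (\<lambda>\<omega>. E \<omega> ^ r)"
    using C.expectation_power_le[OF Em Ebnd, of "r - 1"] r(1) by simp
  with Er have EE: "C.expectation E ^ r \<le> sqrt (F\<^sup>2 + r * s\<^sup>2) ^ r * sqrt (real (k + r)) ^ r / fact r" by simp
  have "C.expectation err ^ Suc q \<le> C.expectation (\<lambda>\<omega>. err \<omega> ^ Suc q)"
    by (rule C.expectation_power_le[OF errm bnd])
  also have "\<dots> \<le> C.expectation (\<lambda>\<omega>. s + E \<omega>)"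
    using iq iE by (intro integral_mono) (auto simp: E_def simp del: power_Suc)
  also have "\<dots> = s + C.expectation E" using iE by (simp add: P.prob_space)
  also have "\<dots> \<le> (1 + 4 * sqrt (real (k + l) / (real l - 1))) * s + exp 1 * sqrt (real (k + l)) / real l * F"
    using Ebnd by (intro error_constants[OF r(1,3) s F _ EE] Bochner_Integration.integral_nonneg) auto
  finally show "integral\<^sup>L (completion P) err ^ Suc q \<le>
      (1 + 4 * sqrt (real (k + l) / (real l - 1))) * \<nu> k ^ Suc q
      + exp 1 * sqrt (real (k + l)) / real l * sqrt (\<Sum>j\<in>{k..<d}. (\<nu> j ^ Suc q)\<^sup>2)"
    unfolding s_def F_def .
qed

text \<open>The multiset identity factors the characteristic polynomial over the complex numbers. As
  all roots are real and coefficientwise embedding is injective, the factorization descends to the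
  reals, where the spectral theorem applies in the order given by \<open>lam\<close>.\<close>

lemma T_SPD_eigenbasis:
  fixes A :: tensor and lam :: "nat \<Rightarrow> real"
  assumes A: "A \<in> carrier_tensor n n p" and spd: "T_SPD n A" and d: "d = n * p"
    and ev: "image_mset (\<lambda>j. complex_of_real (lam j)) (mset_set {1..d}) = T_eigenvalues n A"
  shows "\<exists>U. orthogonal_mat d U \<and> bcirc n A = eig_power d U (\<lambda>i. lam (Suc i)) 1 \<and> (\<forall>i<d. lam (Suc i) > 0)"
proof -
  interpret h: map_poly_inj_idom_hom complex_of_real ..
  let ?M = "bcirc n A"
  have M: "?M \<in> carrier_mat d d" using A d by (simp add: carrier_tensor_def bcirc_def Let_def)
  have sym: "?M\<^sup>T = ?M"
    and pd: "\<And>v. v \<in> carrier_vec d \<Longrightarrow> v \<noteq> 0\<^sub>v d \<Longrightarrow> 0 < scalar_prod v (?M *\<^sub>v v)"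
    using spd M by (auto simp: T_SPD_def symmetric_positive_definite_def)
  define es where "es = map (\<lambda>i. lam (Suc i)) [0..<d]"
  have "char_poly (map_mat complex_of_real ?M) = (\<Prod>x\<in>#T_eigenvalues n A. [:- x, 1:])"
    using complex_poly_decompose_multiset[of "char_poly (map_mat complex_of_real ?M)"]
      degree_monic_char_poly[of "map_mat complex_of_real ?M" d] M
    by (simp add: T_eigenvalues_def)
  also have "\<dots> = (\<Prod>j\<in>{1..d}. [:- complex_of_real (lam j), 1:])"
    unfolding ev[symmetric] by (simp add: image_mset.compositionality comp_def prod_unfold_prod_mset)
  finally have "map_poly complex_of_real (char_poly ?M) = (\<Prod>j\<in>{1..d}. [:- complex_of_real (lam j), 1:])"
    by (simp add: of_real_hom.char_poly_hom[OF M])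
  also have "\<dots> = map_poly complex_of_real (\<Prod>j\<in>{1..d}. [:- lam j, 1:])"
    by (simp add: h.hom_prod)
  finally have "char_poly ?M = (\<Prod>j\<in>{1..d}. [:- lam j, 1:])"
    by (simp only: h.eq_iff)
  also have "\<dots> = (\<Prod>i\<in>{0..<d}. [:- lam (Suc i), 1:])"
    by (rule prod.reindex_bij_witness[of _ Suc "\<lambda>j. j - 1"]) auto
  also have "\<dots> = (\<Prod>e\<leftarrow>es. [:- e, 1:])"
    by (simp add: es_def prod.distinct_set_conv_list[symmetric] comp_def)
  finally obtain U where U: "orthogonal_mat d U" and MU: "?M = U * mat_diag d (\<lambda>i. es ! i) * U\<^sup>T"
    using real_spectral_theorem[OF M sym] by blast
  have "mat_diag d (\<lambda>i. es ! i) = mat_diag d (\<lambda>i. lam (Suc i) ^ 1)"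
    by (intro eq_matI) (auto simp: mat_diag_def es_def)
  then have Me: "?M = eig_power d U (\<lambda>i. lam (Suc i)) 1" unfolding MU eig_power_def by simp
  have "lam (Suc i) > 0" if i: "i < d" for i
  proof -
    have Uc: "U \<in> carrier_mat d d" and UU: "U\<^sup>T * U = 1\<^sub>m d" using U by (auto simp: orthogonal_mat_def)
    let ?e = "unit_vec d i :: real vec"
    \<comment> \<open>Column \<open>i\<close> of \<open>U\<close> is a unit eigenvector, so its
      quadratic form equals \<open>lam (Suc i)\<close>; positive definiteness then gives the
      sign.\<close>
    define x where "x = U *\<^sub>v ?e"
    have x: "x \<in> carrier_vec d" unfolding x_def using Uc by auto
    have Mx: "?M *\<^sub>v x \<in> carrier_vec d" using M x by simp
    have Tx: "U\<^sup>T *\<^sub>v x = ?e"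
      unfolding x_def using Uc UU by (subst assoc_mult_mat_vec[symmetric, of _ d d _ d]) auto
    have "x \<noteq> 0\<^sub>v d"
    proof
      assume "x = 0\<^sub>v d"
      moreover have "U\<^sup>T *\<^sub>v 0\<^sub>v d = 0\<^sub>v d" using Uc by auto
      ultimately have "?e = 0\<^sub>v d" using Tx by simp
      then have "?e $ i = 0\<^sub>v d $ i" by simp
      then show False using i by simp
    qed
    then have "0 < scalar_prod x (?M *\<^sub>v x)" by (rule pd[OF x])
    also have "scalar_prod x (?M *\<^sub>v x) = scalar_prod (?M *\<^sub>v x) (U *\<^sub>v ?e)"
      using comm_scalar_prod[OF x Mx] by (simp add: x_def)
    also have "\<dots> = scalar_prod (U\<^sup>T *\<^sub>v (?M *\<^sub>v x)) ?e"
      using Uc Mx by (intro transpose_vec_mult_scalar[symmetric, of _ d d]) auto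
    also have "\<dots> = (U\<^sup>T *\<^sub>v (?M *\<^sub>v x)) $ i"
      using i Uc Mx by (intro scalar_prod_right_unit[of _ d]) auto
    also have "\<dots> = lam (Suc i)"
      unfolding Me using eig_power_coord[OF U x i, of "\<lambda>i. lam (Suc i)" 1] i by (simp add: Tx)
    finally show ?thesis .
  qed
  with U Me show ?thesis by blast
qed

text \<open>The bracket lies between \<kappa>^(q + 1) and C * \<kappa>^(q + 1) with \<open>C\<close>
  independent of \<open>q\<close>, and C^(1 / (q + 1)) tends to 1. The sqrt d in \<open>C\<close>
  accounts for at most \<open>d\<close> trailing eigenvalues, each at most
  \<open>\<kappa>\<close>.\<close>

lemma error_bound_tendsto:
  fixes lam :: "nat \<Rightarrow> real"
  assumes anti: "\<And>i j. 1 \<le> i \<Longrightarrow> i \<le> j \<Longrightarrow> j \<le> d \<Longrightarrow> lam j \<le> lam i"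
    and pos: "\<And>j. 1 \<le> j \<Longrightarrow> j \<le> d \<Longrightarrow> lam j > 0" and l: "l \<ge> 2" and kd: "k + 1 \<le> d"
  shows "(\<lambda>q. error_bound d k l lam q) \<longlonglongrightarrow> lam (k + 1)"
proof -
  define \<kappa> where "\<kappa> = lam (k + 1)"
  define a where "a = 1 + 4 * sqrt (real (k + l) / (real l - 1))"
  define b where "b = exp 1 * sqrt (real (k + l)) / real l"
  define C where "C = a + b * sqrt (real d)"
  define R where "R q = a * \<kappa> ^ (q + 1) + b * sqrt (\<Sum>j = k + 1..d. lam j ^ (2 * (q + 1)))" for q
  have \<kappa>: "\<kappa> > 0" using pos kd by (simp add: \<kappa>_def)
  have ab: "a \<ge> 1" "b \<ge> 0" using l by (simp_all add: a_def b_def)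
  then have C: "C > 0" by (simp add: C_def add_pos_nonneg)
  have eb: "error_bound d k l lam q = R q powr (1 / real (q + 1))" for q
    unfolding error_bound_def R_def a_def b_def \<kappa>_def ..
  have lo: "\<kappa> ^ (q + 1) \<le> R q" for q
  proof -
    have "0 \<le> (\<Sum>j = k + 1..d. lam j ^ (2 * (q + 1)))" by (intro sum_nonneg zero_le_even_power) simp
    then have "0 \<le> b * sqrt (\<Sum>j = k + 1..d. lam j ^ (2 * (q + 1)))" using ab by simp
    moreover have "1 * \<kappa> ^ (q + 1) \<le> a * \<kappa> ^ (q + 1)" using ab \<kappa> by (intro mult_right_mono) auto
    ultimately show ?thesis by (simp add: R_def)
  qed
  have hi: "R q \<le> C * \<kappa> ^ (q + 1)" for q
  proof -
    have "(\<Sum>j = k + 1..d. lam j ^ (2 * (q + 1))) \<le> (\<Sum>j = k + 1..d. \<kappa> ^ (2 * (q + 1)))"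
    proof (intro sum_mono power_mono)
      fix j assume "j \<in> {k + 1..d}"
      then show "lam j \<le> \<kappa>" "0 \<le> lam j" using anti[of "k + 1" j] pos[of j] by (auto simp: \<kappa>_def)
    qed
    also have "\<dots> \<le> real d * (\<kappa> ^ (q + 1))\<^sup>2"
      using \<kappa> by (simp add: power_mult[symmetric] mult.commute[of 2] mult_right_mono del: power_Suc)
    finally have "sqrt (\<Sum>j = k + 1..d. lam j ^ (2 * (q + 1))) \<le> sqrt (real d * (\<kappa> ^ (q + 1))\<^sup>2)"
      by (rule real_sqrt_le_mono)
    also have "\<dots> = sqrt (real d) * \<kappa> ^ (q + 1)" using \<kappa> by (simp only: real_sqrt_mult) simp
    finally have "b * sqrt (\<Sum>j = k + 1..d. lam j ^ (2 * (q + 1))) \<le> b * (sqrt (real d) * \<kappa> ^ (q + 1))"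
      using ab by (intro mult_left_mono)
    then show ?thesis by (simp add: R_def C_def algebra_simps)
  qed
  have root: "(\<kappa> ^ (q + 1)) powr (1 / real (q + 1)) = \<kappa>" for q
    using \<kappa> by (simp add: powr_realpow[symmetric] powr_powr del: power_Suc)
  have "(\<lambda>q. C powr (1 / real (q + 1)) * \<kappa>) \<longlonglongrightarrow> C powr 0 * \<kappa>"
    using C by (intro tendsto_mult tendsto_powr tendsto_const) (auto intro: LIMSEQ_Suc[OF lim_1_over_n, simplified])
  then have lim: "(\<lambda>q. C powr (1 / real (q + 1)) * \<kappa>) \<longlonglongrightarrow> \<kappa>" using C by simp
  have "(\<lambda>q. error_bound d k l lam q) \<longlonglongrightarrow> \<kappa>"
  proof (rule tendsto_sandwich[OF _ _ tendsto_const lim])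
    show "\<forall>\<^sub>F q in sequentially. \<kappa> \<le> error_bound d k l lam q"
    proof (intro always_eventually allI)
      fix q
      have "(\<kappa> ^ (q + 1)) powr (1 / real (q + 1)) \<le> R q powr (1 / real (q + 1))"
        using \<kappa> lo by (intro powr_mono2) auto
      then show "\<kappa> \<le> error_bound d k l lam q" unfolding root eb .
    qed
    show "\<forall>\<^sub>F q in sequentially. error_bound d k l lam q \<le> C powr (1 / real (q + 1)) * \<kappa>"
    proof (intro always_eventually allI)
      fix q
      have "0 \<le> \<kappa> ^ (q + 1)" using \<kappa> by simp
      then have "R q powr (1 / real (q + 1)) \<le> (C * \<kappa> ^ (q + 1)) powr (1 / real (q + 1))"
        using hi lo[of q] by (intro powr_mono2) auto
      also have "\<dots> = C powr (1 / real (q + 1)) * \<kappa>"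
        using C \<kappa> by (simp only: powr_mult root)
      finally show "error_bound d k l lam q \<le> C powr (1 / real (q + 1)) * \<kappa>" unfolding eb .
    qed
  qed
  then show ?thesis by (simp add: \<kappa>_def)
qed

theorem theorem4p1:
  fixes A :: tensor and n p d k l q :: nat and lam :: "nat \<Rightarrow> real"
    and P :: "'w measure" and Omega Q :: "'w \<Rightarrow> real mat"
  assumes "A \<in> carrier_tensor n n p"
    and "T_SPD n A"
    and "d = n * p"
    and "image_mset (\<lambda>j. complex_of_real (lam j)) (mset_set {1..d}) = T_eigenvalues n A"
    and "\<And>i j. 1 \<le> i \<Longrightarrow> i \<le> j \<Longrightarrow> j \<le> d \<Longrightarrow> lam j \<le> lam i"
    and "1 \<le> k" and "2 \<le> l" and "k + l \<le> d"
    and "prob_space P"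
    and "standard_gaussian_matrix P d (k + l) Omega"
    and "\<And>\<omega>. \<omega> \<in> space P \<Longrightarrow> subspace_iteration_output (bcirc n A) (Omega \<omega>) q (Q \<omega>)"
  shows "integrable (completion P) (\<lambda>\<omega>. approximation_error (bcirc n A) (Q \<omega>)) \<and>
    expected_error P (bcirc n A) Q \<le> error_bound d k l lam q \<and>
    (\<lambda>q'. error_bound d k l lam q') \<longlonglongrightarrow> lam (k + 1)"
proof -
  define \<nu> where "\<nu> i = lam (Suc i)" for i
  obtain U where U: "orthogonal_mat d U" and M: "bcirc n A = eig_power d U \<nu> 1"
    and pos: "\<And>i. i < d \<Longrightarrow> \<nu> i > 0"
    using T_SPD_eigenbasis[OF assms(1-4)] unfolding \<nu>_def by blast
  have anti: "\<nu> j \<le> \<nu> i" if "i \<le> j" "j < d" for i j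
    using assms(5)[of "Suc i" "Suc j"] that by (simp add: \<nu>_def)
  have lpos: "lam j > 0" if "1 \<le> j" "j \<le> d" for j
    using pos[of "j - 1"] that by (simp add: \<nu>_def)
  note bound = expected_error_le[OF U pos anti assms(6-10) assms(11)[unfolded M]]
  let ?E = "integral\<^sup>L (completion P) (\<lambda>\<omega>. approximation_error (eig_power d U \<nu> 1) (Q \<omega>))"
  let ?R = "(1 + 4 * sqrt (real (k + l) / (real l - 1))) * \<nu> k ^ Suc q
      + exp 1 * sqrt (real (k + l)) / real l * sqrt (\<Sum>j\<in>{k..<d}. (\<nu> j ^ Suc q)\<^sup>2)"
  have E: "?E \<ge> 0" by (intro Bochner_Integration.integral_nonneg approximation_error_nonneg)
  have "(\<Sum>j\<in>{k..<d}. (\<nu> j ^ Suc q)\<^sup>2) = (\<Sum>j = k + 1..d. lam j ^ (2 * (q + 1)))"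
    by (rule sum.reindex_bij_witness[of _ "\<lambda>j. j - 1" Suc])
      (auto simp: \<nu>_def power_mult[symmetric] mult.commute simp del: power_Suc)
  then have R: "error_bound d k l lam q = ?R powr (1 / real (q + 1))"
    by (simp add: error_bound_def \<nu>_def)
  \<comment> \<open>The identity between powers and \<open>powr\<close> requires a positive base;
    for a vanishing expectation both sides are 0.\<close>
  have "?E = (?E ^ Suc q) powr (1 / real (q + 1))"
  proof (cases "?E = 0")
    case False
    then have "?E > 0" using E by simp
    then show ?thesis by (simp add: powr_realpow[symmetric] powr_powr del: power_Suc)
  qed simp
  also have "\<dots> \<le> ?R powr (1 / real (q + 1))"
    using bound(2) E by (intro powr_mono2) auto
  finally have "expected_error P (bcirc n A) Q \<le> error_bound d k l lam q"
    unfolding expected_error_def M R .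
  moreover have "(\<lambda>q'. error_bound d k l lam q') \<longlonglongrightarrow> lam (k + 1)"
    using assms(5-8) lpos by (intro error_bound_tendsto) auto
  ultimately show ?thesis using bound(1) by (simp add: M)
qed

end
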